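(* Let $r,s\in(0,\infty)$. \begin{itemize} \item If $r\le s\le 2$, then $\Lambda(\ell_s(L_r))=[r,2]$. \item If $r\le 2\le s$, then $\Lambda(\ell_s(L_r))=[r,2]\cup\{s\}$. \item If $2\le r\le s$, then $\Lambda(\ell_s(L_r))=\{2,r,s\}$. \item If $s\le r\le 2$, then $\Lambda(\ell_s(L_r))=[r,2]\cup\{s\}$. \item If $\max\{2,s\}\le r$, then $\Lambda(\ell_s(L_r))=\{2,r,s\}$. \end{itemize}
   Context: Spaces are over the real or complex field. For a quasi-Banach space $X$, $\Lambda(X)=\{p\in(0,\infty] : \ell_p \text{ isomorphically embeds into } X\}$, with the convention that for $p=\infty$ the symbol $\ell_\infty$ means $c_0$. "Isomorphically embeds" means that there is a linear homeomorphism onto a closed subspace. $L_r=L_r([0,1])$ with Lebesgue measure, and $\ell_s(L_r)$ is the quasi-Banach space of sequences $(f_n)_{n=1}^\infty$ in $L_r$ with quasi-norm $(\sum_n\|f_n\|_{L_r}^s)^{1/s}<\infty$. *)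

theory Defs
  imports "HOL-Analysis.Analysis"
begin

text \<open>
  The spaces \<open>L\<^sub>r\<close> depend on the real parameter \<open>r\<close>, so (quasi-)normed spaces are records over an
  explicit carrier. Nothing is required of the data outside the carrier.
\<close>

record ('k, 'v) qspace =
  qcarrier :: "'v set"
  vadd :: "'v \<Rightarrow> 'v \<Rightarrow> 'v"
  vscale :: "'k \<Rightarrow> 'v \<Rightarrow> 'v"
  qnorm :: "'v \<Rightarrow> real"

definition qdist :: "('k::real_normed_field, 'v) qspace \<Rightarrow> 'v \<Rightarrow> 'v \<Rightarrow> real" where
  "qdist X x y = qnorm X (vadd X y (vscale X (-1) x))"

text \<open>
  For a quasi-norm the balls need not themselves be open, but they form a base of neighbourhoods
  of their centre for the following topology.
\<close>

definition qopen :: "('k::real_normed_field, 'v) qspace \<Rightarrow> 'v set \<Rightarrow> bool" where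
  "qopen X U \<longleftrightarrow> U \<subseteq> qcarrier X \<and>
     (\<forall>x\<in>U. \<exists>e>0. \<forall>y\<in>qcarrier X. qdist X x y < e \<longrightarrow> y \<in> U)"

definition qtopology :: "('k::real_normed_field, 'v) qspace \<Rightarrow> 'v topology" where
  "qtopology X = topology (qopen X)"

lemma istopology_qopen: "istopology (qopen X)"
  unfolding istopology_def
proof (intro conjI allI impI)
  fix S T assume S: "qopen X S" and T: "qopen X T"
  show "qopen X (S \<inter> T)"
    unfolding qopen_def
  proof (intro conjI ballI)
    show "S \<inter> T \<subseteq> qcarrier X" using S by (auto simp: qopen_def)
    fix x assume x: "x \<in> S \<inter> T"
    obtain d where "d > 0" "\<forall>y\<in>qcarrier X. qdist X x y < d \<longrightarrow> y \<in> S"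
      using S x unfolding qopen_def by blast
    moreover obtain e where "e > 0" "\<forall>y\<in>qcarrier X. qdist X x y < e \<longrightarrow> y \<in> T"
      using T x unfolding qopen_def by blast
    ultimately show "\<exists>e>0. \<forall>y\<in>qcarrier X. qdist X x y < e \<longrightarrow> y \<in> S \<inter> T"
      by (intro exI[of _ "min d e"]) auto
  qed
next
  fix K assume "\<forall>S\<in>K. qopen X S"
  then show "qopen X (\<Union>K)"
    unfolding qopen_def by (meson Sup_least UnionE UnionI)
qed

lemma openin_qtopology: "openin (qtopology X) U \<longleftrightarrow> qopen X U"
  by (simp add: qtopology_def istopology_qopen topology_inverse')

lemma topspace_qtopology: "topspace (qtopology X) = qcarrier X"
proof -
  have "qopen X (qcarrier X)"
    by (auto simp: qopen_def intro!: exI[of _ 1])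
  then show ?thesis
    by (metis openin_qtopology openin_subset openin_topspace qopen_def subset_antisym)
qed

definition qlinear ::
  "('k::real_normed_field, 'v) qspace \<Rightarrow> ('k, 'w) qspace \<Rightarrow> ('v \<Rightarrow> 'w) \<Rightarrow> bool" where
  "qlinear X Y T \<longleftrightarrow>
     T ` qcarrier X \<subseteq> qcarrier Y \<and>
     (\<forall>x\<in>qcarrier X. \<forall>y\<in>qcarrier X. T (vadd X x y) = vadd Y (T x) (T y)) \<and>
     (\<forall>c. \<forall>x\<in>qcarrier X. T (vscale X c x) = vscale Y c (T x))"

definition qembeds ::
  "('k::real_normed_field, 'v) qspace \<Rightarrow> ('k, 'w) qspace \<Rightarrow> bool" where
  "qembeds X Y \<longleftrightarrow> (\<exists>T. qlinear X Y T \<and>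
     embedding_map (qtopology X) (qtopology Y) T \<and>
     closedin (qtopology Y) (T ` qcarrier X))"

definition scalars :: "('k::real_normed_field, 'k) qspace" where
  "scalars = \<lparr>qcarrier = UNIV, vadd = (+), vscale = (*), qnorm = norm\<rparr>"

definition ell_sum ::
  "real \<Rightarrow> ('k::real_normed_field, 'v) qspace \<Rightarrow> ('k, nat \<Rightarrow> 'v) qspace" where
  "ell_sum s X =
     \<lparr>qcarrier = {f. (\<forall>n. f n \<in> qcarrier X) \<and> summable (\<lambda>n. qnorm X (f n) powr s)},
      vadd = (\<lambda>f g n. vadd X (f n) (g n)),
      vscale = (\<lambda>c f n. vscale X c (f n)),
      qnorm = (\<lambda>f. (\<Sum>n. qnorm X (f n) powr s) powr (1 / s))\<rparr>"

definition c_zero :: "('k::real_normed_field, nat \<Rightarrow> 'k) qspace" where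
  "c_zero =
     \<lparr>qcarrier = {f. f \<longlonglongrightarrow> 0},
      vadd = (\<lambda>f g n. f n + g n),
      vscale = (\<lambda>c f n. c * f n),
      qnorm = (\<lambda>f. SUP n. norm (f n))\<rparr>"

text \<open>The convention is that the symbol \<open>\<ell>\<^sub>\<infinity>\<close> stands for \<open>c\<^sub>0\<close>.\<close>

definition ell :: "ereal \<Rightarrow> ('k::real_normed_field, nat \<Rightarrow> 'k) qspace" where
  "ell p = (if p = \<infinity> then c_zero else ell_sum (real_of_ereal p) scalars)"

definition Lambda :: "('k::real_normed_field, 'v) qspace \<Rightarrow> ereal set" where
  "Lambda X = {p. 0 < p \<and> qembeds (ell p) X}"

definition Lfun :: "'a measure \<Rightarrow> real \<Rightarrow> ('a \<Rightarrow> 'k::real_normed_field) set" where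
  "Lfun M r = {f \<in> borel_measurable M. integrable M (\<lambda>x. norm (f x) powr r)}"

definition ae_rel :: "'a measure \<Rightarrow> real \<Rightarrow> (('a \<Rightarrow> 'k) \<times> ('a \<Rightarrow> 'k::real_normed_field)) set" where
  "ae_rel M r = {(f, g). f \<in> Lfun M r \<and> g \<in> Lfun M r \<and> (AE x in M. f x = g x)}"

definition Lspace :: "'a measure \<Rightarrow> real \<Rightarrow> ('k::real_normed_field, ('a \<Rightarrow> 'k) set) qspace" where
  "Lspace M r =
     \<lparr>qcarrier = Lfun M r // ae_rel M r,
      vadd = (\<lambda>A B. \<Union>f\<in>A. \<Union>g\<in>B. ae_rel M r `` {\<lambda>x. f x + g x}),
      vscale = (\<lambda>c A. \<Union>f\<in>A. ae_rel M r `` {\<lambda>x. c * f x}),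
      qnorm = (\<lambda>A. the_elem ((\<lambda>f. (\<integral>x. norm (f x) powr r \<partial>M) powr (1 / r)) ` A))\<rparr>"

abbreviation L_unit :: "real \<Rightarrow> ('k::real_normed_field, (real \<Rightarrow> 'k) set) qspace" where
  "L_unit r \<equiv> Lspace (lebesgue_on {0..1}) r"

text \<open>The operations of \<open>Lspace\<close> act on representatives as expected.\<close>

lemma equiv_ae_rel: "equiv (Lfun M r) (ae_rel M r)"
proof (rule equivI)
  show "ae_rel M r \<subseteq> Lfun M r \<times> Lfun M r"
    by (auto simp: ae_rel_def)
  show "refl_on (Lfun M r) (ae_rel M r)"
    by (auto simp: refl_on_def ae_rel_def)
  show "sym (ae_rel M r)"
    by (auto simp: sym_def ae_rel_def eq_commute)
  show "trans (ae_rel M r)"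
  proof (rule transI)
    fix f g h
    assume fg: "(f, g) \<in> ae_rel M r" and gh: "(g, h) \<in> ae_rel M r"
    have "AE x in M. f x = g x" "AE x in M. g x = h x"
      using fg gh by (auto simp: ae_rel_def)
    then have "AE x in M. f x = h x"
      by eventually_elim simp
    then show "(f, h) \<in> ae_rel M r"
      using fg gh by (auto simp: ae_rel_def)
  qed
qed

lemma Lfun_add:
  fixes f g :: "'a \<Rightarrow> 'k::{real_normed_field, second_countable_topology}"
  assumes r: "0 < r" and f: "f \<in> Lfun M r" and g: "g \<in> Lfun M r"
  shows "(\<lambda>x. f x + g x) \<in> Lfun M r"
proof -
  have [measurable]: "f \<in> borel_measurable M" "g \<in> borel_measurable M"
    using f g by (auto simp: Lfun_def)
  have le: "norm (f x + g x) powr r \<le> 2 powr r * (norm (f x) powr r + norm (g x) powr r)" for x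
  proof -
    have "norm (f x + g x) \<le> 2 * max (norm (f x)) (norm (g x))"
      using norm_triangle_ineq[of "f x" "g x"] by linarith
    then have "norm (f x + g x) powr r \<le> (2 * max (norm (f x)) (norm (g x))) powr r"
      using r by (intro powr_mono2) auto
    also have "\<dots> = 2 powr r * max (norm (f x)) (norm (g x)) powr r"
      by (simp add: powr_mult)
    also have "\<dots> \<le> 2 powr r * (norm (f x) powr r + norm (g x) powr r)"
      by (intro mult_left_mono) (auto simp: max_def)
    finally show ?thesis .
  qed
  have "integrable M (\<lambda>x. 2 powr r * (norm (f x) powr r + norm (g x) powr r))"
    using f g by (auto simp: Lfun_def)
  then have "integrable M (\<lambda>x. norm (f x + g x) powr r)"
  proof (rule Bochner_Integration.integrable_bound)
    show "AE x in M. norm (norm (f x + g x) powr r) \<le>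
        norm (2 powr r * (norm (f x) powr r + norm (g x) powr r))"
      using le by (intro always_eventually allI) (simp add: abs_mult)
  qed measurable
  then show ?thesis
    by (simp add: Lfun_def)
qed

lemma Lfun_scale:
  fixes f :: "'a \<Rightarrow> 'k::{real_normed_field, second_countable_topology}"
  assumes f: "f \<in> Lfun M r"
  shows "(\<lambda>x. c * f x) \<in> Lfun M r"
  using f by (auto simp: Lfun_def norm_mult powr_mult)

lemma vadd_Lspace:
  fixes f g :: "'a \<Rightarrow> 'k::{real_normed_field, second_countable_topology}"
  assumes "0 < r" "f \<in> Lfun M r" "g \<in> Lfun M r"
  shows "vadd (Lspace M r) (ae_rel M r `` {f}) (ae_rel M r `` {g}) = ae_rel M r `` {\<lambda>x. f x + g x}"
proof -
  have "congruent2 (ae_rel M r) (ae_rel M r)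
          (\<lambda>f g :: 'a \<Rightarrow> 'k. ae_rel M r `` {\<lambda>x. f x + g x})"
    unfolding congruent2_def
  proof (clarify)
    fix f f' g g' :: "'a \<Rightarrow> 'k"
    assume f: "(f, f') \<in> ae_rel M r" and g: "(g, g') \<in> ae_rel M r"
    have "AE x in M. f x = f' x" "AE x in M. g x = g' x"
      using f g by (auto simp: ae_rel_def)
    then have "AE x in M. f x + g x = f' x + g' x"
      by eventually_elim simp
    then have "(\<lambda>x. f x + g x, \<lambda>x. f' x + g' x) \<in> ae_rel M r"
      using f g by (simp add: ae_rel_def Lfun_add[OF \<open>0 < r\<close>])
    then show "ae_rel M r `` {\<lambda>x. f x + g x} = ae_rel M r `` {\<lambda>x. f' x + g' x}"
      by (rule equiv_class_eq[OF equiv_ae_rel])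
  qed
  then show ?thesis
    using UN_equiv_class2[OF equiv_ae_rel equiv_ae_rel] assms by (simp add: Lspace_def)
qed

lemma vscale_Lspace:
  fixes f :: "'a \<Rightarrow> 'k::{real_normed_field, second_countable_topology}"
  assumes "f \<in> Lfun M r"
  shows "vscale (Lspace M r) c (ae_rel M r `` {f}) = ae_rel M r `` {\<lambda>x. c * f x}"
proof -
  have "congruent (ae_rel M r) (\<lambda>f :: 'a \<Rightarrow> 'k. ae_rel M r `` {\<lambda>x. c * f x})"
    unfolding congruent_def
  proof (clarify)
    fix f f' :: "'a \<Rightarrow> 'k"
    assume f: "(f, f') \<in> ae_rel M r"
    then have "AE x in M. c * f x = c * f' x"
      by (auto simp: ae_rel_def elim!: eventually_mono)
    then have "(\<lambda>x. c * f x, \<lambda>x. c * f' x) \<in> ae_rel M r"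
      using f by (simp add: ae_rel_def Lfun_scale)
    then show "ae_rel M r `` {\<lambda>x. c * f x} = ae_rel M r `` {\<lambda>x. c * f' x}"
      by (rule equiv_class_eq[OF equiv_ae_rel])
  qed
  then show ?thesis
    using UN_equiv_class[OF equiv_ae_rel] assms by (simp add: Lspace_def)
qed

lemma qnorm_Lspace:
  assumes f: "f \<in> Lfun M r"
  shows "qnorm (Lspace M r) (ae_rel M r `` {f}) = (\<integral>x. norm (f x) powr r \<partial>M) powr (1 / r)"
proof -
  have eq: "(\<integral>x. norm (g x) powr r \<partial>M) = (\<integral>x. norm (f x) powr r \<partial>M)"
    if "(f, g) \<in> ae_rel M r" for g
    using that
    by (intro integral_cong_AE) (auto simp: ae_rel_def Lfun_def elim!: eventually_mono)
  let ?N = "\<lambda>g. (\<integral>x. norm (g x) powr r \<partial>M) powr (1 / r)"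
  have mem: "f \<in> ae_rel M r `` {f}"
    using f by (auto simp: ae_rel_def)
  have "?N g = ?N f" if "g \<in> ae_rel M r `` {f}" for g
  proof -
    from that have "(f, g) \<in> ae_rel M r" by blast
    from eq[OF this] show ?thesis by (rule arg_cong)
  qed
  then have "?N ` (ae_rel M r `` {f}) = (\<lambda>_. ?N f) ` (ae_rel M r `` {f})"
    by (rule image_cong[OF refl])
  also have "\<dots> = {?N f}"
    using mem by (rule image_constant)
  finally have "?N ` (ae_rel M r `` {f}) = {?N f}" .
  then show ?thesis
    by (simp add: Lspace_def)
qed

end

theory Submission imports Defs
begin

text \<open>
  Write \<open>Y = \<ell>\<^sub>s(L\<^sub>r)\<close>. Since \<open>\<ell>\<^sub>p\<close> is complete, a linear map from it is an embedding onto a closed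
  subspace exactly if it is bounded above and below (\<open>qembeds_bounds\<close>, \<open>qembeds_if_bounds\<close>). So the
  question is for which \<open>p\<close> there are vectors in \<open>Y\<close> whose finite linear combinations have norms
  comparable to the norm of the coefficients in \<open>\<ell>\<^sub>p\<close>. The case distinction of the theorem only
  sorts the outcome: the exponents are \<open>s\<close> together with \<open>[r, 2]\<close> if \<open>r \<le> 2\<close>, and \<open>s\<close>, \<open>r\<close>, \<open>2\<close> if
  \<open>r \<ge> 2\<close> (\<open>Lambda_ell_sum_L_unit\<close>).

  These exponents occur. Constant functions give \<open>s\<close>, normalised indicators of disjoint sets give
  \<open>r\<close>, and Rademacher functions give \<open>2\<close> by Khintchine's inequality. For \<open>r < p < 2\<close> one would
  use independent \<open>p\<close>-stable variables. All that matters about these is symmetry and the tail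
  \<open>t\<^sup>-\<^sup>p\<close>, so they are replaced by \<open>x\<^sub>k = \<plusminus>v\<^sub>k\<close>, where \<open>v\<^sub>k = 2\<^bsup>m/p\<^esup>\<close> with probability
  \<open>2\<^bsup>-m-1\<^esup>\<close>, read off from disjoint sets of binary digits. By symmetry the signs can be averaged,
  and Khintchine's inequality leaves the integral of \<open>(\<Sum>|a\<^sub>k|\<^sup>2 v\<^sub>k\<^sup>2)\<^bsup>r/2\<^esup>\<close> to be
  estimated for \<open>\<Sum>|a\<^sub>k|\<^sup>p = 1\<close>: it is bounded above by the tail, since \<open>r < p < 2\<close>, and bounded
  below because with probability at least \<open>1/8\<close> some \<open>|a\<^sub>k| v\<^sub>k\<close> is at least \<open>1\<close>
  (\<open>ell_embeds_stable\<close>).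

  No other exponents occur. Put \<open>\<theta> = 1/p\<close>, and \<open>\<theta> = 0\<close> for \<open>c\<^sub>0\<close>. A sum of \<open>n\<close> disjoint unit
  vectors of \<open>\<ell>\<^sub>p\<close> has norm \<open>n\<^sup>\<theta>\<close>; the growth of the norm of its image is computed in another
  way. If images of unit vectors can be concentrated, up to small errors, on coordinates of
  \<open>\<ell>\<^sub>s(L\<^sub>r)\<close> where given earlier images are small, then there are such sums whose images grow like
  \<open>n\<^bsup>1/s\<^esup>\<close>, and \<open>p = s\<close> (\<open>gliding_hump\<close>). Otherwise finitely many coordinates already bound the norm
  from below on a tail of the sequence, and \<open>\<ell>\<^sub>p\<close> lives in \<open>L\<^sub>r\<close> of a finite measure space. For
  \<open>r \<le> 2\<close> averaging over signs gives a square function between \<open>n\<^bsup>1/2\<^esup>\<close> and \<open>n\<^bsup>1/r\<^esup>\<close>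
  (\<open>type_cotype\<close>). For \<open>r \<ge> 2\<close> the gliding hump is applied once more, now to subsets of the measure
  space: it gives \<open>p = r\<close>, or else the norms of \<open>L\<^sub>r\<close> and \<open>L\<^sub>2\<close> are equivalent on the tail and
  \<open>p = 2\<close> (\<open>kadec_pelczynski\<close>).
\<close>

section \<open>Quasi-normed spaces and embeddings\<close>

text \<open>
  A record of type \<open>qspace\<close> names neither its zero vector nor the constant in the quasi-triangle
  inequality; both are parameters here.
\<close>

locale quasi_normed =
  fixes X :: "('k::real_normed_field, 'v) qspace" and z :: 'v and K :: real
  assumes zero_in: "z \<in> qcarrier X"
    and add_in: "\<lbrakk>x \<in> qcarrier X; y \<in> qcarrier X\<rbrakk> \<Longrightarrow> vadd X x y \<in> qcarrier X"
    and scale_in: "x \<in> qcarrier X \<Longrightarrow> vscale X c x \<in> qcarrier X"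
    and add_zero: "x \<in> qcarrier X \<Longrightarrow> vadd X x z = x"
    and add_assoc: "\<lbrakk>x \<in> qcarrier X; y \<in> qcarrier X; w \<in> qcarrier X\<rbrakk>
      \<Longrightarrow> vadd X (vadd X x y) w = vadd X x (vadd X y w)"
    and add_commute: "\<lbrakk>x \<in> qcarrier X; y \<in> qcarrier X\<rbrakk> \<Longrightarrow> vadd X x y = vadd X y x"
    and scale_scale: "x \<in> qcarrier X \<Longrightarrow> vscale X c (vscale X d x) = vscale X (c * d) x"
    and scale_one: "x \<in> qcarrier X \<Longrightarrow> vscale X 1 x = x"
    and scale_add: "\<lbrakk>x \<in> qcarrier X; y \<in> qcarrier X\<rbrakk>
      \<Longrightarrow> vscale X c (vadd X x y) = vadd X (vscale X c x) (vscale X c y)"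
    and add_neg: "x \<in> qcarrier X \<Longrightarrow> vadd X x (vscale X (-1) x) = z"
    and norm_nonneg: "x \<in> qcarrier X \<Longrightarrow> 0 \<le> qnorm X x"
    and norm_scale: "x \<in> qcarrier X \<Longrightarrow> qnorm X (vscale X c x) = norm c * qnorm X x"
    and norm_zeroD: "\<lbrakk>x \<in> qcarrier X; qnorm X x = 0\<rbrakk> \<Longrightarrow> x = z"
    and K_ge_1: "1 \<le> K"
    and triangle: "\<lbrakk>x \<in> qcarrier X; y \<in> qcarrier X\<rbrakk>
      \<Longrightarrow> qnorm X (vadd X x y) \<le> K * (qnorm X x + qnorm X y)"
begin

lemma zero_add: "x \<in> qcarrier X \<Longrightarrow> vadd X z x = x"
  by (metis add_commute add_zero zero_in)

lemma scale_zero: "vscale X c z = z"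
proof -
  have neg: "vscale X (-1) z = z"
    by (metis add_neg scale_in zero_add zero_in)
  have "vscale X c z = vscale X c (vadd X z (vscale X (-1) z))"
    by (simp add: add_neg zero_in)
  also have "\<dots> = vadd X (vscale X c z) (vscale X (-1) (vscale X c z))"
    by (simp add: scale_add scale_in zero_in scale_scale)
  finally show ?thesis
    by (simp add: add_neg scale_in zero_in)
qed

lemma norm_zero: "qnorm X z = 0"
  using norm_scale[OF zero_in, of 0] by (simp add: scale_zero)

lemma scale_null: "x \<in> qcarrier X \<Longrightarrow> vscale X 0 x = z"
  using norm_scale[of x 0] norm_zeroD[OF scale_in] by simp

abbreviation (input) diff where "diff x y \<equiv> vadd X y (vscale X (-1) x)"

lemma diff_in: "\<lbrakk>x \<in> qcarrier X; y \<in> qcarrier X\<rbrakk> \<Longrightarrow> diff x y \<in> qcarrier X"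
  by (simp add: add_in scale_in)

lemma qdist_nonneg: "\<lbrakk>x \<in> qcarrier X; y \<in> qcarrier X\<rbrakk> \<Longrightarrow> 0 \<le> qdist X x y"
  by (simp add: qdist_def norm_nonneg diff_in)

lemma qdist_zero_left: "x \<in> qcarrier X \<Longrightarrow> qdist X z x = qnorm X x"
  by (simp add: qdist_def scale_zero add_zero)

lemma qdist_self: "x \<in> qcarrier X \<Longrightarrow> qdist X x x = 0"
  by (simp add: qdist_def add_neg norm_zero)

lemma diff_telescope:
  assumes "x \<in> qcarrier X" "y \<in> qcarrier X" "w \<in> qcarrier X"
  shows "vadd X (diff y w) (diff x y) = diff x w"
proof -
  have "vadd X (diff y w) (diff x y) = vadd X w (vadd X (vadd X (vscale X (-1) y) y) (vscale X (-1) x))"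
    using assms by (simp add: add_assoc add_in scale_in)
  also have "vadd X (vscale X (-1) y) y = z"
    using assms by (metis add_commute add_neg scale_in)
  finally show ?thesis
    using assms by (simp add: zero_add scale_in)
qed

lemma neg_diff:
  assumes "x \<in> qcarrier X" "y \<in> qcarrier X"
  shows "vscale X (-1) (diff x y) = diff y x"
  using assms by (simp add: scale_add scale_in scale_scale scale_one add_commute)

lemma qdist_commute: "\<lbrakk>x \<in> qcarrier X; y \<in> qcarrier X\<rbrakk> \<Longrightarrow> qdist X x y = qdist X y x"
  using norm_scale[of "diff x y" "-1"] by (simp add: qdist_def neg_diff diff_in)

lemma qdist_triangle:
  assumes "x \<in> qcarrier X" "y \<in> qcarrier X" "w \<in> qcarrier X"
  shows "qdist X x w \<le> K * (qdist X x y + qdist X y w)"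
  using triangle[of "diff y w" "diff x y"] assms
  by (simp add: qdist_def diff_telescope diff_in add.commute)

lemma qdist_zeroD:
  assumes "x \<in> qcarrier X" "y \<in> qcarrier X" "qdist X x y = 0"
  shows "x = y"
proof -
  have "diff x y = z"
    using assms by (simp add: qdist_def norm_zeroD diff_in)
  then have "vadd X (diff x y) x = x"
    using assms by (simp add: zero_add)
  moreover have "vadd X (diff x y) x = vadd X y (vadd X (vscale X (-1) x) x)"
    using assms by (simp add: add_assoc scale_in)
  moreover have "vadd X (vscale X (-1) x) x = z"
    using assms by (metis add_commute add_neg scale_in)
  ultimately show ?thesis
    using assms by (simp add: add_zero)
qed

lemma norm_le_dist:
  assumes "x \<in> qcarrier X" "y \<in> qcarrier X"
  shows "qnorm X y \<le> K * (qnorm X x + qdist X x y)"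
  using qdist_triangle[OF zero_in assms] assms by (simp add: qdist_zero_left)

lemma qdist_add:
  assumes "x \<in> qcarrier X" "y \<in> qcarrier X" "x' \<in> qcarrier X" "y' \<in> qcarrier X"
  shows "qdist X (vadd X x y) (vadd X x' y') \<le> K * (qdist X x x' + qdist X y y')"
proof -
  have "diff (vadd X x y) (vadd X x' y')
      = vadd X (vadd X x' y') (vadd X (vscale X (-1) x) (vscale X (-1) y))"
    using assms by (simp add: scale_add)
  also have "\<dots> = vadd X x' (vadd X y' (vadd X (vscale X (-1) x) (vscale X (-1) y)))"
    using assms by (simp add: add_assoc add_in scale_in)
  also have "vadd X y' (vadd X (vscale X (-1) x) (vscale X (-1) y))
      = vadd X (vscale X (-1) x) (diff y y')"
    using assms by (metis add_assoc add_commute scale_in)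
  also have "vadd X x' \<dots> = vadd X (diff x x') (diff y y')"
    using assms by (simp add: add_assoc add_in scale_in)
  finally show ?thesis
    using assms by (simp add: qdist_def triangle diff_in)
qed

lemma qdist_scale:
  assumes "x \<in> qcarrier X" "y \<in> qcarrier X"
  shows "qdist X (vscale X c x) (vscale X c y) = norm c * qdist X x y"
proof -
  have "diff (vscale X c x) (vscale X c y) = vscale X c (diff x y)"
    using assms by (simp add: scale_add scale_in scale_scale)
  then show ?thesis
    using assms by (simp add: qdist_def norm_scale diff_in)
qed

lemma qdist_limit_unique:
  assumes u: "\<And>n. u n \<in> qcarrier X" and x: "x \<in> qcarrier X" "y \<in> qcarrier X"
    and "(\<lambda>n. qdist X (u n) x) \<longlonglongrightarrow> 0" "(\<lambda>n. qdist X (u n) y) \<longlonglongrightarrow> 0"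
  shows "x = y"
proof (rule qdist_zeroD[OF x])
  have "(\<lambda>n. K * (qdist X (u n) x + qdist X (u n) y)) \<longlonglongrightarrow> K * (0 + 0)"
    by (intro tendsto_intros assms)
  moreover have "qdist X x y \<le> K * (qdist X (u n) x + qdist X (u n) y)" for n
    using qdist_triangle[OF x(1) u x(2), of n] qdist_commute[OF x(1) u, of n] by simp
  ultimately have "qdist X x y \<le> K * (0 + 0)"
    by (intro LIMSEQ_le_const) auto
  then show "qdist X x y = 0"
    using qdist_nonneg[OF x] by simp
qed

text \<open>
  A ball of a quasi-norm need not be open, but the points that have a ball around them inside it
  form an open set: halving radii, up to the constant, absorbs the failure of the triangle
  inequality.
\<close>

lemma open_nbhd_in_ball:
  assumes x: "x \<in> qcarrier X" and e: "0 < e"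
  obtains U where "qopen X U" "x \<in> U" "\<And>y. y \<in> U \<Longrightarrow> qdist X x y < e"
proof
  define B where "B = {y \<in> qcarrier X. qdist X x y < e}"
  define U where "U = {y \<in> qcarrier X. \<exists>d>0. \<forall>w\<in>qcarrier X. qdist X y w < d \<longrightarrow> w \<in> B}"
  show "qopen X U"
    unfolding qopen_def
  proof (intro conjI ballI)
    show "U \<subseteq> qcarrier X" by (auto simp: U_def)
    fix y assume y: "y \<in> U"
    then obtain d where d: "d > 0" "\<And>w. \<lbrakk>w \<in> qcarrier X; qdist X y w < d\<rbrakk> \<Longrightarrow> w \<in> B"
      and yX: "y \<in> qcarrier X"
      by (auto simp: U_def)
    show "\<exists>d>0. \<forall>w\<in>qcarrier X. qdist X y w < d \<longrightarrow> w \<in> U"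
    proof (intro exI[of _ "d / (2 * K)"] conjI ballI impI)
      show "d / (2 * K) > 0" using d K_ge_1 by simp
      fix w assume w: "w \<in> qcarrier X" "qdist X y w < d / (2 * K)"
      have "v \<in> B" if v: "v \<in> qcarrier X" "qdist X w v < d / (2 * K)" for v
      proof -
        have "qdist X y v \<le> K * (qdist X y w + qdist X w v)"
          using yX w v by (simp add: qdist_triangle)
        also have "\<dots> < K * (d / (2 * K) + d / (2 * K))"
          using w v K_ge_1 by (intro mult_strict_left_mono) auto
        also have "\<dots> = d" using K_ge_1 by (simp add: field_simps)
        finally show ?thesis using d v by blast
      qed
      with w show "w \<in> U"
        using d K_ge_1 by (auto simp: U_def intro!: exI[of _ "d / (2 * K)"])
    qed
  qed
  show "x \<in> U"
    using x e by (auto simp: U_def B_def)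
  show "qdist X x y < e" if "y \<in> U" for y
  proof -
    from that have "y \<in> B"
      unfolding U_def by (auto simp: qdist_self)
    then show ?thesis by (simp add: B_def)
  qed
qed

end

definition qcomplete :: "('k::real_normed_field, 'v) qspace \<Rightarrow> bool" where
  "qcomplete X \<longleftrightarrow> (\<forall>f. (\<forall>n::nat. f n \<in> qcarrier X) \<and>
      (\<forall>e>0. \<exists>N. \<forall>m\<ge>N. \<forall>n\<ge>N. qdist X (f m) (f n) < e) \<longrightarrow>
      (\<exists>x\<in>qcarrier X. (\<lambda>n. qdist X (f n) x) \<longlonglongrightarrow> 0))"

locale quasi_normed_pair = X: quasi_normed X zX KX + Y: quasi_normed Y zY KY
  for X :: "('k::real_normed_field, 'v) qspace" and zX KX
    and Y :: "('k, 'w) qspace" and zY KY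
begin

lemma qlinear_zero:
  assumes "qlinear X Y T"
  shows "T zX = zY"
proof -
  have "T zX \<in> qcarrier Y"
    using assms X.zero_in unfolding qlinear_def by blast
  have "T zX = T (vscale X 0 zX)"
    by (simp add: X.scale_null X.zero_in)
  also have "\<dots> = vscale Y 0 (T zX)"
    using assms X.zero_in unfolding qlinear_def by blast
  also have "\<dots> = zY"
    using \<open>T zX \<in> qcarrier Y\<close> by (rule Y.scale_null)
  finally show ?thesis .
qed

lemma qdist_linear:
  assumes "qlinear X Y T" "x \<in> qcarrier X" "y \<in> qcarrier X"
  shows "qdist Y (T x) (T y) = qnorm Y (T (vadd X y (vscale X (-1) x)))"
proof -
  have "T (vadd X y (vscale X (-1) x)) = vadd Y (T y) (vscale Y (-1) (T x))"
    using assms X.scale_in[of x "-1"] unfolding qlinear_def by metis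
  then show ?thesis by (simp only: qdist_def)
qed

text \<open>
  Continuity of the map and of its inverse at zero, combined with homogeneity.
\<close>

lemma qembeds_bounds:
  assumes "qembeds X Y"
  obtains T c C where "qlinear X Y T" "0 < c" "0 < C"
    "\<And>x. x \<in> qcarrier X \<Longrightarrow> c * qnorm X x \<le> qnorm Y (T x)"
    "\<And>x. x \<in> qcarrier X \<Longrightarrow> qnorm Y (T x) \<le> C * qnorm X x"
proof -
  obtain T where T: "qlinear X Y T" and emb: "embedding_map (qtopology X) (qtopology Y) T"
    using assms unfolding qembeds_def by blast
  have TY: "\<And>x. x \<in> qcarrier X \<Longrightarrow> T x \<in> qcarrier Y"
    using T unfolding qlinear_def by blast
  have Tsc: "\<And>c x. x \<in> qcarrier X \<Longrightarrow> T (vscale X c x) = vscale Y c (T x)"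
    using T unfolding qlinear_def by blast
  have T0: "T zX = zY" by (rule qlinear_zero[OF T])
  have hom: "homeomorphic_map (qtopology X) (subtopology (qtopology Y) (T ` qcarrier X)) T"
    using emb unfolding embedding_map_def by (simp add: topspace_qtopology)
  have cont: "continuous_map (qtopology X) (qtopology Y) T"
    using hom[THEN homeomorphic_imp_continuous_map] by (rule continuous_map_into_fulltopology)
  have opn: "open_map (qtopology X) (subtopology (qtopology Y) (T ` qcarrier X)) T"
    using hom by (rule homeomorphic_imp_open_map)
  have inj: "inj_on T (qcarrier X)"
    using hom[THEN homeomorphic_imp_injective_map] by (simp only: topspace_qtopology)
  obtain d where d: "0 < d" "\<And>x. \<lbrakk>x \<in> qcarrier X; qnorm X x < d\<rbrakk> \<Longrightarrow> qnorm Y (T x) < 1"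
  proof -
    obtain U where U: "qopen Y U" "zY \<in> U" "\<And>y. y \<in> U \<Longrightarrow> qdist Y zY y < 1"
      using Y.open_nbhd_in_ball[OF Y.zero_in, of 1] by auto
    have "qopen X {x \<in> qcarrier X. T x \<in> U}"
      using cont U(1) unfolding continuous_map_def by (auto simp: openin_qtopology topspace_qtopology)
    moreover have "zX \<in> {x \<in> qcarrier X. T x \<in> U}" using X.zero_in T0 U by simp
    ultimately obtain d where "0 < d"
      and d: "\<forall>y\<in>qcarrier X. qdist X zX y < d \<longrightarrow> y \<in> {x \<in> qcarrier X. T x \<in> U}"
      unfolding qopen_def by blast
    have "qnorm Y (T x) < 1" if "x \<in> qcarrier X" "qnorm X x < d" for x
    proof -
      have "T x \<in> U"
        using d that by (simp add: X.qdist_zero_left)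
      then show ?thesis
        using U(3)[OF \<open>T x \<in> U\<close>] TY[OF that(1)] by (simp add: Y.qdist_zero_left)
    qed
    with \<open>0 < d\<close> show ?thesis by (rule that)
  qed
  obtain e where e: "0 < e" "\<And>x. \<lbrakk>x \<in> qcarrier X; qnorm Y (T x) < e\<rbrakk> \<Longrightarrow> qnorm X x < 1"
  proof -
    obtain U where U: "qopen X U" "zX \<in> U" "\<And>y. y \<in> U \<Longrightarrow> qdist X zX y < 1"
      using X.open_nbhd_in_ball[OF X.zero_in, of 1] by auto
    have UX: "U \<subseteq> qcarrier X" using U(1) by (auto simp: qopen_def)
    have "openin (subtopology (qtopology Y) (T ` qcarrier X)) (T ` U)"
      using opn U(1) unfolding open_map_def by (auto simp: openin_qtopology)
    then obtain W where W: "qopen Y W" "T ` U = W \<inter> T ` qcarrier X"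
      by (auto simp: openin_subtopology openin_qtopology)
    have "T zX \<in> T ` U" using U(2) by (rule imageI)
    then have "zY \<in> W" using W(2) T0 by simp
    then obtain e where e: "0 < e" "\<forall>y\<in>qcarrier Y. qdist Y zY y < e \<longrightarrow> y \<in> W"
      using W(1) unfolding qopen_def by blast
    have "qnorm X x < 1" if x: "x \<in> qcarrier X" "qnorm Y (T x) < e" for x
    proof -
      have "T x \<in> W \<inter> T ` qcarrier X"
        using e x TY by (auto simp: Y.qdist_zero_left)
      then have "T x \<in> T ` U" using W by simp
      then have "x \<in> U" using inj x UX by (auto simp: inj_on_def)
      from U(3)[OF this] x show ?thesis by (simp add: X.qdist_zero_left)
    qed
    with that e(1) show ?thesis by blast
  qed
  show ?thesis
  proof (rule that[OF T, of e "2 / d"])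
    show "e > 0" "2 / d > 0" using d e by auto
  next
    fix x assume x: "x \<in> qcarrier X"
    show "e * qnorm X x \<le> qnorm Y (T x)"
    proof (cases "qnorm X x = 0")
      case True
      then show ?thesis using x TY Y.norm_nonneg by simp
    next
      case False
      then have pos: "qnorm X x > 0" using x X.norm_nonneg[OF x] by simp
      let ?c = "of_real (1 / qnorm X x) :: 'k"
      have "\<not> qnorm Y (T (vscale X ?c x)) < e"
        using e(2)[OF X.scale_in[OF x], of ?c] pos by (auto simp: X.norm_scale[OF x] norm_divide)
      then have "e \<le> qnorm Y (T x) / qnorm X x"
        using pos by (simp add: Tsc[OF x] Y.norm_scale[OF TY[OF x]] norm_divide)
      then show ?thesis using pos e by (simp add: field_simps)
    qed
    show "qnorm Y (T x) \<le> 2 / d * qnorm X x"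
    proof (cases "qnorm X x = 0")
      case True
      then have "x = zX" using x by (simp add: X.norm_zeroD)
      then show ?thesis using T0 by (simp add: X.norm_zero Y.norm_zero)
    next
      case False
      then have pos: "qnorm X x > 0" using x X.norm_nonneg[OF x] by simp
      let ?c = "of_real (d / (2 * qnorm X x)) :: 'k"
      have nc: "norm ?c = d / (2 * qnorm X x)" using d pos by (simp only: norm_of_real) simp
      have "qnorm X (vscale X ?c x) = d / 2"
        using pos unfolding X.norm_scale[OF x] nc by (simp add: field_simps)
      then have "qnorm Y (T (vscale X ?c x)) < 1"
        using d by (intro d(2) X.scale_in x) auto
      then have "d / (2 * qnorm X x) * qnorm Y (T x) < 1"
        unfolding Tsc[OF x] Y.norm_scale[OF TY[OF x]] nc .
      then show ?thesis using pos d by (simp add: field_simps)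
    qed
  qed
qed

text \<open>
  If \<open>T x\<^sub>n\<close> converges, then \<open>x\<^sub>n\<close> is a Cauchy sequence by the lower bound, and its limit is mapped to
  the limit of \<open>T x\<^sub>n\<close> by the upper bound; hence the range is closed.
\<close>

lemma qembeds_if_bounds:
  assumes T: "qlinear X Y T" and c: "0 < c" and C: "0 < C" and compl: "qcomplete X"
    and lower: "\<And>x. x \<in> qcarrier X \<Longrightarrow> c * qnorm X x \<le> qnorm Y (T x)"
    and upper: "\<And>x. x \<in> qcarrier X \<Longrightarrow> qnorm Y (T x) \<le> C * qnorm X x"
  shows "qembeds X Y"
proof -
  have TY: "\<And>x. x \<in> qcarrier X \<Longrightarrow> T x \<in> qcarrier Y"
    using T unfolding qlinear_def by blast
  have dl: "c * qdist X x y \<le> qdist Y (T x) (T y)" and du: "qdist Y (T x) (T y) \<le> C * qdist X x y"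
    if "x \<in> qcarrier X" "y \<in> qcarrier X" for x y
    using lower upper that unfolding qdist_linear[OF T that] by (auto simp: qdist_def X.diff_in)
  have inj: "inj_on T (qcarrier X)"
  proof (rule inj_onI)
    fix x y assume xy: "x \<in> qcarrier X" "y \<in> qcarrier X" "T x = T y"
    then have "c * qdist X x y \<le> 0" using dl[of x y] Y.qdist_self TY by simp
    then have "qdist X x y = 0"
      using c X.qdist_nonneg[of x y] xy by (simp add: mult_le_0_iff)
    then show "x = y" using xy X.qdist_zeroD by blast
  qed
  have cont: "continuous_map (qtopology X) (qtopology Y) T"
    unfolding continuous_map_def topspace_qtopology openin_qtopology
  proof (intro conjI allI impI)
    show "T \<in> qcarrier X \<rightarrow> qcarrier Y" using TY by blast
    fix W assume W: "qopen Y W"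
    show "qopen X {x \<in> qcarrier X. T x \<in> W}"
      unfolding qopen_def
    proof (intro conjI ballI)
      fix x assume x: "x \<in> {x \<in> qcarrier X. T x \<in> W}"
      then obtain e where e: "0 < e" "\<forall>y\<in>qcarrier Y. qdist Y (T x) y < e \<longrightarrow> y \<in> W"
        using W unfolding qopen_def by blast
      show "\<exists>d>0. \<forall>y\<in>qcarrier X. qdist X x y < d \<longrightarrow> y \<in> {x \<in> qcarrier X. T x \<in> W}"
      proof (intro exI[of _ "e / C"] conjI ballI impI)
        fix y assume y: "y \<in> qcarrier X" "qdist X x y < e / C"
        then have "qdist Y (T x) (T y) < e"
          using du[of x y] x C by (simp add: field_simps) 
        then show "y \<in> {x \<in> qcarrier X. T x \<in> W}" using e y TY by blast
      qed (use e C in auto)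
    qed auto
  qed
  have opn: "open_map (qtopology X) (subtopology (qtopology Y) (T ` qcarrier X)) T"
    unfolding open_map_def
  proof (intro allI impI)
    fix U assume "openin (qtopology X) U"
    then have U: "qopen X U" by (simp add: openin_qtopology)
    then have UX: "U \<subseteq> qcarrier X" by (simp add: qopen_def)
    have "\<exists>W. qopen Y W \<and> T x \<in> W \<and> W \<inter> T ` qcarrier X \<subseteq> T ` U" if x: "x \<in> U" for x
    proof -
      obtain e where e: "0 < e" "\<forall>y\<in>qcarrier X. qdist X x y < e \<longrightarrow> y \<in> U"
        using U x unfolding qopen_def by blast
      obtain W where W: "qopen Y W" "T x \<in> W" "\<And>y. y \<in> W \<Longrightarrow> qdist Y (T x) y < c * e"
        using Y.open_nbhd_in_ball[of "T x" "c * e"] TY x UX c e(1) by (metis mult_pos_pos subsetD)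
      have "W \<inter> T ` qcarrier X \<subseteq> T ` U"
      proof (clarify)
        fix y assume y: "y \<in> qcarrier X" "T y \<in> W"
        then have "c * qdist X x y < c * e" using W(3)[of "T y"] dl[of x y] x UX by fastforce
        then show "T y \<in> T ` U" using c e y by auto
      qed
      with W show ?thesis by blast
    qed
    then obtain W where W: "\<And>x. x \<in> U \<Longrightarrow> qopen Y (W x) \<and> T x \<in> W x \<and> W x \<inter> T ` qcarrier X \<subseteq> T ` U"
      by metis
    have "openin (qtopology Y) (\<Union>(W ` U))"
      using W by (intro openin_Union) (auto simp: openin_qtopology)
    moreover have "T ` U = \<Union>(W ` U) \<inter> T ` qcarrier X"
      using W UX by blast
    ultimately show "openin (subtopology (qtopology Y) (T ` qcarrier X)) (T ` U)"
      unfolding openin_subtopology by blast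
  qed
  have "embedding_map (qtopology X) (qtopology Y) T"
    unfolding embedding_map_def
    using cont opn inj TY
    by (intro bijective_open_imp_homeomorphic_map)
      (auto simp: topspace_qtopology continuous_map_in_subtopology)
  moreover have "closedin (qtopology Y) (T ` qcarrier X)"
    unfolding closedin_def topspace_qtopology openin_qtopology
  proof
    show "T ` qcarrier X \<subseteq> qcarrier Y" using TY by blast
    show "qopen Y (qcarrier Y - T ` qcarrier X)"
      unfolding qopen_def
    proof (intro conjI ballI)
      fix y assume y: "y \<in> qcarrier Y - T ` qcarrier X"
      show "\<exists>e>0. \<forall>w\<in>qcarrier Y. qdist Y y w < e \<longrightarrow> w \<in> qcarrier Y - T ` qcarrier X"
      proof (rule ccontr)
        assume "\<not> ?thesis"
        then have "\<exists>x\<in>qcarrier X. qdist Y y (T x) < e" if "e > 0" for e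
          using that by blast
        then have "\<exists>x\<in>qcarrier X. qdist Y y (T x) < inverse (real (Suc n))" for n by simp
        then obtain f where f: "\<And>n. f n \<in> qcarrier X" "\<And>n. qdist Y y (T (f n)) < inverse (real (Suc n))"
          by metis
        have lim: "(\<lambda>n. qdist Y y (T (f n))) \<longlonglongrightarrow> 0"
        proof (rule tendsto_sandwich[OF _ _ tendsto_const LIMSEQ_inverse_real_of_nat])
          show "\<forall>\<^sub>F n in sequentially. 0 \<le> qdist Y y (T (f n))"
            using y TY f(1) by (auto intro!: always_eventually Y.qdist_nonneg)
          show "\<forall>\<^sub>F n in sequentially. qdist Y y (T (f n)) \<le> inverse (real (Suc n))"
            using f(2) by (intro always_eventually) (auto intro: less_imp_le)
        qed
        have "\<exists>N. \<forall>m\<ge>N. \<forall>n\<ge>N. qdist X (f m) (f n) < e" if e: "e > 0" for e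
        proof -
          define d where "d = c * e / (2 * KY)"
          have "d > 0" using c e Y.K_ge_1 by (simp add: d_def)
          then obtain N where N: "\<And>n. n \<ge> N \<Longrightarrow> qdist Y y (T (f n)) < d"
            using order_tendstoD(2)[OF lim] by (auto simp: eventually_sequentially)
          have "qdist X (f m) (f n) < e" if mn: "m \<ge> N" "n \<ge> N" for m n
          proof -
            have "c * qdist X (f m) (f n) \<le> qdist Y (T (f m)) (T (f n))" using dl f by simp
            also have "\<dots> \<le> KY * (qdist Y (T (f m)) y + qdist Y y (T (f n)))"
              using y f TY by (intro Y.qdist_triangle) auto
            also have "\<dots> < KY * (d + d)"
            proof (intro mult_strict_left_mono add_strict_mono)
              show "qdist Y (T (f m)) y < d"
                using N[OF mn(1)] y f TY by (subst Y.qdist_commute) auto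
            qed (use N mn Y.K_ge_1 in auto)
            also have "\<dots> = c * e" using Y.K_ge_1 by (simp add: d_def)
            finally show ?thesis using c by simp
          qed
          then show ?thesis by blast
        qed
        then obtain x where x: "x \<in> qcarrier X" "(\<lambda>n. qdist X (f n) x) \<longlonglongrightarrow> 0"
          using compl f(1) unfolding qcomplete_def by blast
        have "(\<lambda>n. KY * (qdist Y y (T (f n)) + C * qdist X (f n) x)) \<longlonglongrightarrow> KY * (0 + C * 0)"
          by (intro tendsto_intros lim x)
        moreover have "qdist Y y (T x) \<le> KY * (qdist Y y (T (f n)) + C * qdist X (f n) x)" for n
        proof -
          have "qdist Y y (T x) \<le> KY * (qdist Y y (T (f n)) + qdist Y (T (f n)) (T x))"
            using y f TY x by (intro Y.qdist_triangle) auto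
          also have "\<dots> \<le> KY * (qdist Y y (T (f n)) + C * qdist X (f n) x)"
            using du[OF f(1) x(1)] Y.K_ge_1 by (intro mult_left_mono add_left_mono) auto
          finally show ?thesis .
        qed
        ultimately have "qdist Y y (T x) \<le> KY * (0 + C * 0)"
          by (intro LIMSEQ_le_const) auto
        moreover have "qdist Y y (T x) \<ge> 0"
          using y x TY by (intro Y.qdist_nonneg) auto
        ultimately have "y = T x"
          using y x TY by (intro Y.qdist_zeroD) auto
        with y x show False by blast
      qed
    qed auto
  qed
  ultimately show ?thesis using T unfolding qembeds_def by blast
qed

end

section \<open>Sequence spaces and \<open>L\<^sub>r\<close> as quasi-normed spaces\<close>

lemma powr_add_le:
  fixes x y p :: real
  assumes "0 \<le> x" "0 \<le> y" "0 \<le> p"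
  shows "(x + y) powr p \<le> 2 powr p * (x powr p + y powr p)"
proof -
  have "(x + y) powr p \<le> (2 * max x y) powr p"
    using assms by (intro powr_mono2) auto
  also have "\<dots> = 2 powr p * max x y powr p"
    using assms by (simp add: powr_mult)
  also have "\<dots> \<le> 2 powr p * (x powr p + y powr p)"
    using assms by (intro mult_left_mono) (auto simp: max_def)
  finally show ?thesis .
qed

lemma quasi_normed_scalars: "quasi_normed (scalars :: ('k::real_normed_field, 'k) qspace) 0 1"
  by unfold_locales (auto simp: scalars_def norm_mult algebra_simps intro: norm_triangle_ineq)

lemma quasi_normed_ell_sum:
  assumes "quasi_normed X z K" and s: "0 < s"
  shows "quasi_normed (ell_sum s X) (\<lambda>_. z) (2 * K * 2 powr (1 / s))"
proof -
  interpret quasi_normed X z K by fact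
  have le: "qnorm X (vadd X x y) powr s \<le> (2 * K) powr s * (qnorm X x powr s + qnorm X y powr s)"
    if "x \<in> qcarrier X" "y \<in> qcarrier X" for x y
  proof -
    have "qnorm X (vadd X x y) powr s \<le> (K * (qnorm X x + qnorm X y)) powr s"
      using that s by (intro powr_mono2 triangle) (auto intro: norm_nonneg add_in)
    also have "\<dots> \<le> K powr s * (2 powr s * (qnorm X x powr s + qnorm X y powr s))"
      using that s K_ge_1
      by (simp add: powr_mult norm_nonneg add_nonneg_nonneg mult_left_mono powr_add_le)
    finally show ?thesis using K_ge_1 by (simp add: powr_mult algebra_simps)
  qed
  have add_summable: "summable (\<lambda>n. qnorm X (vadd X (f n) (g n)) powr s)"
    if "f \<in> qcarrier (ell_sum s X)" "g \<in> qcarrier (ell_sum s X)" for f g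
  proof (rule summable_comparison_test'[where N = 0])
    show "summable (\<lambda>n. (2 * K) powr s * (qnorm X (f n) powr s + qnorm X (g n) powr s))"
      using that by (intro summable_mult summable_add) (auto simp: ell_sum_def)
    show "norm (qnorm X (vadd X (f n) (g n)) powr s)
        \<le> (2 * K) powr s * (qnorm X (f n) powr s + qnorm X (g n) powr s)" for n
      using that le[of "f n" "g n"] by (simp add: ell_sum_def)
  qed
  have scale: "summable (\<lambda>n. qnorm X (vscale X c (f n)) powr s)"
    "(\<Sum>n. qnorm X (vscale X c (f n)) powr s) = norm c powr s * (\<Sum>n. qnorm X (f n) powr s)"
    if "f \<in> qcarrier (ell_sum s X)" for c f
  proof -
    have eq: "(\<lambda>n. qnorm X (vscale X c (f n)) powr s) = (\<lambda>n. norm c powr s * qnorm X (f n) powr s)"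
      using that by (auto simp: ell_sum_def norm_scale powr_mult norm_nonneg)
    show "summable (\<lambda>n. qnorm X (vscale X c (f n)) powr s)"
      "(\<Sum>n. qnorm X (vscale X c (f n)) powr s) = norm c powr s * (\<Sum>n. qnorm X (f n) powr s)"
      unfolding eq using that by (auto simp: ell_sum_def intro!: summable_mult suminf_mult)
  qed
  show ?thesis
  proof unfold_locales
    fix f g assume fg: "f \<in> qcarrier (ell_sum s X)" "g \<in> qcarrier (ell_sum s X)"
    show "vadd (ell_sum s X) f g \<in> qcarrier (ell_sum s X)"
      using add_summable[OF fg] fg by (auto simp: ell_sum_def add_in)
    have "(\<Sum>n. qnorm X (vadd X (f n) (g n)) powr s)
        \<le> (\<Sum>n. (2 * K) powr s * (qnorm X (f n) powr s + qnorm X (g n) powr s))"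
      using fg by (intro suminf_le add_summable summable_mult summable_add le) (auto simp: ell_sum_def)
    also have "\<dots> = (2 * K) powr s * ((\<Sum>n. qnorm X (f n) powr s) + (\<Sum>n. qnorm X (g n) powr s))"
      using fg by (simp add: ell_sum_def suminf_mult suminf_add summable_add)
    finally have "(\<Sum>n. qnorm X (vadd X (f n) (g n)) powr s) powr (1 / s)
        \<le> ((2 * K) powr s * ((\<Sum>n. qnorm X (f n) powr s) + (\<Sum>n. qnorm X (g n) powr s))) powr (1 / s)"
      using s by (intro powr_mono2) (auto intro!: suminf_nonneg add_summable fg)
    also have "\<dots> = 2 * K * ((\<Sum>n. qnorm X (f n) powr s) + (\<Sum>n. qnorm X (g n) powr s)) powr (1 / s)"
      using s K_ge_1 by (simp add: powr_mult powr_powr)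
    also have "\<dots> \<le> 2 * K * (2 powr (1 / s) * ((\<Sum>n. qnorm X (f n) powr s) powr (1 / s)
        + (\<Sum>n. qnorm X (g n) powr s) powr (1 / s)))"
      using s K_ge_1 fg
      by (intro mult_left_mono powr_add_le) (auto simp: ell_sum_def intro!: suminf_nonneg)
    finally show "qnorm (ell_sum s X) (vadd (ell_sum s X) f g)
        \<le> 2 * K * 2 powr (1 / s) * (qnorm (ell_sum s X) f + qnorm (ell_sum s X) g)"
      by (simp add: ell_sum_def algebra_simps)
    show "vadd (ell_sum s X) f g = vadd (ell_sum s X) g f"
      using fg by (auto simp: ell_sum_def add_commute)
    show "vscale (ell_sum s X) c (vadd (ell_sum s X) f g)
        = vadd (ell_sum s X) (vscale (ell_sum s X) c f) (vscale (ell_sum s X) c g)" for c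
      using fg by (auto simp: ell_sum_def scale_add)
    show "vadd (ell_sum s X) (vadd (ell_sum s X) f g) h
        = vadd (ell_sum s X) f (vadd (ell_sum s X) g h)" if "h \<in> qcarrier (ell_sum s X)" for h
      using fg that by (auto simp: ell_sum_def add_assoc)
  next
    fix f assume f: "f \<in> qcarrier (ell_sum s X)"
    show "vscale (ell_sum s X) c f \<in> qcarrier (ell_sum s X)" for c
      using f scale(1)[OF f] by (auto simp: ell_sum_def scale_in)
    show "vadd (ell_sum s X) f (\<lambda>_. z) = f"
      using f by (auto simp: ell_sum_def add_zero)
    show "vscale (ell_sum s X) c (vscale (ell_sum s X) d f) = vscale (ell_sum s X) (c * d) f" for c d
      using f by (auto simp: ell_sum_def scale_scale)
    show "vscale (ell_sum s X) 1 f = f"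
      using f by (auto simp: ell_sum_def scale_one)
    show "vadd (ell_sum s X) f (vscale (ell_sum s X) (-1) f) = (\<lambda>_. z)"
      using f by (auto simp: ell_sum_def add_neg)
    show "0 \<le> qnorm (ell_sum s X) f"
      by (simp add: ell_sum_def)
    show "qnorm (ell_sum s X) (vscale (ell_sum s X) c f) = norm c * qnorm (ell_sum s X) f" for c
      using s scale(2)[OF f, of c] f
      by (simp add: ell_sum_def powr_mult powr_powr)
    assume "qnorm (ell_sum s X) f = 0"
    then have "(\<Sum>n. qnorm X (f n) powr s) = 0" by (simp add: ell_sum_def)
    then have "\<forall>n. qnorm X (f n) powr s = 0"
      using f by (subst (asm) suminf_eq_zero_iff) (auto simp: ell_sum_def)
    then show "f = (\<lambda>_. z)"
      using f by (auto simp: ell_sum_def intro!: norm_zeroD)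
  next
    show "(\<lambda>_. z) \<in> qcarrier (ell_sum s X)"
      using s by (auto simp: ell_sum_def zero_in norm_zero)
    have "1 * 1 \<le> (2 * K) * 2 powr (1 / s)"
      using s K_ge_1 by (intro mult_mono ge_one_powr_ge_zero) auto
    then show "1 \<le> 2 * K * 2 powr (1 / s)" by simp
  qed
qed

lemma quasi_normed_c_zero: "quasi_normed (c_zero :: ('k::real_normed_field, _) qspace) (\<lambda>_. 0) 1"
proof -
  have bdd: "bdd_above (range (\<lambda>n. norm (f n)))" if "f \<longlonglongrightarrow> 0" for f :: "nat \<Rightarrow> 'k"
    using convergent_imp_Bseq[OF convergentI[OF that]] by (auto simp: Bseq_def bdd_above_def)
  have le: "norm (f n) \<le> (SUP n. norm (f n))" if "f \<longlonglongrightarrow> 0" for f :: "nat \<Rightarrow> 'k" and n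
    by (intro cSUP_upper bdd that) auto
  show ?thesis
  proof unfold_locales
    fix f g :: "nat \<Rightarrow> 'k"
    assume "f \<in> qcarrier c_zero" "g \<in> qcarrier c_zero"
    then have fg: "f \<longlonglongrightarrow> 0" "g \<longlonglongrightarrow> 0" by (auto simp: c_zero_def)
    show "vadd c_zero f g \<in> qcarrier c_zero"
      using tendsto_add[OF fg] by (simp add: c_zero_def)
    have "(SUP n. norm (f n + g n)) \<le> (SUP n. norm (f n)) + (SUP n. norm (g n))"
      using le[OF fg(1)] le[OF fg(2)]
      by (intro cSUP_least) (auto intro!: norm_triangle_le add_mono)
    then show "qnorm c_zero (vadd c_zero f g) \<le> 1 * (qnorm c_zero f + qnorm c_zero g)"
      by (simp add: c_zero_def)
  next
    fix f :: "nat \<Rightarrow> 'k" and c :: 'k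
    assume "f \<in> qcarrier c_zero"
    then have f: "f \<longlonglongrightarrow> 0" by (auto simp: c_zero_def)
    show "vscale c_zero c f \<in> qcarrier c_zero"
      using tendsto_mult_left[OF f, of c] by (simp add: c_zero_def)
    show "0 \<le> qnorm c_zero f"
      using order_trans[OF norm_ge_zero le[OF f, of 0]] by (simp add: c_zero_def)
    show "qnorm c_zero (vscale c_zero c f) = norm c * qnorm c_zero f"
    proof -
      have "(SUP n. norm c * norm (f n)) = norm c * (SUP n. norm (f n))"
      proof (cases "c = 0")
        case False
        show ?thesis
        proof (intro antisym cSUP_least)
          show "norm c * norm (f n) \<le> norm c * (SUP n. norm (f n))" for n
            by (intro mult_left_mono le f) auto
          have b2: "bdd_above (range (\<lambda>n. norm c * norm (f n)))"
            using bdd[OF tendsto_mult_left[OF f, of c, simplified]] by (simp add: norm_mult)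
          have "norm (f n) \<le> (SUP n. norm c * norm (f n)) / norm c" for n
            using cSUP_upper[OF _ b2, of n] False by (simp add: field_simps)
          then have "(SUP n. norm (f n)) \<le> (SUP n. norm c * norm (f n)) / norm c"
            by (intro cSUP_least) auto
          then show "norm c * (SUP n. norm (f n)) \<le> (SUP n. norm c * norm (f n))"
            using False by (simp add: field_simps)
        qed auto
      qed simp
      then show ?thesis by (simp add: c_zero_def norm_mult)
    qed
    assume "qnorm c_zero f = 0"
    then have "norm (f n) \<le> 0" for n
      using le[OF f, of n] by (simp add: c_zero_def)
    then show "f = (\<lambda>_. 0)" by auto
  qed (auto simp: c_zero_def algebra_simps)
qed

lemma Lspace_carrierE:
  assumes "A \<in> qcarrier (Lspace M r)"
  obtains f where "f \<in> Lfun M r" "A = ae_rel M r `` {f}"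
  using assms by (auto simp: Lspace_def elim: quotientE)

lemma class_in_Lspace: "f \<in> Lfun M r \<Longrightarrow> ae_rel M r `` {f} \<in> qcarrier (Lspace M r)"
  by (auto simp: Lspace_def intro: quotientI)

lemma Lfun_zero: "(\<lambda>_. 0) \<in> Lfun M r"
  by (simp add: Lfun_def)

lemma Lfun_class_eqI:
  "\<lbrakk>f \<in> Lfun M r; g \<in> Lfun M r; AE x in M. f x = g x\<rbrakk> \<Longrightarrow> ae_rel M r `` {f} = ae_rel M r `` {g}"
  by (intro equiv_class_eq[OF equiv_ae_rel]) (simp add: ae_rel_def)

lemma Lfun_measurable: "f \<in> Lfun M r \<Longrightarrow> f \<in> borel_measurable M"
  by (simp add: Lfun_def)

lemma Lfun_integrable: "f \<in> Lfun M r \<Longrightarrow> integrable M (\<lambda>x. norm (f x) powr r)"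
  by (simp add: Lfun_def)

lemma quasi_normed_Lspace:
  fixes M :: "'a measure"
  assumes r: "0 < r"
  shows "quasi_normed (Lspace M r :: ('k::{real_normed_field, second_countable_topology}, _) qspace)
    (ae_rel M r `` {\<lambda>_. 0}) (2 * 2 powr (1 / r))"
    (is "quasi_normed ?L _ _")
proof unfold_locales
  show "ae_rel M r `` {\<lambda>_. 0 :: 'k} \<in> qcarrier ?L"
    by (intro class_in_Lspace Lfun_zero)
next
  fix A B :: "('a \<Rightarrow> 'k) set"
  assume "A \<in> qcarrier ?L" "B \<in> qcarrier ?L"
  then obtain f g where f: "f \<in> Lfun M r" "A = ae_rel M r `` {f}"
    and g: "g \<in> Lfun M r" "B = ae_rel M r `` {g}"
    by (meson Lspace_carrierE)
  note [simp] = f(2) g(2) f(1) g(1) vadd_Lspace[OF r] vscale_Lspace Lfun_add[OF r] Lfun_scale qnorm_Lspace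
  show "vadd ?L A B \<in> qcarrier ?L"
    by (simp add: class_in_Lspace)
  show "vadd ?L A B = vadd ?L B A"
    by (simp add: add.commute)
  show "vscale ?L c (vadd ?L A B) = vadd ?L (vscale ?L c A) (vscale ?L c B)" for c
    by (simp add: algebra_simps)
  show "vadd ?L (vadd ?L A B) D = vadd ?L A (vadd ?L B D)" if "D \<in> qcarrier ?L" for D
    by (rule Lspace_carrierE[OF that]) (simp add: add.assoc)
  have "(\<integral>x. norm (f x + g x) powr r \<partial>M) \<le> (\<integral>x. 2 powr r * (norm (f x) powr r + norm (g x) powr r) \<partial>M)"
  proof (rule integral_mono)
    fix x
    have "norm (f x + g x) powr r \<le> (norm (f x) + norm (g x)) powr r"
      using r by (intro powr_mono2 norm_triangle_ineq) auto
    also have "\<dots> \<le> 2 powr r * (norm (f x) powr r + norm (g x) powr r)"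
      using r by (intro powr_add_le) auto
    finally show "norm (f x + g x) powr r \<le> 2 powr r * (norm (f x) powr r + norm (g x) powr r)" .
  qed (use Lfun_integrable[OF f(1)] Lfun_integrable[OF g(1)] Lfun_integrable[OF Lfun_add[OF r f(1) g(1)]] in auto)
  also have "\<dots> = 2 powr r * ((\<integral>x. norm (f x) powr r \<partial>M) + (\<integral>x. norm (g x) powr r \<partial>M))"
    using Lfun_integrable[OF f(1)] Lfun_integrable[OF g(1)] by simp
  finally have "(\<integral>x. norm (f x + g x) powr r \<partial>M) powr (1 / r)
      \<le> (2 powr r * ((\<integral>x. norm (f x) powr r \<partial>M) + (\<integral>x. norm (g x) powr r \<partial>M))) powr (1 / r)"
    using r by (intro powr_mono2) auto
  also have "\<dots> = 2 * ((\<integral>x. norm (f x) powr r \<partial>M) + (\<integral>x. norm (g x) powr r \<partial>M)) powr (1 / r)"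
    using r by (simp add: powr_mult powr_powr)
  also have "\<dots> \<le> 2 * (2 powr (1 / r) * ((\<integral>x. norm (f x) powr r \<partial>M) powr (1 / r)
      + (\<integral>x. norm (g x) powr r \<partial>M) powr (1 / r)))"
    using r by (intro mult_left_mono powr_add_le) auto
  finally show "qnorm ?L (vadd ?L A B) \<le> 2 * 2 powr (1 / r) * (qnorm ?L A + qnorm ?L B)"
    by (simp add: algebra_simps)
next
  fix A :: "('a \<Rightarrow> 'k) set"
  assume "A \<in> qcarrier ?L"
  then obtain f where f: "f \<in> Lfun M r" "A = ae_rel M r `` {f}"
    by (rule Lspace_carrierE)
  note [simp] = f(2) f(1) vadd_Lspace[OF r] vscale_Lspace Lfun_add[OF r] Lfun_scale qnorm_Lspace Lfun_zero
  show "vscale ?L c A \<in> qcarrier ?L" for c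
    by (simp add: class_in_Lspace)
  show "vadd ?L A (ae_rel M r `` {\<lambda>_. 0}) = A" by simp
  show "vscale ?L c (vscale ?L d A) = vscale ?L (c * d) A" for c d
    by (simp add: mult.assoc)
  show "vscale ?L 1 A = A" by simp
  show "vadd ?L A (vscale ?L (-1) A) = ae_rel M r `` {\<lambda>_. 0}"
    using Lfun_scale[OF f(1), of "-1"] by simp
  show "0 \<le> qnorm ?L A" by simp
  show "qnorm ?L (vscale ?L c A) = norm c * qnorm ?L A" for c
    using r by (simp add: norm_mult powr_mult powr_powr)
  assume "qnorm ?L A = 0"
  then have "AE x in M. norm (f x) powr r = 0"
    using integral_nonneg_eq_0_iff_AE[OF Lfun_integrable[OF f(1)]] by simp
  then have "AE x in M. f x = 0" by eventually_elim simp
  then show "A = ae_rel M r `` {\<lambda>_. 0}"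
    by (simp add: Lfun_class_eqI)
next
  have "1 * 1 \<le> 2 * 2 powr (1 / r)"
    using r by (intro mult_mono ge_one_powr_ge_zero) auto
  then show "1 \<le> 2 * 2 powr (1 / r)" by simp
qed

lemma qdist_Lspace:
  fixes f g :: "'a \<Rightarrow> 'k::{real_normed_field, second_countable_topology}"
  assumes r: "0 < r" and fg: "f \<in> Lfun M r" "g \<in> Lfun M r"
  shows "qdist (Lspace M r) (ae_rel M r `` {f}) (ae_rel M r `` {g})
    = (\<integral>x. norm (g x - f x) powr r \<partial>M) powr (1 / r)"
  using Lfun_add[OF r fg(2) Lfun_scale[OF fg(1), of "-1"]] Lfun_scale[OF fg(1), of "-1"] fg
  by (simp add: qdist_def vadd_Lspace[OF r] vscale_Lspace qnorm_Lspace)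

lemma Lfun_diff:
  fixes f g :: "'a \<Rightarrow> 'k::{real_normed_field, second_countable_topology}"
  assumes r: "0 < r" and fg: "f \<in> Lfun M r" "g \<in> Lfun M r"
  shows "(\<lambda>x. f x - g x) \<in> Lfun M r"
  using Lfun_add[OF r fg(1) Lfun_scale[OF fg(2), of "-1"]] by simp

lemma Lfun_sum:
  fixes f :: "'i \<Rightarrow> 'a \<Rightarrow> 'k::{real_normed_field, second_countable_topology}"
  assumes r: "0 < r" and f: "\<And>i. i \<in> F \<Longrightarrow> f i \<in> Lfun M r"
  shows "(\<lambda>x. \<Sum>i\<in>F. a i * f i x) \<in> Lfun M r"
  using f
  by (induction F rule: infinite_finite_induct)
    (auto simp: Lfun_zero intro!: Lfun_add[OF r] Lfun_scale)

section \<open>Completeness\<close>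

text \<open>
  A rapidly converging subsequence converges almost everywhere, and Fatou's lemma passes the Cauchy
  condition to its limit.
\<close>

lemma Lfun_complete:
  fixes f :: "nat \<Rightarrow> 'a \<Rightarrow> 'k::{real_normed_field, banach, second_countable_topology}"
  assumes r: "0 < r" and f: "\<And>n. f n \<in> Lfun M r"
    and cauchy: "\<And>e. 0 < e \<Longrightarrow> \<exists>N. \<forall>m\<ge>N. \<forall>n\<ge>N. (\<integral>x. norm (f m x - f n x) powr r \<partial>M) < e"
  obtains g where "g \<in> Lfun M r" "(\<lambda>n. \<integral>x. norm (f n x - g x) powr r \<partial>M) \<longlonglongrightarrow> 0"
proof -
  have [measurable]: "f n \<in> borel_measurable M" for n
    using f by (rule Lfun_measurable)
  have int: "integrable M (\<lambda>x. norm (f m x - f n x) powr r)" for m n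
    using Lfun_integrable[OF Lfun_diff[OF r f f]] .
  have "\<exists>N. \<forall>m\<ge>N. \<forall>n\<ge>N. (\<integral>x. norm (f m x - f n x) powr r \<partial>M) < 4 powr (- r * j)" for j :: nat
    by (rule cauchy) simp
  then obtain N where N: "\<And>j m n. \<lbrakk>m \<ge> N j; n \<ge> N j\<rbrakk>
      \<Longrightarrow> (\<integral>x. norm (f m x - f n x) powr r \<partial>M) < 4 powr (- r * real j)"
    by metis
  define k where "k j = j + (\<Sum>i\<le>j. N i)" for j
  have k_ge: "k j \<ge> N j" "k j \<ge> j" "k (Suc j) \<ge> N j" for j
  proof -
    have "N j \<le> (\<Sum>i\<le>j. N i)" by (rule member_le_sum) auto
    then show "k j \<ge> N j" "k j \<ge> j" "k (Suc j) \<ge> N j" by (auto simp: k_def)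
  qed
  define d where "d j x = f (k (Suc j)) x - f (k j) x" for j x
  have [measurable]: "d j \<in> borel_measurable M" for j
    by (simp add: d_def[abs_def])
  have dint: "(\<integral>x. norm (d j x) powr r \<partial>M) < 4 powr (- r * real j)" for j
    unfolding d_def using k_ge by (intro N) auto
  \<comment> \<open>weights \<open>2\<^sup>j\<close> let one argument serve all \<open>r\<close>, below and above \<open>1\<close>\<close>
  have "(\<integral>\<^sup>+x. (\<Sum>j. ennreal ((2 ^ j * norm (d j x)) powr r)) \<partial>M)
      = (\<Sum>j. \<integral>\<^sup>+x. ennreal ((2 ^ j * norm (d j x)) powr r) \<partial>M)"
    by (intro nn_integral_suminf) measurable
  also have "\<dots> \<le> (\<Sum>j. ennreal ((2 powr (- r)) ^ j))"
  proof (intro suminf_le)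
    fix j
    have "(\<integral>\<^sup>+x. ennreal ((2 ^ j * norm (d j x)) powr r) \<partial>M)
        = (\<integral>\<^sup>+x. ennreal (2 powr (r * j)) * ennreal (norm (d j x) powr r) \<partial>M)"
      by (intro nn_integral_cong)
        (simp add: powr_mult ennreal_mult' powr_powr mult.commute flip: powr_realpow)
    also have "\<dots> = ennreal (2 powr (r * j)) * ennreal (\<integral>x. norm (d j x) powr r \<partial>M)"
      using int[of "k (Suc j)" "k j"]
      by (subst nn_integral_cmult) (auto simp: nn_integral_eq_integral d_def)
    also have "\<dots> \<le> ennreal (2 powr (r * j)) * ennreal (4 powr (- r * real j))"
      using dint[of j] by (intro mult_left_mono ennreal_leI) auto
    also have "\<dots> = ennreal ((2 powr (- r)) ^ j)"
    proof -
      have "(4::real) powr (- r * real j) = (2 powr 2) powr (- r * real j)"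
        by (simp add: powr_numeral)
      also have "2 powr (r * j) * \<dots> = 2 powr (- r * real j)"
        unfolding powr_powr by (subst powr_add[symmetric]) (simp add: algebra_simps)
      also have "\<dots> = (2 powr (- r)) ^ j"
        by (simp add: powr_powr flip: powr_realpow)
      finally show ?thesis by (simp flip: ennreal_mult')
    qed
    finally show "(\<integral>\<^sup>+x. ennreal ((2 ^ j * norm (d j x)) powr r) \<partial>M) \<le> ennreal ((2 powr (- r)) ^ j)" .
  qed auto
  also have "\<dots> < \<infinity>"
  proof -
    have "(2::real) powr (- r) < 2 powr 0" using r by (intro powr_less_mono) auto
    then have "summable (\<lambda>j. ((2::real) powr (- r)) ^ j)" by (intro summable_geometric) simp
    then show ?thesis by (subst suminf_ennreal2) auto
  qed
  finally have "AE x in M. (\<Sum>j. ennreal ((2 ^ j * norm (d j x)) powr r)) \<noteq> \<infinity>"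
    by (intro nn_integral_PInf_AE) auto
  then have AE_conv: "AE x in M. (\<lambda>j. f (k j) x) \<longlonglongrightarrow> lim (\<lambda>j. f (k j) x)"
  proof eventually_elim
    fix x assume fin: "(\<Sum>j. ennreal ((2 ^ j * norm (d j x)) powr r)) \<noteq> \<infinity>"
    have "summable (\<lambda>j. (2 ^ j * norm (d j x)) powr r)"
      using fin by (intro summable_suminf_not_top) (auto simp: top_unique)
    then have "(\<lambda>j. (2 ^ j * norm (d j x)) powr r) \<longlonglongrightarrow> 0" by (rule summable_LIMSEQ_zero)
    then have "\<forall>\<^sub>F j in sequentially. (2 ^ j * norm (d j x)) powr r < 1"
      by (rule order_tendstoD) simp
    then obtain J where J: "\<And>j. j \<ge> J \<Longrightarrow> (2 ^ j * norm (d j x)) powr r < 1"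
      by (auto simp: eventually_sequentially)
    have "norm (d j x) \<le> (1 / 2) ^ j" if "j \<ge> J" for j
    proof -
      have "\<not> 1 < 2 ^ j * norm (d j x)"
        using J[OF that] r ge_one_powr_ge_zero[of "2 ^ j * norm (d j x)" r] by auto
      then show ?thesis by (simp add: power_one_over field_simps)
    qed
    then have "summable (\<lambda>j. d j x)"
      by (intro summable_comparison_test'[where N = J, OF summable_geometric[of "1 / 2 :: real"]]) auto
    then have "(\<lambda>n. \<Sum>j<n. d j x) \<longlonglongrightarrow> (\<Sum>j. d j x)" by (rule summable_LIMSEQ)
    moreover have "(\<Sum>j<n. d j x) = f (k n) x - f (k 0) x" for n
      unfolding d_def by (rule sum_lessThan_telescope)
    ultimately have "(\<lambda>n. f (k n) x - f (k 0) x + f (k 0) x) \<longlonglongrightarrow> (\<Sum>j. d j x) + f (k 0) x"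
      by (intro tendsto_add tendsto_const) simp
    then have "convergent (\<lambda>n. f (k n) x)" by (auto simp: convergent_def)
    then show "(\<lambda>j. f (k j) x) \<longlonglongrightarrow> lim (\<lambda>j. f (k j) x)" by (simp add: convergent_LIMSEQ_iff)
  qed
  define g where "g x = lim (\<lambda>j. f (k j) x)" for x
  have [measurable]: "g \<in> borel_measurable M"
    unfolding g_def[abs_def] by (intro borel_measurable_lim_metric) measurable
  have fatou: "(\<integral>\<^sup>+x. ennreal (norm (f n x - g x) powr r) \<partial>M) \<le> ennreal e"
    if e: "0 < e" and n: "\<And>m. m \<ge> L \<Longrightarrow> (\<integral>x. norm (f n x - f m x) powr r \<partial>M) < e" for e n L
  proof -
    have "(\<integral>\<^sup>+x. ennreal (norm (f n x - g x) powr r) \<partial>M)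
        = (\<integral>\<^sup>+x. liminf (\<lambda>j. ennreal (norm (f n x - f (k j) x) powr r)) \<partial>M)"
    proof (rule nn_integral_cong_AE, use AE_conv in eventually_elim)
      fix x assume "(\<lambda>j. f (k j) x) \<longlonglongrightarrow> lim (\<lambda>j. f (k j) x)"
      then have "(\<lambda>j. norm (f n x - f (k j) x) powr r) \<longlonglongrightarrow> norm (f n x - g x) powr r"
        unfolding g_def using r by (intro tendsto_intros tendsto_powr') auto
      then show "ennreal (norm (f n x - g x) powr r)
          = liminf (\<lambda>j. ennreal (norm (f n x - f (k j) x) powr r))"
        by (intro lim_imp_Liminf[symmetric] tendsto_ennrealI) auto
    qed
    also have "\<dots> \<le> liminf (\<lambda>j. \<integral>\<^sup>+x. ennreal (norm (f n x - f (k j) x) powr r) \<partial>M)"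
      by (intro nn_integral_liminf) measurable
    also have "\<dots> \<le> limsup (\<lambda>j. \<integral>\<^sup>+x. ennreal (norm (f n x - f (k j) x) powr r) \<partial>M)"
      by (intro Liminf_le_Limsup) simp
    also have "\<dots> \<le> ennreal e"
    proof (rule Limsup_bounded)
      show "\<forall>\<^sub>F j in sequentially. (\<integral>\<^sup>+x. ennreal (norm (f n x - f (k j) x) powr r) \<partial>M) \<le> ennreal e"
        using eventually_ge_at_top[of L]
      proof eventually_elim
        fix j assume "L \<le> j"
        then have "L \<le> k j" using k_ge(2)[of j] by simp
        then show "(\<integral>\<^sup>+x. ennreal (norm (f n x - f (k j) x) powr r) \<partial>M) \<le> ennreal e"
          using n[of "k j"] int by (subst nn_integral_eq_integral) (simp_all add: ennreal_leI)
      qed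
    qed
    finally show ?thesis .
  qed
  have diff_in: "(\<lambda>x. f n x - g x) \<in> Lfun M r" and diff_le: "(\<integral>x. norm (f n x - g x) powr r \<partial>M) \<le> e"
    if e: "0 < e" and n: "\<And>m. m \<ge> L \<Longrightarrow> (\<integral>x. norm (f n x - f m x) powr r \<partial>M) < e" for e n L
  proof -
    have fat: "(\<integral>\<^sup>+x. ennreal (norm (f n x - g x) powr r) \<partial>M) \<le> ennreal e"
      by (rule fatou[OF e n])
    also have "\<dots> < \<infinity>" by simp
    finally have "integrable M (\<lambda>x. norm (f n x - g x) powr r)"
      by (intro integrableI_nonneg) auto
    then show "(\<lambda>x. f n x - g x) \<in> Lfun M r" by (simp add: Lfun_def)
    show "(\<integral>x. norm (f n x - g x) powr r \<partial>M) \<le> e"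
      using fat e by (intro integral_real_bounded) auto
  qed
  have "g \<in> Lfun M r"
  proof -
    obtain L where "\<forall>m\<ge>L. \<forall>n\<ge>L. (\<integral>x. norm (f m x - f n x) powr r \<partial>M) < 1"
      using cauchy[of 1] by auto
    then have "(\<lambda>x. f L x - g x) \<in> Lfun M r" by (intro diff_in[of 1 L]) auto
    from Lfun_diff[OF r f[of L] this] show ?thesis by simp
  qed
  moreover have "(\<lambda>n. \<integral>x. norm (f n x - g x) powr r \<partial>M) \<longlonglongrightarrow> 0"
  proof (rule LIMSEQ_I)
    fix e :: real assume e: "0 < e"
    then obtain L where L: "\<forall>m\<ge>L. \<forall>n\<ge>L. (\<integral>x. norm (f m x - f n x) powr r \<partial>M) < e / 2"
      using cauchy[of "e / 2"] by auto
    have "norm ((\<integral>x. norm (f n x - g x) powr r \<partial>M) - 0) < e" if "n \<ge> L" for n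
      using diff_le[of "e / 2" L n] e L that by (simp add: field_simps abs_of_nonneg)
    then show "\<exists>no. \<forall>n\<ge>no. norm ((\<integral>x. norm (f n x - g x) powr r \<partial>M) - 0) < e" by blast
  qed
  ultimately show ?thesis by (rule that)
qed

lemma ell_carrier:
  assumes "0 < p"
  shows "a \<in> qcarrier (ell (ereal p)) \<longleftrightarrow> summable (\<lambda>n. norm (a n) powr p)"
    "qnorm (ell (ereal p)) a = (\<Sum>n. norm (a n) powr p) powr (1 / p)"
    "vadd (ell (ereal p)) a b = (\<lambda>n. a n + b n)"
    "vscale (ell (ereal p)) c a = (\<lambda>n. c * a n)"
  by (simp_all add: ell_def ell_sum_def scalars_def)

lemma quasi_normed_ell:
  "0 < p \<Longrightarrow> quasi_normed (ell (ereal p) :: ('k::real_normed_field, _) qspace) (\<lambda>_. 0) (2 * 2 powr (1 / p))"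
  using quasi_normed_ell_sum[OF quasi_normed_scalars, of p] by (simp add: ell_def)

lemma qcomplete_ell:
  assumes p: "0 < p"
  shows "qcomplete (ell (ereal p) :: ('k::{real_normed_field, banach}, _) qspace)"
  unfolding qcomplete_def
proof (intro allI impI, elim conjE)
  fix f :: "nat \<Rightarrow> nat \<Rightarrow> 'k"
  interpret quasi_normed "ell (ereal p) :: ('k, _) qspace" "\<lambda>_. 0" "2 * 2 powr (1 / p)"
    using p by (rule quasi_normed_ell)
  assume f: "\<forall>n. f n \<in> qcarrier (ell (ereal p))"
    and cauchy: "\<forall>e>0. \<exists>N. \<forall>m\<ge>N. \<forall>n\<ge>N. qdist (ell (ereal p)) (f m) (f n) < e"
  have dist: "qdist (ell (ereal p)) a b = (\<Sum>n. norm (b n - a n) powr p) powr (1 / p)" for a b :: "nat \<Rightarrow> 'k"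
    by (simp add: qdist_def ell_carrier[OF p])
  have summ: "summable (\<lambda>i. norm (b i - a i) powr p)"
    if "a \<in> qcarrier (ell (ereal p))" "b \<in> qcarrier (ell (ereal p))" for a b :: "nat \<Rightarrow> 'k"
    using diff_in[OF that] by (simp add: ell_carrier[OF p])
  have partial: "(\<Sum>i<n. norm (b i - a i) powr p) \<le> qdist (ell (ereal p)) a b powr p"
    if "a \<in> qcarrier (ell (ereal p))" "b \<in> qcarrier (ell (ereal p))" for a b :: "nat \<Rightarrow> 'k" and n
    using p summ[OF that] unfolding dist by (simp add: powr_powr sum_le_suminf suminf_nonneg)
  have coord: "norm (b i - a i) \<le> qdist (ell (ereal p)) a b"
    if "a \<in> qcarrier (ell (ereal p))" "b \<in> qcarrier (ell (ereal p))" for a b :: "nat \<Rightarrow> 'k" and i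
  proof -
    have "norm (b i - a i) powr p \<le> (\<Sum>i<Suc i. norm (b i - a i) powr p)"
      by (intro member_le_sum) auto
    also have "\<dots> \<le> qdist (ell (ereal p)) a b powr p" using that by (rule partial)
    finally have "\<not> qdist (ell (ereal p)) a b powr p < norm (b i - a i) powr p" by simp
    then show ?thesis
      using powr_less_mono2[OF p qdist_nonneg[OF that]] not_le by blast
  qed
  have "Cauchy (\<lambda>n. f n i)" for i
  proof (rule CauchyI)
    fix e :: real assume "0 < e"
    then obtain N where N: "\<forall>m\<ge>N. \<forall>n\<ge>N. qdist (ell (ereal p)) (f m) (f n) < e"
      using cauchy[rule_format] by blast
    have "norm (f m i - f n i) < e" if "m \<ge> N" "n \<ge> N" for m n
      using le_less_trans[OF coord[of "f n" "f m" i]] f N that by simp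
    then show "\<exists>M. \<forall>m\<ge>M. \<forall>n\<ge>M. norm (f m i - f n i) < e" by blast
  qed
  then have "\<exists>g. \<forall>i. (\<lambda>n. f n i) \<longlonglongrightarrow> g i"
    by (intro choice allI) (simp add: Cauchy_convergent_iff convergent_def)
  then obtain g where g: "\<And>i. (\<lambda>n. f n i) \<longlonglongrightarrow> g i" by blast
  have diff: "summable (\<lambda>i. norm (g i - f n i) powr p)" "qdist (ell (ereal p)) (f n) g \<le> e"
    if e: "0 < e" and N: "\<forall>m\<ge>N. qdist (ell (ereal p)) (f n) (f m) < e" for e n N
  proof -
    have part: "(\<Sum>i<k. norm (g i - f n i) powr p) \<le> e powr p" for k
    proof (rule LIMSEQ_le_const2)
      show "(\<lambda>m. \<Sum>i<k. norm (f m i - f n i) powr p) \<longlonglongrightarrow> (\<Sum>i<k. norm (g i - f n i) powr p)"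
        using p by (intro tendsto_intros g tendsto_powr') auto
      show "\<exists>N. \<forall>m\<ge>N. (\<Sum>i<k. norm (f m i - f n i) powr p) \<le> e powr p"
      proof (intro exI[of _ N] allI impI)
        fix m assume "m \<ge> N"
        then have "qdist (ell (ereal p)) (f n) (f m) powr p \<le> e powr p"
          using N p f by (intro powr_mono2) (auto intro: less_imp_le qdist_nonneg)
        then show "(\<Sum>i<k. norm (f m i - f n i) powr p) \<le> e powr p"
          using partial[of "f n" "f m" k] f by simp
      qed
    qed
    show s: "summable (\<lambda>i. norm (g i - f n i) powr p)"
      using part by (intro bounded_imp_summable[where B = "e powr p"])
        (simp_all only: part powr_ge_zero flip: lessThan_Suc_atMost)
    have "(\<Sum>i. norm (g i - f n i) powr p) \<le> e powr p"
      using part by (intro suminf_le_const s) auto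
    then have "(\<Sum>i. norm (g i - f n i) powr p) powr (1 / p) \<le> (e powr p) powr (1 / p)"
      using p s by (intro powr_mono2 suminf_nonneg) auto
    then show "qdist (ell (ereal p)) (f n) g \<le> e"
      using p e by (simp add: dist powr_powr)
  qed
  show "\<exists>x\<in>qcarrier (ell (ereal p)). (\<lambda>n. qdist (ell (ereal p)) (f n) x) \<longlonglongrightarrow> 0"
  proof
    obtain N where "\<forall>m\<ge>N. \<forall>n\<ge>N. qdist (ell (ereal p)) (f m) (f n) < 1"
      using cauchy[rule_format, OF zero_less_one] by (rule exE)
    then have "(\<lambda>i. g i - f N i) \<in> qcarrier (ell (ereal p))"
      using diff(1)[of 1 N N] by (simp add: ell_carrier[OF p])
    from add_in[OF this, of "f N"] f show gX: "g \<in> qcarrier (ell (ereal p))"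
      by (simp add: ell_carrier(3)[OF p])
    show "(\<lambda>n. qdist (ell (ereal p)) (f n) g) \<longlonglongrightarrow> 0"
    proof (rule LIMSEQ_I)
      fix e :: real assume e: "0 < e"
      obtain L where L: "\<forall>m\<ge>L. \<forall>n\<ge>L. qdist (ell (ereal p)) (f m) (f n) < e / 2"
        using cauchy[rule_format, OF half_gt_zero[OF e]] by (rule exE)
      have "norm (qdist (ell (ereal p)) (f n) g - 0) < e" if "n \<ge> L" for n
        using diff(2)[of "e / 2" L n] e L that qdist_nonneg[of "f n" g] f gX by auto
      then show "\<exists>no. \<forall>n\<ge>no. norm (qdist (ell (ereal p)) (f n) g - 0) < e" by blast
    qed
  qed
qed

lemma qcomplete_Lspace:
  assumes r: "0 < r"
  shows "qcomplete (Lspace M r :: ('k::{real_normed_field, banach, second_countable_topology}, _) qspace)"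
  unfolding qcomplete_def
proof (intro allI impI, elim conjE)
  fix A :: "nat \<Rightarrow> ('a \<Rightarrow> 'k) set"
  assume A: "\<forall>n. A n \<in> qcarrier (Lspace M r)"
    and cauchy: "\<forall>e>0. \<exists>N. \<forall>m\<ge>N. \<forall>n\<ge>N. qdist (Lspace M r) (A m) (A n) < e"
  have "\<exists>f. f \<in> Lfun M r \<and> A n = ae_rel M r `` {f}" for n
    using A Lspace_carrierE by blast
  then obtain f where f: "\<And>n. f n \<in> Lfun M r" and Af: "\<And>n. A n = ae_rel M r `` {f n}" by metis
  have "\<exists>N. \<forall>m\<ge>N. \<forall>n\<ge>N. (\<integral>x. norm (f m x - f n x) powr r \<partial>M) < e" if e: "0 < e" for e
  proof -
    obtain N where N: "\<And>m n. \<lbrakk>m \<ge> N; n \<ge> N\<rbrakk> \<Longrightarrow> qdist (Lspace M r) (A m) (A n) < e powr (1 / r)"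
      using cauchy[rule_format, of "e powr (1 / r)"] e by auto
    have "(\<integral>x. norm (f m x - f n x) powr r \<partial>M) < e" if "m \<ge> N" "n \<ge> N" for m n
    proof -
      have "(\<integral>x. norm (f m x - f n x) powr r \<partial>M) powr (1 / r) < e powr (1 / r)"
        using N[OF that(2,1)] by (simp add: Af qdist_Lspace[OF r f f])
      then show ?thesis
        using r e powr_mono2[of "1 / r" e "\<integral>x. norm (f m x - f n x) powr r \<partial>M"] by force
    qed
    then show ?thesis by blast
  qed
  then obtain g where g: "g \<in> Lfun M r" "(\<lambda>n. \<integral>x. norm (f n x - g x) powr r \<partial>M) \<longlonglongrightarrow> 0"
    using Lfun_complete[where f = f and M = M and r = r] r f by blast
  have "(\<lambda>n. (\<integral>x. norm (f n x - g x) powr r \<partial>M) powr (1 / r)) \<longlonglongrightarrow> 0 powr (1 / r)"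
    using r by (intro tendsto_powr' g tendsto_const) auto
  then show "\<exists>x\<in>qcarrier (Lspace M r). (\<lambda>n. qdist (Lspace M r) (A n) x) \<longlonglongrightarrow> 0"
    using g(1) by (intro bexI[of _ "ae_rel M r `` {g}"])
      (simp_all add: Af qdist_Lspace[OF r f] class_in_Lspace norm_minus_commute)
qed

section \<open>Maps given on finitely supported sequences\<close>

text \<open>
  A map that is only defined on finitely supported sequences, there with two-sided bounds, extends
  to all of \<open>\<ell>\<^sub>p\<close> because the target is complete.
\<close>

lemma ell_embeds_if_finite_bounds:
  fixes x :: "nat \<Rightarrow> 'a \<Rightarrow> 'k::{real_normed_field, banach, second_countable_topology}"
  assumes r: "0 < r" and s: "0 < s" and p: "0 < p" and x: "\<And>n. x n \<in> Lfun M r"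
    and c: "0 < c" and C: "0 < C"
    and lower: "\<And>a F. finite F \<Longrightarrow>
      c * (\<Sum>n\<in>F. norm (a n) powr p) powr (r / p) \<le> (\<integral>w. norm (\<Sum>n\<in>F. a n * x n w) powr r \<partial>M)"
    and upper: "\<And>a F. finite F \<Longrightarrow>
      (\<integral>w. norm (\<Sum>n\<in>F. a n * x n w) powr r \<partial>M) \<le> C * (\<Sum>n\<in>F. norm (a n) powr p) powr (r / p)"
  shows "qembeds (ell (ereal p)) (ell_sum s (Lspace M r :: ('k, _) qspace))"
proof -
  let ?E = "ell (ereal p) :: ('k, _) qspace"
  let ?L = "Lspace M r :: ('k, _) qspace"
  let ?Y = "ell_sum s ?L"
  interpret E: quasi_normed ?E "\<lambda>_. 0" "2 * 2 powr (1 / p)"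
    using p by (rule quasi_normed_ell)
  interpret L: quasi_normed ?L "ae_rel M r `` {\<lambda>_. 0}" "2 * 2 powr (1 / r)"
    using r by (rule quasi_normed_Lspace)
  interpret EY: quasi_normed_pair ?E "\<lambda>_. 0" "2 * 2 powr (1 / p)" ?Y "\<lambda>_. ae_rel M r `` {\<lambda>_. 0}"
    "2 * (2 * 2 powr (1 / r)) * 2 powr (1 / s)"
    by (intro quasi_normed_pair.intro E.quasi_normed_axioms quasi_normed_ell_sum
        L.quasi_normed_axioms s)
  note ell = ell_carrier[OF p]
  define S where "S a F = ae_rel M r `` {\<lambda>w. \<Sum>n\<in>F. a n * x n w}" for a F
  have Sf: "(\<lambda>w. \<Sum>n\<in>F. a n * x n w) \<in> Lfun M r" for a F
    by (intro Lfun_sum r x)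
  have S_in: "S a F \<in> qcarrier ?L" for a F
    unfolding S_def by (intro class_in_Lspace Sf)
  have S_norm: "qnorm ?L (S a F) = (\<integral>w. norm (\<Sum>n\<in>F. a n * x n w) powr r \<partial>M) powr (1 / r)" for a F
    unfolding S_def by (intro qnorm_Lspace Sf)
  define c' where "c' = c powr (1 / r)"
  define C' where "C' = C powr (1 / r)"
  have c': "0 < c'" "0 < C'" using c C by (auto simp: c'_def C'_def)
  have S_lower: "c' * (\<Sum>n\<in>F. norm (a n) powr p) powr (1 / p) \<le> qnorm ?L (S a F)" if "finite F" for a F
  proof -
    have "(c * (\<Sum>n\<in>F. norm (a n) powr p) powr (r / p)) powr (1 / r) \<le> qnorm ?L (S a F)"
      unfolding S_norm using r c lower[OF that, of a] by (intro powr_mono2) auto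
    then show ?thesis
      using c r by (simp add: powr_mult powr_powr c'_def)
  qed
  have S_upper: "qnorm ?L (S a F) \<le> C' * (\<Sum>n\<in>F. norm (a n) powr p) powr (1 / p)" if "finite F" for a F
  proof -
    have "qnorm ?L (S a F) \<le> (C * (\<Sum>n\<in>F. norm (a n) powr p) powr (r / p)) powr (1 / r)"
      unfolding S_norm using r C upper[OF that, of a] by (intro powr_mono2) auto
    then show ?thesis
      using C r by (simp add: powr_mult powr_powr C'_def)
  qed
  have S_add: "vadd ?L (S a F) (S b F) = S (\<lambda>n. a n + b n) F" for a b F
    unfolding S_def vadd_Lspace[OF r Sf Sf] by (simp add: sum.distrib algebra_simps)
  have S_scale: "vscale ?L d (S a F) = S (\<lambda>n. d * a n) F" for d a F
    unfolding S_def vscale_Lspace[OF Sf] by (simp add: sum_distrib_left mult.assoc)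
  have S_dist: "qdist ?L (S a {..<m}) (S a {..<n}) = qnorm ?L (S a {m..<n})" if "m \<le> n" for a m n
  proof -
    have "(\<Sum>i<n. a i * x i w) - (\<Sum>i<m. a i * x i w) = (\<Sum>i=m..<n. a i * x i w)" for w
      using that by (simp flip: sum_diff add: lessThan_minus_lessThan)
    then show ?thesis
      by (simp add: S_def qdist_Lspace[OF r Sf Sf] qnorm_Lspace[OF Sf])
  qed
  have "\<exists>y\<in>qcarrier ?L. (\<lambda>n. qdist ?L (S a {..<n}) y) \<longlonglongrightarrow> 0" if a: "a \<in> qcarrier ?E" for a
  proof (rule qcomplete_Lspace[OF r, unfolded qcomplete_def, rule_format], intro conjI allI impI S_in)
    fix e :: real assume e: "0 < e"
    have summ: "summable (\<lambda>n. norm (a n) powr p)" using a by (simp add: ell)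
    define d where "d = (e / C') powr p"
    have "0 < d" using e c' by (simp add: d_def)
    then obtain N where N: "\<And>m n. m \<ge> N \<Longrightarrow> norm (\<Sum>i=m..<n. norm (a i) powr p) < d"
      using summ unfolding summable_Cauchy by blast
    have small: "qdist ?L (S a {..<m}) (S a {..<n}) < e" if "N \<le> m" "m \<le> n" for m n
    proof -
      have "(\<Sum>i=m..<n. norm (a i) powr p) < d" using N[OF that(1), of n] by simp
      then have "(\<Sum>i=m..<n. norm (a i) powr p) powr (1 / p) < d powr (1 / p)"
        using p by (intro powr_less_mono2 sum_nonneg) auto
      also have "d powr (1 / p) = e / C'"
        using p e c' by (simp add: d_def powr_powr)
      finally have "C' * (\<Sum>i=m..<n. norm (a i) powr p) powr (1 / p) < e"
        using c' by (simp add: field_simps)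
      then show ?thesis
        using S_upper[of "{m..<n}" a] that by (simp add: S_dist)
    qed
    have "qdist ?L (S a {..<m}) (S a {..<n}) < e" if "m \<ge> N" "n \<ge> N" for m n
      using small[of m n] small[of n m] that L.qdist_commute[OF S_in S_in, of a "{..<m}" a "{..<n}"]
      by (cases "m \<le> n") auto
    then show "\<exists>N. \<forall>m\<ge>N. \<forall>n\<ge>N. qdist ?L (S a {..<m}) (S a {..<n}) < e" by blast
  qed
  then obtain T where T: "\<And>a. a \<in> qcarrier ?E \<Longrightarrow> T a \<in> qcarrier ?L"
      "\<And>a. a \<in> qcarrier ?E \<Longrightarrow> (\<lambda>n. qdist ?L (S a {..<n}) (T a)) \<longlonglongrightarrow> 0"
    by metis
  have T_add: "T (vadd ?E a b) = vadd ?L (T a) (T b)" if a: "a \<in> qcarrier ?E" and b: "b \<in> qcarrier ?E" for a b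
  proof (rule L.qdist_limit_unique[of "\<lambda>n. S (vadd ?E a b) {..<n}"])
    show "(\<lambda>n. qdist ?L (S (vadd ?E a b) {..<n}) (vadd ?L (T a) (T b))) \<longlonglongrightarrow> 0"
    proof (rule tendsto_sandwich[OF _ _ tendsto_const])
      show "(\<lambda>n. 2 * 2 powr (1 / r) * (qdist ?L (S a {..<n}) (T a) + qdist ?L (S b {..<n}) (T b))) \<longlonglongrightarrow> 0"
        using tendsto_mult_left[OF tendsto_add[OF T(2)[OF a] T(2)[OF b]]] by simp
      show "\<forall>\<^sub>F n in sequentially. qdist ?L (S (vadd ?E a b) {..<n}) (vadd ?L (T a) (T b))
          \<le> 2 * 2 powr (1 / r) * (qdist ?L (S a {..<n}) (T a) + qdist ?L (S b {..<n}) (T b))"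
        using T(1) a b by (intro always_eventually allI)
          (simp add: ell S_add[symmetric] L.qdist_add S_in)
      show "\<forall>\<^sub>F n in sequentially. 0 \<le> qdist ?L (S (vadd ?E a b) {..<n}) (vadd ?L (T a) (T b))"
        using T(1) a b by (intro always_eventually allI L.qdist_nonneg S_in L.add_in)
    qed
  qed (use T E.add_in L.add_in S_in a b in auto)
  have T_scale: "T (vscale ?E d a) = vscale ?L d (T a)" if a: "a \<in> qcarrier ?E" for a d
  proof (rule L.qdist_limit_unique[of "\<lambda>n. S (vscale ?E d a) {..<n}"])
    have "(\<lambda>n. norm d * qdist ?L (S a {..<n}) (T a)) \<longlonglongrightarrow> norm d * 0"
      by (intro tendsto_mult_left T a)
    then show "(\<lambda>n. qdist ?L (S (vscale ?E d a) {..<n}) (vscale ?L d (T a))) \<longlonglongrightarrow> 0"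
      using a by (simp add: ell S_scale[symmetric] L.qdist_scale S_in T)
  qed (use T E.scale_in L.scale_in S_in a in auto)
  define KL where "KL = 2 * 2 powr (1 / r :: real)"
  have KL: "0 < KL" by (simp add: KL_def)
  have norm_lim: "(\<lambda>n. (\<Sum>i<n. norm (a i) powr p) powr (1 / p)) \<longlonglongrightarrow> qnorm ?E a" if "a \<in> qcarrier ?E" for a
    using that p unfolding ell
    by (intro tendsto_powr' tendsto_const summable_LIMSEQ)
      (auto intro!: always_eventually sum_nonneg)
  have T_upper: "qnorm ?L (T a) \<le> KL * C' * qnorm ?E a" if a: "a \<in> qcarrier ?E" for a
  proof (rule LIMSEQ_le_const)
    show "(\<lambda>n. KL * (C' * (\<Sum>i<n. norm (a i) powr p) powr (1 / p) + qdist ?L (S a {..<n}) (T a)))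
        \<longlonglongrightarrow> KL * C' * qnorm ?E a"
      using tendsto_mult_left[OF tendsto_add[OF tendsto_mult_left[OF norm_lim[OF a], of C'] T(2)[OF a]], of KL]
      by (simp add: mult.assoc)
    have "qnorm ?L (T a) \<le> KL * (C' * (\<Sum>i<n. norm (a i) powr p) powr (1 / p) + qdist ?L (S a {..<n}) (T a))" for n
    proof -
      have "qnorm ?L (T a) \<le> KL * (qnorm ?L (S a {..<n}) + qdist ?L (S a {..<n}) (T a))"
        unfolding KL_def by (intro L.norm_le_dist S_in T a)
      also have "\<dots> \<le> KL * (C' * (\<Sum>i<n. norm (a i) powr p) powr (1 / p) + qdist ?L (S a {..<n}) (T a))"
        using S_upper[of "{..<n}" a] KL by (intro mult_left_mono add_right_mono) auto
      finally show ?thesis .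
    qed
    then show "\<exists>N. \<forall>n\<ge>N. qnorm ?L (T a) \<le> KL * (C' * (\<Sum>i<n. norm (a i) powr p) powr (1 / p) + qdist ?L (S a {..<n}) (T a))"
      by blast
  qed
  have T_lower: "c' / KL * qnorm ?E a \<le> qnorm ?L (T a)" if a: "a \<in> qcarrier ?E" for a
  proof -
    have "c' * qnorm ?E a \<le> KL * qnorm ?L (T a)"
    proof (rule LIMSEQ_le)
      show "(\<lambda>n. c' * (\<Sum>i<n. norm (a i) powr p) powr (1 / p)) \<longlonglongrightarrow> c' * qnorm ?E a"
        by (intro tendsto_mult_left norm_lim a)
      show "(\<lambda>n. KL * (qnorm ?L (T a) + qdist ?L (S a {..<n}) (T a))) \<longlonglongrightarrow> KL * qnorm ?L (T a)"
        using tendsto_mult_left[OF tendsto_add[OF tendsto_const T(2)[OF a]]] by simp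
      have "c' * (\<Sum>i<n. norm (a i) powr p) powr (1 / p) \<le> KL * (qnorm ?L (T a) + qdist ?L (S a {..<n}) (T a))" for n
        using S_lower[of "{..<n}" a] L.norm_le_dist[OF T(1)[OF a] S_in, of a "{..<n}"]
          L.qdist_commute[OF T(1)[OF a] S_in, of a "{..<n}"]
        by (simp add: KL_def)
      then show "\<exists>N. \<forall>n\<ge>N. c' * (\<Sum>i<n. norm (a i) powr p) powr (1 / p)
          \<le> KL * (qnorm ?L (T a) + qdist ?L (S a {..<n}) (T a))" by blast
    qed
    then show ?thesis using KL by (simp add: field_simps)
  qed
  \<comment> \<open>\<open>L\<^sub>r\<close> sits in \<open>\<ell>\<^sub>s(L\<^sub>r)\<close> as the first coordinate\<close>
  define J where "J y = (\<lambda>i::nat. if i = 0 then y else ae_rel M r `` {\<lambda>_. 0 :: 'k})" for y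
  have J_sums: "(\<lambda>i. qnorm ?L (J y i) powr s) sums (qnorm ?L y powr s)" for y
  proof -
    have "(\<lambda>i. if i = 0 then qnorm ?L y powr s else 0) sums (qnorm ?L y powr s)"
      using sums_single[of 0 "\<lambda>_. qnorm ?L y powr s"] by simp
    moreover have "(\<lambda>i. qnorm ?L (J y i) powr s) = (\<lambda>i. if i = 0 then qnorm ?L y powr s else 0)"
      using s L.norm_zero by (auto simp: J_def)
    ultimately show ?thesis by simp
  qed
  have J_norm: "qnorm ?Y (J y) = qnorm ?L y" if "y \<in> qcarrier ?L" for y
    using sums_unique[OF J_sums[of y], symmetric] s L.norm_nonneg[OF that] by (simp add: ell_sum_def powr_powr)
  have "qlinear ?E ?Y (\<lambda>a. J (T a))"
    unfolding qlinear_def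
  proof (intro conjI ballI allI image_subsetI)
    fix a assume a: "a \<in> qcarrier ?E"
    show "J (T a) \<in> qcarrier ?Y"
      using sums_summable[OF J_sums[of "T a"]] T(1)[OF a] L.zero_in by (simp add: ell_sum_def J_def)
    show "J (T (vscale ?E d a)) = vscale ?Y d (J (T a))" for d
      by (auto simp: fun_eq_iff T_scale[OF a] J_def ell_sum_def L.scale_zero)
    show "J (T (vadd ?E a b)) = vadd ?Y (J (T a)) (J (T b))" if "b \<in> qcarrier ?E" for b
      by (auto simp: fun_eq_iff T_add[OF a that] J_def ell_sum_def L.add_zero L.zero_in)
  qed
  then show ?thesis
    using T_lower T_upper T(1) c' KL
    by (intro EY.qembeds_if_bounds[of _ "c' / KL" "KL * C'"] qcomplete_ell p) (auto simp: J_norm)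
qed

section \<open>Khintchine's inequality\<close>

text \<open>
  A choice of signs is encoded as the set \<open>A\<close> of the indices with a minus sign, so averages over all
  choices are averages over a power set.
\<close>

definition signed_sum :: "('i \<Rightarrow> 'v::ab_group_add) \<Rightarrow> 'i set \<Rightarrow> 'i set \<Rightarrow> 'v" where
  "signed_sum v F A = (\<Sum>k\<in>F. if k \<in> A then - v k else v k)"

definition sign_avg :: "'i set \<Rightarrow> ('i set \<Rightarrow> real) \<Rightarrow> real" where
  "sign_avg F f = (\<Sum>A\<in>Pow F. f A) / 2 ^ card F"

lemma sign_avg_insert:
  assumes "finite F" "x \<notin> F"
  shows "sign_avg (insert x F) f = sign_avg F (\<lambda>A. (f A + f (insert x A)) / 2)"
proof -
  have inj: "inj_on (insert x) (Pow F)"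
    using assms by (auto simp: inj_on_def)
  have "Pow F \<inter> insert x ` Pow F = {}"
    using assms by auto
  then have "(\<Sum>A\<in>Pow (insert x F). f A) = (\<Sum>A\<in>Pow F. f A + f (insert x A))"
    using assms unfolding Pow_insert
    by (simp add: sum.union_disjoint sum.reindex[OF inj] sum.distrib)
  then show ?thesis
    using assms by (simp add: sign_avg_def sum_divide_distrib)
qed

lemma signed_sum_insert:
  assumes "finite F" "x \<notin> F" "A \<subseteq> F"
  shows "signed_sum v (insert x F) A = signed_sum v F A + v x"
    "signed_sum v (insert x F) (insert x A) = signed_sum v F A - v x"
proof -
  have "x \<notin> A" using assms by auto
  moreover have "(\<Sum>k\<in>F. if k \<in> insert x A then - v k else v k) = (\<Sum>k\<in>F. if k \<in> A then - v k else v k)"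
    using assms by (intro sum.cong) auto
  ultimately show "signed_sum v (insert x F) A = signed_sum v F A + v x"
    "signed_sum v (insert x F) (insert x A) = signed_sum v F A - v x"
    using assms by (auto simp: signed_sum_def)
qed

lemma sign_avg_cong: "(\<And>A. A \<subseteq> F \<Longrightarrow> f A = g A) \<Longrightarrow> sign_avg F f = sign_avg F g"
  by (auto simp: sign_avg_def intro!: arg_cong2[where f = "(/)"] sum.cong)

lemma sign_avg_mono: "(\<And>A. A \<subseteq> F \<Longrightarrow> f A \<le> g A) \<Longrightarrow> sign_avg F f \<le> sign_avg F g"
  by (auto simp: sign_avg_def intro!: divide_right_mono sum_mono)

lemma sign_avg_add: "sign_avg F (\<lambda>A. f A + g A) = sign_avg F f + sign_avg F g"
  by (simp add: sign_avg_def sum.distrib add_divide_distrib)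

lemma sign_avg_mult: "sign_avg F (\<lambda>A. c * f A) = c * sign_avg F f"
  by (simp add: sign_avg_def sum_distrib_left)

lemma sign_avg_sum: "sign_avg F (\<lambda>A. \<Sum>b\<in>B. f b A) = (\<Sum>b\<in>B. sign_avg F (f b))"
  unfolding sign_avg_def by (subst sum.swap) (simp add: sum_divide_distrib)

lemma sign_avg_const: "finite F \<Longrightarrow> sign_avg F (\<lambda>A. c) = c"
  by (simp add: sign_avg_def card_Pow)

abbreviation sign_moment :: "real \<Rightarrow> ('i \<Rightarrow> 'v::real_normed_vector) \<Rightarrow> 'i set \<Rightarrow> real" where
  "sign_moment r v F \<equiv> sign_avg F (\<lambda>A. norm (signed_sum v F A) powr r)"

lemma sign_avg_norm_sq:
  fixes v :: "'i \<Rightarrow> 'v::real_inner"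
  assumes "finite F"
  shows "sign_avg F (\<lambda>A. (norm (signed_sum v F A))\<^sup>2) = (\<Sum>k\<in>F. (norm (v k))\<^sup>2)"
  using assms
proof induction
  case empty
  show ?case by (simp add: sign_avg_def signed_sum_def)
next
  case (insert x F)
  have "sign_avg (insert x F) (\<lambda>A. (norm (signed_sum v (insert x F) A))\<^sup>2)
      = sign_avg F (\<lambda>A. (norm (signed_sum v F A))\<^sup>2 + (norm (v x))\<^sup>2)"
    unfolding sign_avg_insert[OF insert(1,2)]
    by (intro sign_avg_cong)
      (simp add: signed_sum_insert[OF insert(1,2)] power2_norm_eq_inner algebra_simps inner_commute)
  then show ?case
    using insert by (simp add: sign_avg_add sign_avg_const)
qed

lemma cosh_le_exp_sq: "cosh x \<le> exp (x\<^sup>2)" for x :: real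
proof (cases "\<bar>x\<bar> \<le> 1")
  case True
  have "exp y \<le> 1 + y + y\<^sup>2" if "\<bar>y\<bar> \<le> 1" for y :: real
  proof (cases "y \<ge> 0")
    case True
    then show ?thesis using that exp_bound[of y] by simp
  next
    case False
    have "y * y * y \<le> 0" using False by (intro mult_nonneg_nonpos) auto
    moreover have "(1 + y + y\<^sup>2) * (1 - y) = 1 - y * y * y"
      by (simp add: power2_eq_square algebra_simps)
    ultimately have "1 \<le> (1 + y + y\<^sup>2) * (1 - y)" by simp
    also have "\<dots> \<le> (1 + y + y\<^sup>2) * exp (- y)"
      using exp_ge_add_one_self[of "- y"] that zero_le_power2[of y] by (intro mult_left_mono) auto
    finally show ?thesis by (simp add: exp_minus field_simps)
  qed
  from this[of x] this[of "- x"] True have "cosh x \<le> 1 + x\<^sup>2"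
    by (simp add: cosh_def)
  also have "\<dots> \<le> exp (x\<^sup>2)" by (rule exp_ge_add_one_self)
  finally show ?thesis .
next
  case False
  then have "\<bar>x\<bar> * 1 \<le> \<bar>x\<bar> * \<bar>x\<bar>" by (intro mult_left_mono) auto
  then have "\<bar>x\<bar> \<le> x\<^sup>2" by (simp add: power2_eq_square flip: abs_mult)
  then have "exp x \<le> exp (x\<^sup>2)" "exp (- x) \<le> exp (x\<^sup>2)" by auto
  then show ?thesis by (simp add: cosh_def del: exp_le_cancel_iff)
qed

text \<open>
  The hyperbolic cosine plays the part of a moment generating function: the addition theorem makes its
  average over signs factorise.
\<close>

lemma sign_avg_cosh:
  fixes v :: "'i \<Rightarrow> real"
  assumes "finite F"
  shows "sign_avg F (\<lambda>A. cosh (signed_sum v F A)) = (\<Prod>k\<in>F. cosh (v k))"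
  using assms
proof induction
  case empty
  show ?case by (simp add: sign_avg_def signed_sum_def)
next
  case (insert x F)
  have "sign_avg (insert x F) (\<lambda>A. cosh (signed_sum v (insert x F) A))
      = sign_avg F (\<lambda>A. cosh (v x) * cosh (signed_sum v F A))"
    unfolding sign_avg_insert[OF insert(1,2)]
    by (intro sign_avg_cong) (simp add: signed_sum_insert[OF insert(1,2)] cosh_add cosh_diff)
  then show ?case
    using insert by (simp add: sign_avg_mult)
qed

lemma sign_avg_powr_scale:
  fixes v :: "'i \<Rightarrow> 'v::real_normed_vector"
  assumes "0 \<le> t"
  shows "sign_moment r (\<lambda>k. t *\<^sub>R v k) F
    = t powr r * sign_moment r v F"
proof -
  have "signed_sum (\<lambda>k. t *\<^sub>R v k) F A = t *\<^sub>R signed_sum v F A" for A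
    unfolding signed_sum_def scaleR_sum_right by (intro sum.cong) auto
  then show ?thesis
    using assms by (simp add: powr_mult sign_avg_mult)
qed

text \<open>By homogeneity both Khintchine inequalities reduce to the case of Euclidean length one.\<close>

lemma khintchine_normalise:
  fixes v :: "'i \<Rightarrow> 'v::real_normed_vector"
  assumes F: "finite F" and s: "s = (\<Sum>k\<in>F. (norm (v k))\<^sup>2)" and "s \<noteq> 0"
  shows "(\<Sum>k\<in>F. (norm (inverse (sqrt s) *\<^sub>R v k))\<^sup>2) = 1"
    "sign_moment r v F
      = s powr (r / 2) * sign_avg F (\<lambda>A. norm (signed_sum (\<lambda>k. inverse (sqrt s) *\<^sub>R v k) F A) powr r)"
proof -
  have "0 \<le> s" unfolding s by (intro sum_nonneg) auto
  then have pos: "0 < s" using \<open>s \<noteq> 0\<close> by simp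
  have "(\<Sum>k\<in>F. (norm (inverse (sqrt s) *\<^sub>R v k))\<^sup>2) = (inverse (sqrt s))\<^sup>2 * s"
    using s by (simp add: power_mult_distrib sum_distrib_left power_inverse)
  then show "(\<Sum>k\<in>F. (norm (inverse (sqrt s) *\<^sub>R v k))\<^sup>2) = 1"
    using pos by (simp add: power_inverse)
  have "inverse (sqrt s) = s powr (- (1 / 2))"
    using pos by (simp add: powr_minus powr_half_sqrt)
  then have "s powr (r / 2) * inverse (sqrt s) powr r = 1"
    using pos by (simp add: powr_powr flip: powr_add)
  then show "sign_moment r v F
      = s powr (r / 2) * sign_avg F (\<lambda>A. norm (signed_sum (\<lambda>k. inverse (sqrt s) *\<^sub>R v k) F A) powr r)"
    using pos by (subst sign_avg_powr_scale) (simp_all flip: mult.assoc)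
qed

lemma signed_sum_null:
  assumes "finite F" "(\<Sum>k\<in>F. (norm (v k :: 'v::real_normed_vector))\<^sup>2) = 0"
  shows "signed_sum v F A = 0"
proof -
  have "\<forall>k\<in>F. v k = 0"
    using assms by (subst (asm) sum_nonneg_eq_0_iff) auto
  then show ?thesis by (auto simp: signed_sum_def intro: sum.neutral)
qed

lemma khintchine_upper_real:
  fixes v :: "'i \<Rightarrow> real"
  assumes F: "finite F" and r: "0 < r"
  shows "sign_avg F (\<lambda>A. \<bar>signed_sum v F A\<bar> powr r)
    \<le> 2 * r powr r * exp 1 * (\<Sum>k\<in>F. (v k)\<^sup>2) powr (r / 2)"
proof -
  have norm1: "sign_avg F (\<lambda>A. \<bar>signed_sum v F A\<bar> powr r) \<le> 2 * r powr r * exp 1"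
    if "(\<Sum>k\<in>F. (v k)\<^sup>2) = 1" for v :: "'i \<Rightarrow> real"
  proof -
    have "\<bar>x\<bar> powr r \<le> 2 * r powr r * cosh x" for x :: real
    proof -
      have "\<bar>x\<bar> / r \<le> exp (\<bar>x\<bar> / r)" using exp_ge_add_one_self[of "\<bar>x\<bar> / r"] by linarith
      then have "\<bar>x\<bar> powr r \<le> (r * exp (\<bar>x\<bar> / r)) powr r"
        using r by (intro powr_mono2) (auto simp: field_simps)
      also have "\<dots> = r powr r * exp \<bar>x\<bar>"
        using r by (simp add: powr_mult) (simp add: powr_def)
      also have "\<dots> \<le> r powr r * (2 * cosh x)"
        by (intro mult_left_mono) (cases "x \<ge> 0"; auto simp: cosh_def)+
      finally show ?thesis by (simp add: mult_ac)
    qed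
    then have "sign_avg F (\<lambda>A. \<bar>signed_sum v F A\<bar> powr r)
        \<le> sign_avg F (\<lambda>A. 2 * r powr r * cosh (signed_sum v F A))"
      by (intro sign_avg_mono) simp
    also have "\<dots> = 2 * r powr r * (\<Prod>k\<in>F. cosh (v k))"
      by (simp add: sign_avg_mult sign_avg_cosh[OF F])
    also have "\<dots> \<le> 2 * r powr r * (\<Prod>k\<in>F. exp ((v k)\<^sup>2))"
      by (intro mult_left_mono prod_mono) (auto intro: cosh_le_exp_sq)
    also have "\<dots> = 2 * r powr r * exp 1"
      using F that by (simp flip: exp_sum)
    finally show ?thesis .
  qed
  show ?thesis
  proof (cases "(\<Sum>k\<in>F. (v k)\<^sup>2) = 0")
    case True
    then have "signed_sum v F A = 0" for A
      using signed_sum_null[OF F, of v] by simp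
    then show ?thesis using F r by (simp add: sign_avg_const)
  next
    case False
    let ?s = "\<Sum>k\<in>F. (v k)\<^sup>2"
    have s: "?s = (\<Sum>k\<in>F. (norm (v k))\<^sup>2)" by simp
    have "sign_avg F (\<lambda>A. \<bar>signed_sum (\<lambda>k. inverse (sqrt ?s) *\<^sub>R v k) F A\<bar> powr r) \<le> 2 * r powr r * exp 1"
      using khintchine_normalise(1)[OF F s False] by (intro norm1) simp
    from mult_left_mono[OF this, of "?s powr (r / 2)"] show ?thesis
      using khintchine_normalise(2)[OF F s False, of r] by (simp add: mult.commute)
  qed
qed

lemma sum_powr_le:
  fixes f :: "'b \<Rightarrow> real"
  assumes B: "finite B" "B \<noteq> {}" and f: "\<And>b. b \<in> B \<Longrightarrow> 0 \<le> f b" and r: "0 \<le> r"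
  shows "(\<Sum>b\<in>B. f b) powr r \<le> real (card B) powr r * (\<Sum>b\<in>B. f b powr r)"
proof -
  have "Max (f ` B) \<in> f ` B" using B by (intro Max_in) auto
  then obtain b where b: "b \<in> B" "Max (f ` B) = f b" by blast
  then have max: "f c \<le> f b" if "c \<in> B" for c
    using Max_ge[of "f ` B" "f c"] B that by simp
  have "(\<Sum>b\<in>B. f b) \<le> real (card B) * f b"
    using sum_bounded_above[of B f "f b"] max by simp
  then have "(\<Sum>b\<in>B. f b) powr r \<le> (real (card B) * f b) powr r"
    using r f by (intro powr_mono2 sum_nonneg) auto
  also have "\<dots> = real (card B) powr r * f b powr r"
    using f b by (simp add: powr_mult)
  also have "\<dots> \<le> real (card B) powr r * (\<Sum>b\<in>B. f b powr r)"
    using b B by (intro mult_left_mono member_le_sum) auto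
  finally show ?thesis .
qed

text \<open>
  The scalar inequality is applied to each coordinate.
\<close>

lemma khintchine_upper:
  assumes r: "0 < r"
  obtains C where "0 < C"
    "\<And>F (v :: 'i \<Rightarrow> 'v::euclidean_space). finite F \<Longrightarrow>
      sign_moment r v F \<le> C * (\<Sum>k\<in>F. (norm (v k))\<^sup>2) powr (r / 2)"
proof
  define c where "c = 2 * r powr r * exp 1"
  define d where "d = real DIM('v)"
  have c: "0 < c" using r by (simp add: c_def)
  have d: "0 < d" by (simp add: d_def)
  show "0 < d powr r * d * c" using c d by simp
  fix F :: "'i set" and v :: "'i \<Rightarrow> 'v" assume F: "finite F"
  have coord: "signed_sum v F A \<bullet> b = signed_sum (\<lambda>k. v k \<bullet> b) F A" for A b
    unfolding signed_sum_def inner_sum_left by (intro sum.cong) auto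
  have "sign_moment r v F
      \<le> sign_avg F (\<lambda>A. d powr r * (\<Sum>b\<in>Basis. \<bar>signed_sum (\<lambda>k. v k \<bullet> b) F A\<bar> powr r))"
  proof (rule sign_avg_mono)
    fix A
    have "norm (signed_sum v F A) powr r \<le> (\<Sum>b\<in>Basis. \<bar>signed_sum v F A \<bullet> b\<bar>) powr r"
      using r norm_le_l1[of "signed_sum v F A"] by (intro powr_mono2) auto
    also have "\<dots> \<le> d powr r * (\<Sum>b\<in>Basis. \<bar>signed_sum v F A \<bullet> b\<bar> powr r)"
      unfolding d_def using r by (intro sum_powr_le) auto
    finally show "norm (signed_sum v F A) powr r
        \<le> d powr r * (\<Sum>b\<in>Basis. \<bar>signed_sum (\<lambda>k. v k \<bullet> b) F A\<bar> powr r)"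
      by (simp add: coord)
  qed
  also have "\<dots> = d powr r * (\<Sum>b\<in>Basis. sign_avg F (\<lambda>A. \<bar>signed_sum (\<lambda>k. v k \<bullet> b) F A\<bar> powr r))"
    by (simp add: sign_avg_mult sign_avg_sum)
  also have "\<dots> \<le> d powr r * (\<Sum>b\<in>(Basis::'v set). c * (\<Sum>k\<in>F. (norm (v k))\<^sup>2) powr (r / 2))"
  proof (intro mult_left_mono sum_mono)
    fix b :: 'v assume b: "b \<in> Basis"
    have "sign_avg F (\<lambda>A. \<bar>signed_sum (\<lambda>k. v k \<bullet> b) F A\<bar> powr r)
        \<le> c * (\<Sum>k\<in>F. (v k \<bullet> b)\<^sup>2) powr (r / 2)"
      unfolding c_def by (rule khintchine_upper_real[OF F r])
    also have "\<dots> \<le> c * (\<Sum>k\<in>F. (norm (v k))\<^sup>2) powr (r / 2)"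
      using c r Basis_le_norm[OF b]
      by (intro mult_left_mono powr_mono2 sum_mono sum_nonneg) (auto simp: abs_le_square_iff[symmetric])
    finally show "sign_avg F (\<lambda>A. \<bar>signed_sum (\<lambda>k. v k \<bullet> b) F A\<bar> powr r)
        \<le> c * (\<Sum>k\<in>F. (norm (v k))\<^sup>2) powr (r / 2)" .
  qed auto
  finally show "sign_moment r v F
      \<le> d powr r * d * c * (\<Sum>k\<in>F. (norm (v k))\<^sup>2) powr (r / 2)"
    by (simp add: d_def mult_ac)
qed

text \<open>
  The second moment is known exactly and the fourth is bounded, so neither small nor large values
  can account for all of the second moment; the values in between bound every other moment from
  below.
\<close>

lemma khintchine_lower:
  assumes r: "0 < r"
  obtains c where "0 < c"
    "\<And>F (v :: 'i \<Rightarrow> 'v::euclidean_space). finite F \<Longrightarrow>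
      c * (\<Sum>k\<in>F. (norm (v k))\<^sup>2) powr (r / 2) \<le> sign_moment r v F"
proof -
  obtain C where C: "0 < C" "\<And>F (v :: 'i \<Rightarrow> 'v). finite F \<Longrightarrow>
      sign_moment 4 v F \<le> C * (\<Sum>k\<in>F. (norm (v k))\<^sup>2) powr (4 / 2)"
    using khintchine_upper[of 4] by auto
  define m where "m = 4 * C"
  define c where "c = 1 / (2 * m * 2 powr r)"
  have m: "0 < m" and c: "0 < c" using C by (auto simp: m_def c_def)
  \<comment> \<open>the middle term dominates except where the second moment is small and where the fourth
     moment controls it\<close>
  have pointwise: "x\<^sup>2 \<le> 1 / 4 + m * 2 powr r * x powr r + x powr 4 / m" if x: "0 \<le> x" for x :: real
  proof -
    have nn: "0 \<le> m * 2 powr r * x powr r" "0 \<le> x powr 4 / m" using m by auto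
    have "x \<le> 1 / 2 \<or> (1 / 2 < x \<and> x\<^sup>2 \<le> m) \<or> (m < x\<^sup>2)" by linarith
    then show ?thesis
    proof (elim disjE conjE)
      assume "x \<le> 1 / 2"
      then have "x\<^sup>2 \<le> (1 / 2)\<^sup>2" using x by (intro power_mono)
      then show ?thesis using nn by (simp add: power2_eq_square)
    next
      assume a: "1 / 2 < x" "x\<^sup>2 \<le> m"
      have "1 \<le> (2 * x) powr r" using a r by (intro ge_one_powr_ge_zero) auto
      then have "m * 1 \<le> m * (2 powr r * x powr r)" using m x by (intro mult_left_mono) (auto simp: powr_mult)
      then show ?thesis using a nn by (simp add: mult.assoc)
    next
      assume a: "m < x\<^sup>2"
      have "x\<^sup>2 * m \<le> x\<^sup>2 * x\<^sup>2" using a by (intro mult_left_mono) auto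
      also have "\<dots> = x powr 4" using x by (simp add: powr_numeral flip: power_add)
      finally have "x\<^sup>2 \<le> x powr 4 / m" using m by (simp add: field_simps)
      then show ?thesis using nn by simp
    qed
  qed
  have norm1: "c \<le> sign_moment r v F"
    if F: "finite F" and v: "(\<Sum>k\<in>F. (norm (v k))\<^sup>2) = 1" for F :: "'i set" and v :: "'i \<Rightarrow> 'v"
  proof -
    have "1 = sign_avg F (\<lambda>A. (norm (signed_sum v F A))\<^sup>2)"
      using v by (simp add: sign_avg_norm_sq[OF F])
    also have "\<dots> \<le> sign_avg F (\<lambda>A. 1 / 4 + m * 2 powr r * norm (signed_sum v F A) powr r
        + 1 / m * norm (signed_sum v F A) powr 4)"
      using pointwise by (intro sign_avg_mono) simp
    also have "\<dots> = 1 / 4 + m * 2 powr r * sign_moment r v F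
        + 1 / m * sign_moment 4 v F"
      by (simp only: sign_avg_add sign_avg_mult sign_avg_const[OF F])
    also have "1 / m * sign_moment 4 v F \<le> 1 / m * C"
      using C(2)[OF F, of v] v m by (intro mult_left_mono) auto
    also have "1 / m * C = 1 / 4" using C by (simp add: m_def)
    finally show ?thesis using m by (simp add: c_def field_simps)
  qed
  show ?thesis
  proof (rule that[OF c])
    fix F :: "'i set" and v :: "'i \<Rightarrow> 'v" assume F: "finite F"
    let ?s = "\<Sum>k\<in>F. (norm (v k))\<^sup>2"
    show "c * ?s powr (r / 2) \<le> sign_moment r v F"
    proof (cases "?s = 0")
      case True
      then show ?thesis using F r by (simp add: sign_avg_def sum_nonneg)
    next
      case False
      show ?thesis
        unfolding khintchine_normalise(2)[OF F refl False]
        using mult_left_mono[OF norm1[OF F khintchine_normalise(1)[OF F refl False]], of "?s powr (r / 2)"]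
        by (simp add: mult.commute)
    qed
  qed
qed

section \<open>Binary digits as independent coin flips\<close>

lemma nn_integral_unit:
  assumes [measurable]: "F \<in> borel_measurable borel"
  shows "(\<integral>\<^sup>+x. F x \<partial>lebesgue_on {0..1::real}) = (\<integral>\<^sup>+x. F x * indicator {0..<1} x \<partial>lborel)"
proof -
  have "(\<integral>\<^sup>+x. F x \<partial>lebesgue_on {0..1::real}) = (\<integral>\<^sup>+x. F x * indicator {0..1} x \<partial>lebesgue)"
    by (rule nn_integral_restrict_space) simp
  also have "\<dots> = (\<integral>\<^sup>+x. F x * indicator {0..1} x \<partial>lborel)"
    by (rule nn_integral_completion) measurable
  also have "\<dots> = (\<integral>\<^sup>+x. F x * indicator {0..<1} x \<partial>lborel)"
    by (rule nn_integral_cong_AE, use AE_lborel_singleton[of 1] in eventually_elim)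
      (auto simp: indicator_def)
  finally show ?thesis .
qed

lemma borel_measurable_unit: "f \<in> borel_measurable borel \<Longrightarrow> f \<in> borel_measurable (lebesgue_on {0..1::real})"
  by (intro measurable_restrict_space1 measurable_completion) simp

text \<open>
  The digits after the binary point, counted from \<open>0\<close>. Their joint distribution is found from a
  single fact: flipping one digit preserves the measure.
\<close>

definition digit :: "nat \<Rightarrow> real \<Rightarrow> bool" where
  "digit j x \<longleftrightarrow> odd \<lfloor>2 ^ Suc j * x\<rfloor>"

definition flip :: "nat \<Rightarrow> real \<Rightarrow> real" where
  "flip j x = (if digit j x then x - 1 / 2 ^ Suc j else x + 1 / 2 ^ Suc j)"

lemma measurable_digit [measurable]: "Measurable.pred borel (digit j)"
proof -
  have "(\<lambda>x::real. \<lfloor>2 ^ Suc j * x\<rfloor>) \<in> borel \<rightarrow>\<^sub>M count_space UNIV" by measurable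
  then show ?thesis
    unfolding digit_def[abs_def] by (rule measurable_compose) simp
qed

lemma measurable_flip [measurable]: "flip j \<in> borel_measurable borel"
  unfolding flip_def[abs_def] by measurable

lemma floor_flip:
  "\<lfloor>2 ^ Suc j * flip j x\<rfloor> = (if digit j x then \<lfloor>2 ^ Suc j * x\<rfloor> - 1 else \<lfloor>2 ^ Suc j * x\<rfloor> + 1)"
  by (simp add: flip_def right_diff_distrib distrib_left del: power_Suc)

text \<open>
  Flipping digit \<open>j\<close> exchanges an even value of \<open>\<lfloor>2\<^bsup>j+1\<^esup> x\<rfloor>\<close> with its odd successor, which
  have the same quotient by \<open>2\<close>; the earlier digits and the integer part only depend on this quotient.
\<close>

lemma floor_flip_coarse:
  assumes "i \<le> j"
  shows "\<lfloor>2 ^ i * flip j x\<rfloor> = \<lfloor>2 ^ i * x\<rfloor>"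
proof -
  have coarse: "\<lfloor>2 ^ i * y\<rfloor> = \<lfloor>2 ^ Suc j * y\<rfloor> div 2 div 2 ^ (j - i)" for y :: real
  proof -
    have "2 ^ i * y = 2 ^ Suc j * y / real_of_int (2 * 2 ^ (j - i))"
      using assms by (simp add: field_simps flip: power_add)
    then have "\<lfloor>2 ^ i * y\<rfloor> = \<lfloor>2 ^ Suc j * y\<rfloor> div (2 * 2 ^ (j - i))"
      using floor_divide_real_eq_div[of "2 * 2 ^ (j - i)" "2 ^ Suc j * y"] by simp
    then show ?thesis by (simp add: zdiv_zmult2_eq)
  qed
  have "\<lfloor>2 ^ Suc j * flip j x\<rfloor> div 2 = \<lfloor>2 ^ Suc j * x\<rfloor> div 2"
    unfolding floor_flip digit_def by (auto elim!: oddE evenE)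
  then show ?thesis by (simp only: coarse)
qed

lemma digit_flip: "digit i (flip j x) \<longleftrightarrow> (if i = j then \<not> digit i x else digit i x)"
proof -
  have "digit i (flip j x) \<longleftrightarrow> digit i x" if "i < j"
    using that by (simp add: digit_def floor_flip_coarse del: power_Suc)
  moreover have "digit i (flip j x) \<longleftrightarrow> digit i x" if "j < i"
  proof -
    have half: "(2::real) ^ Suc i / 2 ^ Suc j = of_int (2 * 2 ^ (i - j - 1))"
      using that by (simp add: field_simps flip: power_add power_Suc)
    have "2 ^ Suc i * flip j x = 2 ^ Suc i * x - (2 ^ Suc i / 2 ^ Suc j)
        \<or> 2 ^ Suc i * flip j x = 2 ^ Suc i * x + (2 ^ Suc i / 2 ^ Suc j)"
      by (simp add: flip_def right_diff_distrib distrib_left del: power_Suc)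
    then have "\<lfloor>2 ^ Suc i * flip j x\<rfloor> = \<lfloor>2 ^ Suc i * x\<rfloor> - 2 * 2 ^ (i - j - 1)
        \<or> \<lfloor>2 ^ Suc i * flip j x\<rfloor> = \<lfloor>2 ^ Suc i * x\<rfloor> + 2 * 2 ^ (i - j - 1)"
      unfolding half by (metis floor_add_int floor_diff_of_int)
    then show ?thesis by (auto simp: digit_def simp del: power_Suc)
  qed
  moreover have "digit j (flip j x) \<longleftrightarrow> \<not> digit j x"
    unfolding digit_def[of j "flip j x"] floor_flip by (simp add: digit_def)
  ultimately show ?thesis by (cases i j rule: linorder_cases) auto
qed

lemma flip_in_unit: "flip j x \<in> {0..<1} \<longleftrightarrow> x \<in> {0..<1}"
proof -
  have "y \<in> {0..<1} \<longleftrightarrow> \<lfloor>2 ^ 0 * y\<rfloor> = 0" for y :: real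
    by (auto simp: floor_eq_iff)
  then show ?thesis by (simp only: floor_flip_coarse[of 0])
qed

text \<open>
  The flip is a translation where the digit is \<open>0\<close> and the opposite translation where it is \<open>1\<close>, and
  these translations exchange the two sets.
\<close>

lemma nn_integral_flip:
  assumes [measurable]: "F \<in> borel_measurable borel"
  shows "(\<integral>\<^sup>+x. F (flip j x) \<partial>lebesgue_on {0..1}) = (\<integral>\<^sup>+x. F x \<partial>lebesgue_on {0..1})"
proof -
  define G where "G x = F x * indicator {0..<1} x" for x
  have [measurable]: "G \<in> borel_measurable borel" unfolding G_def by measurable
  define h :: real where "h = 1 / 2 ^ Suc j"
  have dig: "digit j (x + h) \<longleftrightarrow> \<not> digit j x" "digit j (x - h) \<longleftrightarrow> \<not> digit j x" for x
    by (auto simp: digit_def h_def right_diff_distrib distrib_left simp del: power_Suc)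
  have shift: "(\<integral>\<^sup>+x. H (x + c) \<partial>lborel) = (\<integral>\<^sup>+x. H x \<partial>lborel)"
    if "H \<in> borel_measurable borel" for H :: "real \<Rightarrow> ennreal" and c
    using nn_integral_real_affine[OF that, of 1 c] by (simp add: add.commute)
  have "(\<integral>\<^sup>+x. G (flip j x) \<partial>lborel)
      = (\<integral>\<^sup>+x. G (x + h) * indicator {y. digit j y} (x + h)
          + G (x + (- h)) * indicator {y. \<not> digit j y} (x + (- h)) \<partial>lborel)"
    by (intro nn_integral_cong) (auto simp: flip_def dig simp flip: h_def simp del: power_Suc)
  also have "\<dots> = (\<integral>\<^sup>+x. G (x + h) * indicator {y. digit j y} (x + h) \<partial>lborel)
      + (\<integral>\<^sup>+x. G (x + (- h)) * indicator {y. \<not> digit j y} (x + (- h)) \<partial>lborel)"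
    by (intro nn_integral_add) measurable
  also have "\<dots> = (\<integral>\<^sup>+x. G x * indicator {y. digit j y} x \<partial>lborel)
      + (\<integral>\<^sup>+x. G x * indicator {y. \<not> digit j y} x \<partial>lborel)"
    by (intro arg_cong2[where f = "(+)"] shift) measurable
  also have "\<dots> = (\<integral>\<^sup>+x. G x * indicator {y. digit j y} x + G x * indicator {y. \<not> digit j y} x \<partial>lborel)"
    by (intro nn_integral_add[symmetric]) measurable
  also have "\<dots> = (\<integral>\<^sup>+x. G x \<partial>lborel)"
    by (intro nn_integral_cong) (auto simp: indicator_def)
  finally have "(\<integral>\<^sup>+x. G (flip j x) \<partial>lborel) = (\<integral>\<^sup>+x. G x \<partial>lborel)" .
  moreover have "G (flip j x) = F (flip j x) * indicator {0..<1} x" for x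
    using flip_in_unit[of j x] by (auto simp: G_def indicator_def)
  ultimately show ?thesis
    by (subst (1 2) nn_integral_unit) (auto simp: G_def)
qed

lemma ennreal_halve:
  assumes "2 * y = ennreal c" "0 \<le> c"
  shows "y = ennreal (c / 2)"
proof (cases y)
  case (real t)
  have "ennreal (2 * t) = ennreal c"
    using assms(1) real by (simp add: ennreal_mult')
  then show ?thesis using real assms(2) by simp
next
  case top
  then show ?thesis using assms(1) by (simp add: ennreal_mult_top)
qed

text \<open>
  Flipping a further digit exchanges its two values, so prescribing it halves the measure.
\<close>

lemma prob_digits:
  assumes "finite J"
  shows "(\<integral>\<^sup>+x. indicator {x. \<forall>j\<in>J. digit j x = e j} x \<partial>lebesgue_on {0..1}) = ennreal (1 / 2 ^ card J)"
  using assms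
proof induction
  case empty
  show ?case by (simp add: emeasure_restrict_space)
next
  case (insert j J)
  let ?I = "\<lambda>A. \<integral>\<^sup>+x. indicator A x \<partial>lebesgue_on {0..1::real}"
  let ?A = "{x. \<forall>i\<in>insert j J. digit i x = e i}"
  let ?B = "{x. digit j x = (\<not> e j) \<and> (\<forall>i\<in>J. digit i x = e i)}"
  have [measurable]: "?A \<in> sets borel" "?B \<in> sets borel"
    using insert(1) by measurable
  have fl: "indicator ?A (flip j x) = (indicator ?B x :: ennreal)" for x
    using insert(2) by (auto simp: indicator_def digit_flip)
  have "ennreal (1 / 2 ^ card J) = ?I {x. \<forall>i\<in>J. digit i x = e i}" by (rule insert(3)[symmetric])
  also have "\<dots> = (\<integral>\<^sup>+x. indicator ?A x + indicator ?B x \<partial>lebesgue_on {0..1})"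
    by (intro nn_integral_cong) (auto simp: indicator_def)
  also have "\<dots> = ?I ?A + ?I ?B"
    by (intro nn_integral_add borel_measurable_unit) measurable
  also have "?I ?B = (\<integral>\<^sup>+x. indicator ?A (flip j x) \<partial>lebesgue_on {0..1})"
    by (simp only: fl)
  also have "\<dots> = ?I ?A"
    by (intro nn_integral_flip) measurable
  finally have "2 * ?I ?A = ennreal (1 / 2 ^ card J)"
    by (simp add: mult_2)
  then have "?I ?A = ennreal (1 / 2 ^ card J / 2)"
    by (rule ennreal_halve) simp
  then show ?case
    using insert(1,2) by (simp add: mult.commute)
qed

text \<open>
  The digits are arranged into sequences, one for each \<open>k\<close>. Position \<open>0\<close> of a sequence is reserved for
  a sign; \<open>block k m\<close> says that the first \<open>1\<close> among the other positions comes after \<open>m\<close> zeros.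
\<close>

definition block :: "nat \<Rightarrow> nat \<Rightarrow> real \<Rightarrow> bool" where
  "block k m x \<longleftrightarrow> (\<forall>i\<le>m. digit (prod_encode (k, Suc i)) x \<longleftrightarrow> i = m)"

lemma measurable_block [measurable]: "Measurable.pred borel (block k m)"
  unfolding block_def[abs_def] by measurable

lemma block_unique: "\<lbrakk>block k m x; block k n x\<rbrakk> \<Longrightarrow> m = n"
  unfolding block_def by (metis le_cases order_refl)

lemma block_flip: "block k m (flip (prod_encode (l, 0)) x) \<longleftrightarrow> block k m x"
  by (simp add: block_def digit_flip)

lemma prob_blocks:
  assumes "finite K"
  shows "(\<integral>\<^sup>+x. indicator {x. \<forall>k\<in>K. block k (m k) x} x \<partial>lebesgue_on {0..1})
    = ennreal (\<Prod>k\<in>K. 1 / 2 ^ Suc (m k))"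
proof -
  let ?S = "SIGMA k:K. {1..Suc (m k)}"
  let ?e = "\<lambda>n. snd (prod_decode n) = Suc (m (fst (prod_decode n)))"
  have "{x. \<forall>k\<in>K. block k (m k) x} = {x. \<forall>j\<in>prod_encode ` ?S. digit j x = ?e j}"
  proof -
    have "block k (m k) x \<longleftrightarrow> (\<forall>i\<in>{1..Suc (m k)}. digit (prod_encode (k, i)) x \<longleftrightarrow> i = Suc (m k))" for k x
    proof -
      have "{1..Suc (m k)} = Suc ` {..m k}" by (simp add: image_Suc_atMost)
      then show ?thesis by (auto simp: block_def)
    qed
    then show ?thesis by auto
  qed
  moreover have "card (prod_encode ` ?S) = (\<Sum>k\<in>K. Suc (m k))"
    using assms by (simp add: card_image inj_prod_encode)
  moreover have "finite (prod_encode ` ?S)" using assms by auto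
  ultimately show ?thesis
    using prob_digits[of "prod_encode ` ?S" ?e]
    by (simp add: power_sum prod_dividef)
qed

section \<open>Embedding \<open>\<ell>\<^sub>p\<close> for \<open>p = s\<close> and between \<open>r\<close> and \<open>2\<close>\<close>

text \<open>For \<open>p = s\<close> the coordinates of \<open>\<ell>\<^sub>s\<close> become constant functions.\<close>

lemma ell_embeds_outer:
  fixes M :: "'a measure"
  assumes r: "0 < r" and s: "0 < s" and M: "finite_measure M" "measure M (space M) = 1"
  shows "qembeds (ell (ereal s))
    (ell_sum s (Lspace M r :: ('k::{real_normed_field, banach, second_countable_topology}, _) qspace))"
proof -
  let ?E = "ell (ereal s) :: ('k, _) qspace"
  let ?L = "Lspace M r :: ('k, _) qspace"
  let ?Y = "ell_sum s ?L"
  interpret M: finite_measure M by fact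
  interpret EY: quasi_normed_pair ?E "\<lambda>_. 0" "2 * 2 powr (1 / s)" ?Y "\<lambda>_. ae_rel M r `` {\<lambda>_. 0}"
    "2 * (2 * 2 powr (1 / r)) * 2 powr (1 / s)"
    by (intro quasi_normed_pair.intro quasi_normed_ell quasi_normed_ell_sum quasi_normed_Lspace r s)
  define T where "T a = (\<lambda>n::nat. ae_rel M r `` {\<lambda>_. a n :: 'k})" for a
  have const: "(\<lambda>_. d :: 'k) \<in> Lfun M r" for d
    by (simp add: Lfun_def)
  have norm: "qnorm ?L (T a n) = norm (a n)" for a n
    using r M(2) by (simp add: T_def qnorm_Lspace[OF const] powr_powr)
  have "qlinear ?E ?Y T"
    unfolding qlinear_def
    by (auto simp: ell_carrier[OF s] ell_sum_def norm)
      (auto simp: T_def class_in_Lspace[OF const] vadd_Lspace[OF r const const] vscale_Lspace[OF const])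
  then show ?thesis
    using s by (intro EY.qembeds_if_bounds[of T 1 1] qcomplete_ell)
      (auto simp: ell_carrier[OF s] ell_sum_def norm)
qed

abbreviation moment ::
  "real \<Rightarrow> (nat \<Rightarrow> real \<Rightarrow> 'k::real_normed_field) \<Rightarrow> (nat \<Rightarrow> 'k) \<Rightarrow> nat set \<Rightarrow> ennreal" where
  "moment r x a F \<equiv> \<integral>\<^sup>+w. ennreal (norm (\<Sum>k\<in>F. a k * x k w) powr r) \<partial>lebesgue_on {0..1}"

abbreviation square_moment ::
  "real \<Rightarrow> (nat \<Rightarrow> real \<Rightarrow> 'k::real_normed_field) \<Rightarrow> (nat \<Rightarrow> 'k) \<Rightarrow> nat set \<Rightarrow> ennreal" where
  "square_moment r x a F \<equiv>
    \<integral>\<^sup>+w. ennreal ((\<Sum>k\<in>F. (norm (a k * x k w))\<^sup>2) powr (r / 2)) \<partial>lebesgue_on {0..1}"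

text \<open>
  By homogeneity it suffices to consider coefficients of norm one.
\<close>

lemma ell_embeds_if_normalised_bounds:
  fixes x :: "nat \<Rightarrow> real \<Rightarrow> 'k::{real_normed_field, euclidean_space}"
  assumes r: "0 < r" and s: "0 < s" and p: "0 < p" and x: "\<And>n. x n \<in> borel_measurable borel"
    and c: "0 < c" and C: "0 < C"
    and bounds: "\<And>a F. \<lbrakk>finite F; (\<Sum>n\<in>F. norm (a n) powr p) = 1\<rbrakk> \<Longrightarrow>
      ennreal c \<le> moment r x a F \<and> moment r x a F \<le> ennreal C"
  shows "qembeds (ell (ereal p)) (ell_sum s (L_unit r :: ('k, _) qspace))"
proof -
  let ?U = "lebesgue_on {0..1::real}"
  have [measurable]: "x n \<in> borel_measurable ?U" for n
    using x by (rule borel_measurable_unit)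
  have xL: "x n \<in> Lfun ?U r" for n
  proof -
    have "(\<integral>\<^sup>+w. ennreal (norm (x n w) powr r) \<partial>?U) \<le> ennreal C"
      using bounds[of "{n}" "\<lambda>_. 1"] by simp
    also have "\<dots> < \<infinity>" by simp
    finally have "integrable ?U (\<lambda>w. norm (x n w) powr r)"
      by (intro integrableI_nonneg) auto
    then show ?thesis by (simp add: Lfun_def)
  qed
  have both: "c * (\<Sum>n\<in>F. norm (a n) powr p) powr (r / p) \<le> (\<integral>w. norm (\<Sum>n\<in>F. a n * x n w) powr r \<partial>?U)
      \<and> (\<integral>w. norm (\<Sum>n\<in>F. a n * x n w) powr r \<partial>?U) \<le> C * (\<Sum>n\<in>F. norm (a n) powr p) powr (r / p)"
    if F: "finite F" for F and a :: "nat \<Rightarrow> 'k"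
  proof (cases "(\<Sum>n\<in>F. norm (a n) powr p) = 0")
    case True
    then have "\<forall>n\<in>F. a n = 0"
      using F by (subst (asm) sum_nonneg_eq_0_iff) auto
    then have "(\<Sum>n\<in>F. a n * x n w) = 0" for w by (intro sum.neutral) auto
    then show ?thesis using True p r by simp
  next
    case False
    define S where "S = (\<Sum>n\<in>F. norm (a n) powr p)"
    have S: "0 < S" using False by (simp add: S_def sum_nonneg less_le)
    define t where "t = S powr (1 / p)"
    have t: "0 < t" using S by (simp add: t_def)
    define b where "b n = a n / of_real t" for n
    have tp: "t powr p = S" using S p by (simp add: t_def powr_powr)
    have "(\<Sum>n\<in>F. norm (b n) powr p) = S / t powr p"
      using t by (simp add: b_def norm_divide powr_divide S_def sum_divide_distrib)
    then have b1: "(\<Sum>n\<in>F. norm (b n) powr p) = 1" using S tp by simp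
    have eq: "norm (\<Sum>n\<in>F. a n * x n w) powr r = t powr r * norm (\<Sum>n\<in>F. b n * x n w) powr r" for w
    proof -
      have "(\<Sum>n\<in>F. a n * x n w) = of_real t * (\<Sum>n\<in>F. b n * x n w)"
        using t by (simp add: b_def sum_distrib_left)
      then show ?thesis using t by (simp add: norm_mult powr_mult)
    qed
    let ?I = "\<integral>w. norm (\<Sum>n\<in>F. b n * x n w) powr r \<partial>?U"
    have "integrable ?U (\<lambda>w. norm (\<Sum>n\<in>F. b n * x n w) powr r)"
      by (intro Lfun_integrable Lfun_sum r xL)
    then have "moment r x b F = ennreal ?I"
      by (intro nn_integral_eq_integral) auto
    then have "c \<le> ?I" "?I \<le> C"
      using bounds[OF F b1] c C by auto
    moreover have "t powr r = S powr (r / p)" by (simp add: t_def powr_powr)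
    ultimately show ?thesis
      using mult_right_mono[of c ?I "S powr (r / p)"] mult_right_mono[of ?I C "S powr (r / p)"]
      unfolding eq S_def[symmetric] by (simp add: mult.commute)
  qed
  show ?thesis
    by (rule ell_embeds_if_finite_bounds[where x = x and c = c and C = C]) (use r s p c C xL both in auto)
qed

text \<open>Disjointly supported functions of norm one span \<open>\<ell>\<^sub>r\<close> isometrically.\<close>

lemma ell_embeds_inner:
  assumes r: "0 < r" and s: "0 < s"
  shows "qembeds (ell (ereal r)) (ell_sum s (L_unit r :: ('k::{real_normed_field, euclidean_space}, _) qspace))"
proof (rule ell_embeds_if_normalised_bounds[OF r s r])
  define x :: "nat \<Rightarrow> real \<Rightarrow> 'k" where
    "x m w = (if block 0 m w then of_real ((2 ^ Suc m) powr (1 / r)) else 0)" for m w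
  show "x n \<in> borel_measurable borel" for n
    unfolding x_def[abs_def] by measurable
  fix a :: "nat \<Rightarrow> 'k" and F :: "nat set"
  assume F: "finite F" and a: "(\<Sum>n\<in>F. norm (a n) powr r) = 1"
  have pointwise: "ennreal (norm (\<Sum>n\<in>F. a n * x n w) powr r)
      = (\<Sum>n\<in>F. ennreal (norm (a n) powr r * 2 ^ Suc n) * indicator {w. block 0 n w} w)" for w
  proof (cases "\<exists>m\<in>F. block 0 m w")
    case True
    then obtain m where m: "m \<in> F" "block 0 m w" by blast
    then have only: "block 0 n w \<longleftrightarrow> n = m" for n using block_unique by blast
    have "(\<Sum>n\<in>F. a n * x n w) = (\<Sum>n\<in>F. if n = m then a m * of_real ((2 ^ Suc m) powr (1 / r)) else 0)"
      by (intro sum.cong) (auto simp: x_def only)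
    then have "norm (\<Sum>n\<in>F. a n * x n w) powr r = norm (a m) powr r * 2 ^ Suc m"
      using F m r by (simp add: norm_mult powr_mult powr_powr)
    then have "ennreal (norm (\<Sum>n\<in>F. a n * x n w) powr r)
        = (\<Sum>n\<in>F. if n = m then ennreal (norm (a m) powr r * 2 ^ Suc m) else 0)"
      using F m by simp
    also have "\<dots> = (\<Sum>n\<in>F. ennreal (norm (a n) powr r * 2 ^ Suc n) * indicator {w. block 0 n w} w)"
      by (intro sum.cong) (auto simp: only)
    finally show ?thesis .
  next
    case False
    then have "(\<Sum>n\<in>F. a n * x n w) = 0" by (intro sum.neutral) (auto simp: x_def)
    moreover have "(\<Sum>n\<in>F. ennreal (norm (a n) powr r * 2 ^ Suc n) * indicator {w. block 0 n w} w) = 0"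
      using False by (intro sum.neutral) auto
    ultimately show ?thesis using r by simp
  qed
  have "moment r x a F
      = (\<Sum>n\<in>F. \<integral>\<^sup>+w. ennreal (norm (a n) powr r * 2 ^ Suc n) * indicator {w. block 0 n w} w \<partial>lebesgue_on {0..1})"
    unfolding pointwise by (intro nn_integral_sum borel_measurable_unit) measurable
  also have "\<dots> = (\<Sum>n\<in>F. ennreal (norm (a n) powr r))"
  proof (intro sum.cong refl)
    fix n
    have "(\<integral>\<^sup>+w. indicator {w. block 0 n w} w \<partial>lebesgue_on {0..1}) = ennreal (1 / 2 ^ Suc n)"
      using prob_blocks[of "{0}" "\<lambda>_. n"] by simp
    then have "(\<integral>\<^sup>+w. ennreal (norm (a n) powr r * 2 ^ Suc n) * indicator {w. block 0 n w} w \<partial>lebesgue_on {0..1})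
        = ennreal (norm (a n) powr r * 2 ^ Suc n) * ennreal (1 / 2 ^ Suc n)"
      by (subst nn_integral_cmult) (auto intro!: borel_measurable_unit)
    also have "\<dots> = ennreal (norm (a n) powr r)" by (simp flip: ennreal_mult)
    finally show "(\<integral>\<^sup>+w. ennreal (norm (a n) powr r * 2 ^ Suc n) * indicator {w. block 0 n w} w \<partial>lebesgue_on {0..1})
        = ennreal (norm (a n) powr r)" .
  qed
  also have "\<dots> = 1" using a by (simp add: sum_ennreal)
  finally show "ennreal 1 \<le> moment r x a F \<and> moment r x a F \<le> ennreal 1"
    by simp
qed auto

text \<open>
  Flipping one sign digit preserves the measure, so the integral does not change when the signs of
  the terms are averaged; Khintchine's inequality then applies pointwise.
\<close>

lemma symmetric_square_function:
  assumes r: "0 < r"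
  obtains c C where "0 < c" "0 < C"
    "\<And>(x :: nat \<Rightarrow> real \<Rightarrow> 'k::{real_normed_field, euclidean_space}) a F.
      \<lbrakk>\<And>k. x k \<in> borel_measurable borel;
        \<And>k l w. x k (flip (prod_encode (l, 0)) w) = (if k = l then - x k w else x k w); finite F\<rbrakk> \<Longrightarrow>
      ennreal c * square_moment r x a F \<le> moment r x a F \<and> moment r x a F \<le> ennreal C * square_moment r x a F"
proof -
  obtain c where c: "0 < c" "\<And>F (v :: nat \<Rightarrow> 'k). finite F \<Longrightarrow>
      c * (\<Sum>k\<in>F. (norm (v k))\<^sup>2) powr (r / 2) \<le> sign_moment r v F"
    using khintchine_lower[OF r] by blast
  obtain C where C: "0 < C" "\<And>F (v :: nat \<Rightarrow> 'k). finite F \<Longrightarrow>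
      sign_moment r v F \<le> C * (\<Sum>k\<in>F. (norm (v k))\<^sup>2) powr (r / 2)"
    using khintchine_upper[OF r] by blast
  show ?thesis
  proof (rule that[OF c(1) C(1)])
    fix x :: "nat \<Rightarrow> real \<Rightarrow> 'k" and a :: "nat \<Rightarrow> 'k" and F :: "nat set"
    assume x: "\<And>k. x k \<in> borel_measurable borel"
      and symm: "\<And>k l w. x k (flip (prod_encode (l, 0)) w) = (if k = l then - x k w else x k w)"
      and F: "finite F"
    let ?U = "lebesgue_on {0..1::real}"
    note [measurable] = x
    define G where "G A w = ennreal (norm (signed_sum (\<lambda>k. a k * x k w) F A) powr r)" for A w
    have [measurable]: "G A \<in> borel_measurable borel" for A
      unfolding G_def signed_sum_def by measurable
    have G_insert: "G (insert l A) w = G A (flip (prod_encode (l, 0)) w)" if "l \<notin> A" for l A w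
      unfolding G_def signed_sum_def using that
      by (intro arg_cong[where f = "\<lambda>u. ennreal (norm u powr r)"] sum.cong) (auto simp: symm)
    have G_int: "(\<integral>\<^sup>+w. G A w \<partial>?U) = (\<integral>\<^sup>+w. G {} w \<partial>?U)" if "finite A" for A
      using that
    proof induction
      case (insert l A)
      have "(\<integral>\<^sup>+w. G (insert l A) w \<partial>?U) = (\<integral>\<^sup>+w. G A (flip (prod_encode (l, 0)) w) \<partial>?U)"
        using insert by (simp add: G_insert)
      also have "\<dots> = (\<integral>\<^sup>+w. G A w \<partial>?U)" by (rule nn_integral_flip) measurable
      finally show ?case using insert by simp
    qed simp
    have "moment r x a F = (\<integral>\<^sup>+w. G {} w \<partial>?U)"
      by (simp add: G_def signed_sum_def)
    also have "\<dots> = (\<integral>\<^sup>+w. ennreal (sign_moment r (\<lambda>k. a k * x k w) F) \<partial>?U)"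
    proof -
      have "ennreal (sign_moment r (\<lambda>k. a k * x k w) F)
          = ennreal (1 / 2 ^ card F) * (\<Sum>A\<in>Pow F. G A w)" for w
        unfolding sign_avg_def G_def
        by (subst sum_ennreal) (auto simp: sum_nonneg simp flip: ennreal_mult)
      then have "(\<integral>\<^sup>+w. ennreal (sign_moment r (\<lambda>k. a k * x k w) F) \<partial>?U)
          = ennreal (1 / 2 ^ card F) * (\<Sum>A\<in>Pow F. \<integral>\<^sup>+w. G A w \<partial>?U)"
        by (simp add: nn_integral_cmult nn_integral_sum borel_measurable_unit)
      also have "(\<Sum>A\<in>Pow F. \<integral>\<^sup>+w. G A w \<partial>?U) = (\<Sum>A\<in>Pow F. \<integral>\<^sup>+w. G {} w \<partial>?U)"
        using F by (intro sum.cong G_int) (auto intro: finite_subset)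
      also have "\<dots> = ennreal (2 ^ card F) * (\<integral>\<^sup>+w. G {} w \<partial>?U)"
        using F by (simp add: card_Pow flip: ennreal_power)
      finally show ?thesis by (simp flip: mult.assoc ennreal_mult)
    qed
    finally have avg: "moment r x a F
      = (\<integral>\<^sup>+w. ennreal (sign_moment r (\<lambda>k. a k * x k w) F) \<partial>?U)" .
    let ?Q = "\<lambda>w. (\<Sum>k\<in>F. (norm (a k * x k w))\<^sup>2) powr (r / 2)"
    have Q: "(\<integral>\<^sup>+w. ennreal d * ennreal (?Q w) \<partial>?U) = ennreal d * (\<integral>\<^sup>+w. ennreal (?Q w) \<partial>?U)" for d
      by (intro nn_integral_cmult borel_measurable_unit) measurable
    have "ennreal c * (\<integral>\<^sup>+w. ennreal (?Q w) \<partial>?U) \<le> moment r x a F"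
      unfolding avg Q[symmetric]
      using c F by (intro nn_integral_mono) (auto simp flip: ennreal_mult intro!: ennreal_leI)
    moreover have "moment r x a F
        \<le> ennreal C * (\<integral>\<^sup>+w. ennreal (?Q w) \<partial>?U)"
      unfolding avg Q[symmetric]
      using C F by (intro nn_integral_mono) (auto simp flip: ennreal_mult intro!: ennreal_leI)
    ultimately show "ennreal c * (\<integral>\<^sup>+w. ennreal (?Q w) \<partial>?U) \<le> moment r x a F \<and> moment r x a F
          \<le> ennreal C * (\<integral>\<^sup>+w. ennreal (?Q w) \<partial>?U)" ..
  qed
qed

lemma ell_2_embeds:
  assumes r: "0 < r" and s: "0 < s"
  shows "qembeds (ell (ereal 2)) (ell_sum s (L_unit r :: ('k::{real_normed_field, euclidean_space}, _) qspace))"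
proof -
  obtain c C where c: "0 < c" "0 < C" and sq: "\<And>(x :: nat \<Rightarrow> real \<Rightarrow> 'k) a F.
      \<lbrakk>\<And>k. x k \<in> borel_measurable borel;
        \<And>k l w. x k (flip (prod_encode (l, 0)) w) = (if k = l then - x k w else x k w); finite F\<rbrakk> \<Longrightarrow>
      ennreal c * square_moment r x a F \<le> moment r x a F \<and> moment r x a F \<le> ennreal C * square_moment r x a F"
    using symmetric_square_function[OF r] by blast
  define x :: "nat \<Rightarrow> real \<Rightarrow> 'k" where "x k w = (if digit (prod_encode (k, 0)) w then - 1 else 1)" for k w
  have x: "x k \<in> borel_measurable borel" for k unfolding x_def[abs_def] by measurable
  have symm: "x k (flip (prod_encode (l, 0)) w) = (if k = l then - x k w else x k w)" for k l w
    by (auto simp: x_def digit_flip)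
  have norm: "norm (x k w) = 1" for k w by (simp add: x_def)
  show ?thesis
  proof (rule ell_embeds_if_normalised_bounds[OF r s _ x c])
    fix a :: "nat \<Rightarrow> 'k" and F :: "nat set"
    assume F: "finite F" and a: "(\<Sum>n\<in>F. norm (a n) powr 2) = 1"
    have "(\<Sum>n\<in>F. (norm (a n))\<^sup>2) = 1" using a by (simp add: powr_numeral)
    then show "ennreal c \<le> moment r x a F \<and> moment r x a F \<le> ennreal C"
      using sq[OF x symm F, of a] by (simp add: norm_mult norm emeasure_restrict_space)
  qed simp
qed

text \<open>
  If the sum \<open>S\<close> of the squares exceeds \<open>1\<close>, write \<open>S\<^bsup>r/2\<^esup>\<close> as the sum of the \<open>t\<^sup>2 S\<^bsup>r/2-1\<^esup>\<close>. The exponent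
  \<open>r/2-1\<close> is not positive, so \<open>S \<ge> 1\<close> and \<open>S \<ge> t\<^sup>2\<close> bound such a term by \<open>t\<^sup>2\<close> and by \<open>t\<^sup>r\<close>.
\<close>

lemma powr_sum_squares_le:
  fixes t :: "'i \<Rightarrow> real"
  assumes F: "finite F" and t: "\<And>k. k \<in> F \<Longrightarrow> 0 \<le> t k" and r: "0 < r" "r \<le> 2"
  shows "(\<Sum>k\<in>F. (t k)\<^sup>2) powr (r / 2) \<le> 1 + (\<Sum>k\<in>F. if t k \<le> 1 then (t k)\<^sup>2 else t k powr r)"
proof -
  define S where "S = (\<Sum>k\<in>F. (t k)\<^sup>2)"
  have nn: "0 \<le> (\<Sum>k\<in>F. if t k \<le> 1 then (t k)\<^sup>2 else t k powr r)"
    by (intro sum_nonneg) auto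
  show ?thesis
  proof (cases "S \<le> 1")
    case True
    then have "S powr (r / 2) \<le> 1 powr (r / 2)"
      using r by (intro powr_mono2) (auto simp: S_def sum_nonneg)
    then show ?thesis using nn by (simp add: S_def)
  next
    case False
    have "S powr (r / 2) = S * S powr (r / 2 - 1)"
      using False by (simp add: powr_diff)
    also have "\<dots> = (\<Sum>k\<in>F. (t k)\<^sup>2 * S powr (r / 2 - 1))"
      by (simp add: S_def sum_distrib_right)
    also have "\<dots> \<le> (\<Sum>k\<in>F. if t k \<le> 1 then (t k)\<^sup>2 else t k powr r)"
    proof (rule sum_mono)
      fix k assume k: "k \<in> F"
      show "(t k)\<^sup>2 * S powr (r / 2 - 1) \<le> (if t k \<le> 1 then (t k)\<^sup>2 else t k powr r)"
      proof (cases "t k \<le> 1")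
        case True
        have "S powr (r / 2 - 1) \<le> 1"
          using powr_mono2'[of "r / 2 - 1" 1 S] r False by simp
        then show ?thesis using True mult_left_le[of "S powr (r / 2 - 1)" "(t k)\<^sup>2"] by simp
      next
        case gt: False
        have "(t k)\<^sup>2 \<le> S" unfolding S_def using k F by (intro member_le_sum) auto
        then have "S powr (r / 2 - 1) \<le> ((t k)\<^sup>2) powr (r / 2 - 1)"
          using r gt by (intro powr_mono2') auto
        then have "(t k)\<^sup>2 * S powr (r / 2 - 1) \<le> (t k)\<^sup>2 * ((t k)\<^sup>2) powr (r / 2 - 1)"
          by (intro mult_left_mono) auto
        also have "\<dots> = t k powr r"
        proof -
          have "(t k)\<^sup>2 = t k powr 2" using gt by (simp add: powr_numeral)
          then show ?thesis using gt by (simp only: powr_powr flip: powr_add) simp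
        qed
        finally show ?thesis using gt by simp
      qed
    qed
    finally show ?thesis by (simp add: S_def)
  qed
qed

text \<open>
  The terms are largest near the index where \<open>b q\<^sup>m\<close> passes \<open>1\<close> and decay geometrically to both
  sides of it, wherever it lies; a bounded potential that grows by at least the term at each step
  turns this into a telescoping sum.
\<close>

lemma sum_two_sided_geometric_bounded:
  fixes \<alpha> \<beta> q :: real
  assumes "0 < \<alpha>" "0 < \<beta>" "1 < q"
  obtains C where "0 < C"
    "\<And>b n. 0 < b \<Longrightarrow>
      (\<Sum>m<n. if b * q ^ m \<le> 1 then (b * q ^ m) powr \<alpha> else (b * q ^ m) powr (- \<beta>)) \<le> C"
proof -
  define A where "A = q powr \<alpha> - 1"
  define B where "B = 1 - q powr (- \<beta>)"
  have A: "0 < A" using assms by (simp add: A_def)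
  have B: "0 < B" using assms by (simp add: B_def powr_less_one)
  define \<psi> where "\<psi> t = min (t powr \<alpha>) (q powr \<alpha>) / A - min 1 (t powr (- \<beta>)) / B" for t
  have step: "(if t \<le> 1 then t powr \<alpha> else t powr (- \<beta>)) \<le> \<psi> (t * q) - \<psi> t" if t: "0 < t" for t
  proof (cases "t \<le> 1")
    case True
    have "t powr \<alpha> \<le> 1" using True t assms by (simp add: powr_le1)
    moreover have "1 \<le> q powr \<alpha>" using assms by (intro ge_one_powr_ge_zero) auto
    ultimately have m1: "min (t powr \<alpha>) (q powr \<alpha>) = t powr \<alpha>"
      "min ((t * q) powr \<alpha>) (q powr \<alpha>) = t powr \<alpha> * q powr \<alpha>"
      using t assms by (auto simp: powr_mult min_def mult_le_cancel_right1)
    have "1 \<le> t powr (- \<beta>)"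
      using powr_mono2'[of "- \<beta>" t 1] True t assms by simp
    then have "min 1 ((t * q) powr (- \<beta>)) / B \<le> min 1 (t powr (- \<beta>)) / B"
      using B by (intro divide_right_mono) auto
    moreover have "t powr \<alpha> * q powr \<alpha> / A - t powr \<alpha> / A = t powr \<alpha> * A / A"
      by (simp only: A_def right_diff_distrib diff_divide_distrib mult_1_right)
    moreover have "t powr \<alpha> * A / A = t powr \<alpha>" using A by simp
    ultimately show ?thesis using True unfolding \<psi>_def m1 by simp
  next
    case False
    have "t powr (- \<beta>) \<le> 1" using powr_mono2'[of "- \<beta>" 1 t] False assms by simp
    moreover have "q powr (- \<beta>) \<le> 1" using B by (simp add: B_def)
    moreover have "t powr (- \<beta>) * q powr (- \<beta>) \<le> 1 * 1"
      using calculation by (intro mult_mono) auto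
    ultimately have m1: "min 1 (t powr (- \<beta>)) = t powr (- \<beta>)"
      "min 1 ((t * q) powr (- \<beta>)) = t powr (- \<beta>) * q powr (- \<beta>)"
      using t assms by (auto simp: powr_mult)
    have "t powr \<alpha> \<le> (t * q) powr \<alpha>" using t assms by (intro powr_mono2) auto
    then have "min (t powr \<alpha>) (q powr \<alpha>) / A \<le> min ((t * q) powr \<alpha>) (q powr \<alpha>) / A"
      using A by (intro divide_right_mono) auto
    moreover have "t powr (- \<beta>) / B - t powr (- \<beta>) * q powr (- \<beta>) / B = t powr (- \<beta>) * B / B"
      by (simp only: B_def right_diff_distrib diff_divide_distrib mult_1_right)
    moreover have "t powr (- \<beta>) * B / B = t powr (- \<beta>)" using B by simp
    ultimately show ?thesis using False unfolding \<psi>_def m1 by simp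
  qed
  show ?thesis
  proof (rule that[of "q powr \<alpha> / A + 1 / B"])
    show "0 < q powr \<alpha> / A + 1 / B" using A B by (intro add_nonneg_pos) auto
    fix b :: real and n assume b: "0 < b"
    have "(\<Sum>m<n. if b * q ^ m \<le> 1 then (b * q ^ m) powr \<alpha> else (b * q ^ m) powr (- \<beta>))
        \<le> (\<Sum>m<n. \<psi> (b * q ^ Suc m) - \<psi> (b * q ^ m))"
    proof (rule sum_mono)
      fix m
      have "0 < b * q ^ m" using b assms by simp
      moreover have "b * q ^ Suc m = b * q ^ m * q" by simp
      ultimately show "(if b * q ^ m \<le> 1 then (b * q ^ m) powr \<alpha> else (b * q ^ m) powr (- \<beta>))
          \<le> \<psi> (b * q ^ Suc m) - \<psi> (b * q ^ m)"
        using step by (simp only:)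
    qed
    also have "\<dots> = \<psi> (b * q ^ n) - \<psi> (b * q ^ 0)"
      by (rule sum_lessThan_telescope)
    also have "\<dots> \<le> q powr \<alpha> / A + 1 / B"
    proof -
      have up: "\<psi> t \<le> q powr \<alpha> / A" for t
      proof -
        have "min (t powr \<alpha>) (q powr \<alpha>) / A \<le> q powr \<alpha> / A"
          using A by (intro divide_right_mono) auto
        moreover have "0 \<le> min 1 (t powr (- \<beta>)) / B" using B by simp
        ultimately show ?thesis by (simp add: \<psi>_def)
      qed
      have low: "- (1 / B) \<le> \<psi> t" for t
      proof -
        have "min 1 (t powr (- \<beta>)) / B \<le> 1 / B" using B by (intro divide_right_mono) auto
        moreover have "0 \<le> min (t powr \<alpha>) (q powr \<alpha>) / A" using A by simp
        ultimately show ?thesis by (simp add: \<psi>_def)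
      qed
      show ?thesis using up[of "b * q ^ n"] low[of "b * q ^ 0"] by linarith
    qed
    finally show "(\<Sum>m<n. if b * q ^ m \<le> 1 then (b * q ^ m) powr \<alpha> else (b * q ^ m) powr (- \<beta>))
        \<le> q powr \<alpha> / A + 1 / B" .
  qed
qed

text \<open>
  Adding the events one by one, each meets the union of the earlier ones in a set of measure at most
  its own measure times the sum of theirs.
\<close>

lemma measure_UN_ge_if_pairwise_independent:
  assumes N: "finite_measure N" and F: "finite F" and B: "\<And>k. k \<in> F \<Longrightarrow> B k \<in> sets N"
    and pair: "\<And>k l. \<lbrakk>k \<in> F; l \<in> F; k \<noteq> l\<rbrakk> \<Longrightarrow> measure N (B k \<inter> B l) \<le> measure N (B k) * measure N (B l)"
  shows "(\<Sum>k\<in>F. measure N (B k)) - (\<Sum>k\<in>F. measure N (B k))\<^sup>2 / 2 \<le> measure N (\<Union>k\<in>F. B k)"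
  using F B pair
proof (induction F)
  case (insert x F)
  interpret finite_measure N by fact
  let ?S = "\<Sum>k\<in>F. measure N (B k)" and ?b = "measure N (B x)"
  have U: "(\<Union>k\<in>F. B k) \<in> sets N" "B x \<in> sets N" using insert by auto
  have "measure N (B x \<inter> (\<Union>k\<in>F. B k)) = measure N (\<Union>k\<in>F. B x \<inter> B k)"
    by (intro arg_cong[where f = "measure N"]) auto
  also have "\<dots> \<le> (\<Sum>k\<in>F. measure N (B x \<inter> B k))"
    using insert by (intro finite_measure_subadditive_finite) auto
  also have "\<dots> \<le> (\<Sum>k\<in>F. ?b * measure N (B k))"
    using insert by (intro sum_mono) auto
  finally have cap: "measure N (B x \<inter> (\<Union>k\<in>F. B k)) \<le> ?b * ?S"
    by (simp add: sum_distrib_left)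
  have "measure N (B x \<union> (\<Union>k\<in>F. B k)) = ?b + measure N (\<Union>k\<in>F. B k) - measure N (B x \<inter> (\<Union>k\<in>F. B k))"
    using U by (intro measure_Un3) (auto simp: fmeasurable_eq_sets)
  moreover have "?S - ?S\<^sup>2 / 2 \<le> measure N (\<Union>k\<in>F. B k)"
    using insert by (intro insert.IH) auto
  moreover have "(?b + ?S)\<^sup>2 = ?b\<^sup>2 + 2 * (?b * ?S) + ?S\<^sup>2"
    by (simp add: power2_sum)
  moreover have "0 \<le> ?b\<^sup>2" by simp
  ultimately have "?b + ?S - (?b + ?S)\<^sup>2 / 2 \<le> measure N (B x \<union> (\<Union>k\<in>F. B k))"
    using cap by linarith
  then show ?case
    using insert(1,2) by simp
qed simp

text \<open>
  For \<open>q = 2\<^bsup>1/p\<^esup>\<close> the measure of the set where \<open>first_one q k\<close> is at least \<open>q\<^sup>m\<close> is \<open>2\<^sup>-\<^sup>m = (q\<^sup>m)\<^sup>-\<^sup>p\<close>, the tail of a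
  \<open>p\<close>-stable variable. The value \<open>0\<close> is taken on a null set.
\<close>

definition first_one :: "real \<Rightarrow> nat \<Rightarrow> real \<Rightarrow> real" where
  "first_one q k w = (if \<exists>m. block k m w then q ^ (LEAST m. block k m w) else 0)"

lemma measurable_first_one [measurable]: "first_one q k \<in> borel_measurable borel"
  unfolding first_one_def[abs_def] by measurable

lemma first_one_block: "block k m w \<Longrightarrow> first_one q k w = q ^ m"
proof -
  assume m: "block k m w"
  then have "block k (LEAST m. block k m w) w" by (rule LeastI)
  then have "(LEAST m. block k m w) = m" using m by (rule block_unique)
  then show ?thesis using m by (auto simp: first_one_def)
qed

lemma first_one_flip: "first_one q k (flip (prod_encode (l, 0)) w) = first_one q k w"
  by (simp add: first_one_def block_flip)

text \<open>
  Terms \<open>t = |a\<^sub>k| v\<^sub>k\<close> with \<open>t \<le> 1\<close> enter the upper estimate through \<open>t\<^sup>2\<close> and the others through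
  \<open>t\<^sup>r\<close>; because of \<open>r < p < 2\<close> both parts have integrals of order \<open>|a\<^sub>k|\<^sup>p\<close>. The lower estimate only
  uses that some term is at least \<open>1\<close> with a probability bounded from below.
\<close>

lemma ell_embeds_stable:
  assumes r: "0 < r" and s: "0 < s" and p: "r < p" "p < 2"
  shows "qembeds (ell (ereal p)) (ell_sum s (L_unit r :: ('k::{real_normed_field, euclidean_space}, _) qspace))"
proof -
  let ?U = "lebesgue_on {0..1::real}"
  obtain c C where c: "0 < c" "0 < C" and sq: "\<And>(x :: nat \<Rightarrow> real \<Rightarrow> 'k) a F.
      \<lbrakk>\<And>k. x k \<in> borel_measurable borel;
        \<And>k l w. x k (flip (prod_encode (l, 0)) w) = (if k = l then - x k w else x k w); finite F\<rbrakk> \<Longrightarrow>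
      ennreal c * square_moment r x a F \<le> moment r x a F \<and> moment r x a F \<le> ennreal C * square_moment r x a F"
    using symmetric_square_function[OF r] by blast
  have p0: "0 < p" using r p by simp
  define q where "q = 2 powr (1 / p)"
  have q: "1 < q" using p0 by (simp add: q_def)
  have q_pow: "(q ^ m) powr p = 2 ^ m" for m
    using p0 by (simp add: q_def powr_powr mult.commute flip: powr_realpow)
  obtain D where D: "0 < D" "\<And>b n. 0 < b \<Longrightarrow>
      (\<Sum>m<n. if b * q ^ m \<le> 1 then (b * q ^ m) powr (2 - p) else (b * q ^ m) powr (- (p - r))) \<le> D"
    using sum_two_sided_geometric_bounded[of "2 - p" "p - r" q] p q by auto
  define x :: "nat \<Rightarrow> real \<Rightarrow> 'k" where
    "x k w = (if digit (prod_encode (k, 0)) w then - of_real (first_one q k w) else of_real (first_one q k w))" for k w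
  have x: "x k \<in> borel_measurable borel" for k unfolding x_def[abs_def] by measurable
  have symm: "x k (flip (prod_encode (l, 0)) w) = (if k = l then - x k w else x k w)" for k l w
    by (auto simp: x_def digit_flip first_one_flip)
  have nonneg: "0 \<le> first_one q k w" for k w
    using q by (simp add: first_one_def)
  have norm: "norm (x k w) = first_one q k w" for k w
    using nonneg[of k w] by (simp add: x_def)
  have prob: "(\<integral>\<^sup>+w. indicator {w. block k m w} w \<partial>?U) = ennreal (1 / 2 ^ Suc m)" for k m
    using prob_blocks[of "{k}" "\<lambda>_. m"] by simp
  define h where "h t = (if t \<le> 1 then t\<^sup>2 else t powr r)" for t :: real
  have h_nonneg: "0 \<le> h t" for t by (simp add: h_def)
  have [measurable]: "h \<in> borel_measurable borel" unfolding h_def[abs_def] by measurable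
  have h_scale: "h (b * q ^ m) / 2 ^ m
      = b powr p * (if b * q ^ m \<le> 1 then (b * q ^ m) powr (2 - p) else (b * q ^ m) powr (- (p - r)))"
    if b: "0 < b" for b m
  proof -
    let ?t = "b * q ^ m"
    have t: "0 < ?t" using b q by simp
    have tp: "?t powr p = b powr p * 2 ^ m" using b q by (simp add: powr_mult q_pow)
    have "h ?t = ?t powr p * (if ?t \<le> 1 then ?t powr (2 - p) else ?t powr (- (p - r)))"
      using t by (simp add: h_def powr_numeral flip: powr_add)
    then show ?thesis unfolding tp by simp
  qed
  have tail: "(\<integral>\<^sup>+w. ennreal (h (b * first_one q k w)) \<partial>?U) \<le> ennreal (D * b powr p)" if b: "0 \<le> b" for b k
  proof (cases "b = 0")
    case True
    then show ?thesis by (simp add: h_def)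
  next
    case False
    then have b: "0 < b" using b by simp
    have "(\<integral>\<^sup>+w. ennreal (h (b * first_one q k w)) \<partial>?U)
        \<le> (\<integral>\<^sup>+w. (\<Sum>m. ennreal (h (b * q ^ m)) * indicator {w. block k m w} w) \<partial>?U)"
    proof (intro nn_integral_mono)
      fix w
      show "ennreal (h (b * first_one q k w)) \<le> (\<Sum>m. ennreal (h (b * q ^ m)) * indicator {w. block k m w} w)"
      proof (cases "\<exists>m. block k m w")
        case True
        then obtain m where m: "block k m w" by blast
        then show ?thesis
          using sum_le_suminf[of "\<lambda>m. ennreal (h (b * q ^ m)) * indicator {w. block k m w} w" "{m}"]
          by (simp add: first_one_block)
      next
        case False
        then show ?thesis by (simp add: first_one_def h_def)
      qed
    qed
    also have "\<dots> = (\<Sum>m. ennreal (h (b * q ^ m)) * ennreal (1 / 2 ^ Suc m))"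
      unfolding prob[of k, symmetric]
      by (subst nn_integral_suminf)
        (auto intro!: suminf_cong nn_integral_cmult borel_measurable_unit)
    also have "\<dots> \<le> ennreal (D * b powr p)"
    proof (rule suminf_le_const)
      fix n
      have "(\<Sum>m<n. ennreal (h (b * q ^ m)) * ennreal (1 / 2 ^ Suc m)) = ennreal (\<Sum>m<n. h (b * q ^ m) / 2 ^ m / 2)"
        using h_nonneg by (subst sum_ennreal[symmetric]) (auto simp: mult.commute simp flip: ennreal_mult)
      also have "\<dots> \<le> ennreal (D * b powr p)"
      proof (rule ennreal_leI)
        have "(\<Sum>m<n. h (b * q ^ m) / 2 ^ m / 2) \<le> (\<Sum>m<n. h (b * q ^ m) / 2 ^ m)"
          using h_nonneg by (intro sum_mono) (simp add: field_simps)
        also have "\<dots> = b powr p * (\<Sum>m<n. if b * q ^ m \<le> 1 then (b * q ^ m) powr (2 - p)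
            else (b * q ^ m) powr (- (p - r)))"
          by (simp only: h_scale[OF b] sum_distrib_left)
        also have "\<dots> \<le> b powr p * D" by (intro mult_left_mono D b) auto
        finally show "(\<Sum>m<n. h (b * q ^ m) / 2 ^ m / 2) \<le> D * b powr p" by (simp add: mult.commute)
      qed
      finally show "(\<Sum>m<n. ennreal (h (b * q ^ m)) * ennreal (1 / 2 ^ Suc m)) \<le> ennreal (D * b powr p)" .
    qed simp
    finally show ?thesis .
  qed
  have upper: "square_moment r x a F \<le> ennreal (1 + D)"
    if F: "finite F" and a: "(\<Sum>n\<in>F. norm (a n) powr p) = 1" for a F
  proof -
    have "square_moment r x a F \<le> (\<integral>\<^sup>+w. 1 + (\<Sum>k\<in>F. ennreal (h (norm (a k) * first_one q k w))) \<partial>?U)"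
    proof (intro nn_integral_mono)
      fix w
      have "(\<Sum>k\<in>F. (norm (a k * x k w))\<^sup>2) powr (r / 2) \<le> 1 + (\<Sum>k\<in>F. h (norm (a k) * first_one q k w))"
        using powr_sum_squares_le[OF F, of "\<lambda>k. norm (a k) * first_one q k w" r] r p nonneg
        by (simp add: norm_mult norm h_def)
      then have "ennreal ((\<Sum>k\<in>F. (norm (a k * x k w))\<^sup>2) powr (r / 2))
          \<le> ennreal (1 + (\<Sum>k\<in>F. h (norm (a k) * first_one q k w)))" by (rule ennreal_leI)
      also have "\<dots> = 1 + (\<Sum>k\<in>F. ennreal (h (norm (a k) * first_one q k w)))"
        using h_nonneg by (simp add: sum_nonneg sum_ennreal)
      finally show "ennreal ((\<Sum>k\<in>F. (norm (a k * x k w))\<^sup>2) powr (r / 2))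
          \<le> 1 + (\<Sum>k\<in>F. ennreal (h (norm (a k) * first_one q k w)))" .
    qed
    also have "\<dots> = 1 + (\<Sum>k\<in>F. \<integral>\<^sup>+w. ennreal (h (norm (a k) * first_one q k w)) \<partial>?U)"
      by (subst nn_integral_add)
        (auto simp: emeasure_restrict_space intro!: nn_integral_sum borel_measurable_unit borel_measurable_sum)
    also have "\<dots> \<le> 1 + (\<Sum>k\<in>F. ennreal (D * norm (a k) powr p))"
      by (intro add_left_mono sum_mono tail) auto
    also have "\<dots> = ennreal (1 + D)"
      using a D by (simp add: sum_ennreal flip: sum_distrib_left)
    finally show ?thesis .
  qed
  have lower: "ennreal (1 / 8) \<le> square_moment r x a F"
    if F: "finite F" and a: "(\<Sum>n\<in>F. norm (a n) powr p) = 1" for a F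
  proof -
    define F' where "F' = {k \<in> F. a k \<noteq> 0}"
    have F': "finite F'" using F by (simp add: F'_def)
    have a': "(\<Sum>n\<in>F'. norm (a n) powr p) = 1"
      unfolding a[symmetric] using F by (intro sum.mono_neutral_left) (auto simp: F'_def)
    \<comment> \<open>\<open>m\<close> is the first level at which the term with index \<open>k\<close> reaches \<open>1\<close>\<close>
    have "\<exists>m. 1 \<le> norm (a k) powr p * 2 ^ m \<and> norm (a k) powr p * 2 ^ m \<le> 2" if k: "k \<in> F'" for k
    proof -
      let ?b = "norm (a k) powr p"
      have b: "0 < ?b" using k by (simp add: F'_def)
      have "?b \<le> (\<Sum>n\<in>F'. norm (a n) powr p)" using F' k by (intro member_le_sum) auto
      then have b1: "?b \<le> 1" using a' by simp
      obtain n where "1 / ?b < 2 ^ n" using real_arch_pow[of 2 "1 / ?b"] by auto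
      then have ex: "1 \<le> ?b * 2 ^ n" using b by (simp add: field_simps)
      define m where "m = (LEAST m. 1 \<le> ?b * 2 ^ m)"
      have m: "1 \<le> ?b * 2 ^ m" unfolding m_def using ex by (rule LeastI)
      have "?b * 2 ^ m \<le> 2"
      proof (cases m)
        case (Suc i)
        then have "\<not> 1 \<le> ?b * 2 ^ i" using not_less_Least[of i "\<lambda>m. 1 \<le> ?b * 2 ^ m"] by (simp add: m_def)
        then show ?thesis using Suc by simp
      qed (use b1 in simp)
      with m show ?thesis by blast
    qed
    then obtain m where m: "\<And>k. k \<in> F' \<Longrightarrow> 1 \<le> norm (a k) powr p * 2 ^ m k"
        "\<And>k. k \<in> F' \<Longrightarrow> norm (a k) powr p * 2 ^ m k \<le> 2"
      by metis
    \<comment> \<open>the uniform distribution on Borel sets, so that probabilities are taken of sets of reals\<close>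
    define N where "N = distr ?U borel (\<lambda>w. w)"
    have id: "(\<lambda>w. w) \<in> ?U \<rightarrow>\<^sub>M borel" by (rule borel_measurable_unit) simp
    have N: "finite_measure N"
      unfolding N_def by (intro finite_measure.finite_measure_distr id finite_measureI)
        (simp add: emeasure_restrict_space)
    interpret N: finite_measure N by (rule N)
    have emN: "emeasure N A = (\<integral>\<^sup>+w. indicator A w \<partial>?U)" if "A \<in> sets borel" for A
    proof -
      have "emeasure N A = (\<integral>\<^sup>+w. indicator A w \<partial>N)" using that by (simp add: N_def)
      also have "\<dots> = (\<integral>\<^sup>+w. indicator A w \<partial>?U)"
        unfolding N_def using that by (intro nn_integral_distr[OF id]) auto
      finally show ?thesis .
    qed
    define B where "B k = {w. block k (m k) w}" for k
    have B [measurable]: "B k \<in> sets borel" for k unfolding B_def by measurable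
    have mB: "measure N (B k) = 1 / 2 ^ Suc (m k)" for k
      unfolding measure_def emN[OF B] using prob[of k "m k"] by (simp add: B_def)
    have pair: "measure N (B k \<inter> B l) \<le> measure N (B k) * measure N (B l)" if "k \<noteq> l" for k l
    proof -
      have "B k \<inter> B l = {w. \<forall>k\<in>{k, l}. block k (m k) w}" by (auto simp: B_def)
      then have "emeasure N (B k \<inter> B l) = ennreal (1 / 2 ^ Suc (m k) * (1 / 2 ^ Suc (m l)))"
        using prob_blocks[of "{k, l}" m] that emN[of "B k \<inter> B l"] by simp
      then have "measure N (B k \<inter> B l) = 1 / 2 ^ Suc (m k) * (1 / 2 ^ Suc (m l))"
        unfolding measure_def by simp
      then show ?thesis by (simp add: mB)
    qed
    define S where "S = (\<Sum>k\<in>F'. measure N (B k))"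
    have S_bounds: "1 / 4 \<le> S" "S \<le> 1 / 2"
    proof -
      have "(\<Sum>k\<in>F'. norm (a k) powr p / 4) \<le> S"
        unfolding S_def mB using m(2) by (intro sum_mono) (simp add: field_simps)
      then show "1 / 4 \<le> S" using a' by (simp flip: sum_divide_distrib)
      have "S \<le> (\<Sum>k\<in>F'. norm (a k) powr p / 2)"
        unfolding S_def mB using m(1) by (intro sum_mono) (simp add: field_simps)
      then show "S \<le> 1 / 2" using a' by (simp flip: sum_divide_distrib)
    qed
    have "S\<^sup>2 \<le> S * (1 / 2)"
      using S_bounds by (simp add: power2_eq_square mult_left_mono)
    then have "1 / 8 \<le> S - S\<^sup>2 / 2" using S_bounds by simp
    also have "\<dots> \<le> measure N (\<Union>k\<in>F'. B k)"
      unfolding S_def by (intro measure_UN_ge_if_pairwise_independent N F' pair) (auto simp: N_def)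
    finally have "ennreal (1 / 8) \<le> emeasure N (\<Union>k\<in>F'. B k)"
      by (simp add: N.emeasure_eq_measure ennreal_leI)
    also have "\<dots> = (\<integral>\<^sup>+w. indicator (\<Union>k\<in>F'. B k) w \<partial>?U)"
      using F' by (intro emN) auto
    also have "\<dots> \<le> square_moment r x a F"
    proof (intro nn_integral_mono)
      fix w
      show "indicator (\<Union>k\<in>F'. B k) w \<le> ennreal ((\<Sum>k\<in>F. (norm (a k * x k w))\<^sup>2) powr (r / 2))"
      proof (cases "w \<in> (\<Union>k\<in>F'. B k)")
        case True
        then obtain k where k: "k \<in> F'" "block k (m k) w" by (auto simp: B_def)
        let ?t = "norm (a k) * q ^ m k"
        have "1 \<le> ?t powr p" using m(1)[OF k(1)] q by (simp add: powr_mult q_pow)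
        have t0: "0 \<le> ?t" using q by simp
        have "1 \<le> ?t"
        proof (rule ccontr)
          assume "\<not> 1 \<le> ?t"
          then have "?t powr p < 1 powr p" using t0 p0 by (intro powr_less_mono2) auto
          then show False using \<open>1 \<le> ?t powr p\<close> by simp
        qed
        moreover have "?t = norm (a k * x k w)"
          using k(2) by (simp add: norm_mult norm first_one_block)
        ultimately have "1 \<le> (norm (a k * x k w))\<^sup>2" by simp
        also have "\<dots> \<le> (\<Sum>k\<in>F. (norm (a k * x k w))\<^sup>2)"
          using F k(1) by (intro member_le_sum) (auto simp: F'_def)
        finally have "1 \<le> (\<Sum>k\<in>F. (norm (a k * x k w))\<^sup>2) powr (r / 2)"
          using r by (intro ge_one_powr_ge_zero) auto
        then show ?thesis using True by simp
      qed simp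
    qed
    finally show ?thesis .
  qed
  show ?thesis
  proof (rule ell_embeds_if_normalised_bounds[OF r s p0 x])
    show "0 < c * (1 / 8)" "0 < C * (1 + D)" using c D by auto
    fix a :: "nat \<Rightarrow> 'k" and F :: "nat set"
    assume F: "finite F" and a: "(\<Sum>n\<in>F. norm (a n) powr p) = 1"
    note square = sq[OF x symm F, of a]
    have "ennreal (c * (1 / 8)) = ennreal c * ennreal (1 / 8)" using c by (intro ennreal_mult) auto
    also have "\<dots> \<le> ennreal c * square_moment r x a F" by (intro mult_left_mono lower F a) auto
    also note square[THEN conjunct1]
    finally have low: "ennreal (c * (1 / 8)) \<le> moment r x a F" .
    note square[THEN conjunct2]
    also have "ennreal C * square_moment r x a F \<le> ennreal C * ennreal (1 + D)"
      by (intro mult_left_mono upper F a) auto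
    also have "\<dots> = ennreal (C * (1 + D))"
      using c D by (intro ennreal_mult[symmetric]) auto
    finally have "moment r x a F \<le> ennreal (C * (1 + D))" .
    with low show "ennreal (c * (1 / 8)) \<le> moment r x a F \<and> moment r x a F \<le> ennreal (C * (1 + D))"
      by simp
  qed
qed

section \<open>Gliding humps\<close>

lemma powr_growth_le:
  fixes \<alpha> \<beta> K :: real
  assumes "\<And>n. 1 \<le> n \<Longrightarrow> real n powr \<alpha> \<le> K * real n powr \<beta>"
  shows "\<alpha> \<le> \<beta>"
proof (rule ccontr)
  assume "\<not> \<alpha> \<le> \<beta>"
  then have d: "0 < \<alpha> - \<beta>" by simp
  obtain k where k: "(\<bar>K\<bar> + 1) powr (1 / (\<alpha> - \<beta>)) \<le> real k" using real_arch_simple by blast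
  define n where "n = max k 1"
  have "\<bar>K\<bar> + 1 = ((\<bar>K\<bar> + 1) powr (1 / (\<alpha> - \<beta>))) powr (\<alpha> - \<beta>)"
    using d by (simp add: powr_powr)
  also have "\<dots> \<le> real n powr (\<alpha> - \<beta>)"
    using d k by (intro powr_mono2) (auto simp: n_def)
  finally have n: "K + 1 \<le> real n powr (\<alpha> - \<beta>)" "1 \<le> n" by (auto simp: n_def)
  have "real n powr \<alpha> = real n powr (\<alpha> - \<beta>) * real n powr \<beta>"
    by (simp flip: powr_add)
  with assms[OF n(2)] n have "real n powr (\<alpha> - \<beta>) \<le> K" by simp
  then show False using n by simp
qed

text \<open>Adding a small term changes a power only a little, at the price of a large constant on it.\<close>

lemma powr_add_le_eta:
  fixes \<eta> Q :: real
  assumes \<eta>: "0 < \<eta>" and Q: "0 < Q"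
  obtains C where "0 < C"
    "\<And>x y. \<lbrakk>0 \<le> x; 0 \<le> y\<rbrakk> \<Longrightarrow> (x + y) powr Q \<le> (1 + \<eta>) * x powr Q + C * y powr Q"
proof -
  define \<delta> where "\<delta> = (1 + \<eta>) powr (1 / Q) - 1"
  have "1 < (1 + \<eta>) powr (1 / Q)" using \<eta> Q by simp
  then have \<delta>: "0 < \<delta>" by (simp add: \<delta>_def)
  have \<delta>Q: "(1 + \<delta>) powr Q = 1 + \<eta>" using \<eta> Q by (simp add: \<delta>_def powr_powr)
  show ?thesis
  proof (rule that[of "(1 + 1 / \<delta>) powr Q"])
    have "0 < 1 + 1 / \<delta>" using \<delta> by (simp add: add_pos_pos)
    then show "0 < (1 + 1 / \<delta>) powr Q" by simp
    fix x y :: real assume xy: "0 \<le> x" "0 \<le> y"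
    show "(x + y) powr Q \<le> (1 + \<eta>) * x powr Q + (1 + 1 / \<delta>) powr Q * y powr Q"
    proof (cases "y \<le> \<delta> * x")
      case True
      then have "(x + y) powr Q \<le> ((1 + \<delta>) * x) powr Q"
        using xy Q by (intro powr_mono2) (auto simp: algebra_simps)
      also have "\<dots> = (1 + \<eta>) * x powr Q" using xy \<delta> \<delta>Q by (simp add: powr_mult)
      finally show ?thesis by (simp add: add_increasing2)
    next
      case False
      then have "x \<le> y / \<delta>" using \<delta> by (simp add: field_simps)
      then have "(x + y) powr Q \<le> ((1 + 1 / \<delta>) * y) powr Q"
        using xy Q by (intro powr_mono2) (auto simp: algebra_simps)
      also have "\<dots> = (1 + 1 / \<delta>) powr Q * y powr Q"
        using xy \<delta> by (simp add: powr_mult)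
      finally show ?thesis using \<eta> by (simp add: add_increasing)
    qed
  qed
qed

definition tail :: "nat \<Rightarrow> (nat \<Rightarrow> 'k::zero) \<Rightarrow> bool" where
  "tail m a \<longleftrightarrow> finite {n. a n \<noteq> 0} \<and> (\<forall>n<m. a n = 0)"

lemma tail_mono: "\<lbrakk>tail m a; l \<le> m\<rbrakk> \<Longrightarrow> tail l a"
  by (auto simp: tail_def)

lemma tail_add: "\<lbrakk>tail m a; tail m b\<rbrakk> \<Longrightarrow> tail m (\<lambda>n. a n + b n :: 'k::monoid_add)"
  by (auto simp: tail_def intro: finite_subset[of _ "{n. a n \<noteq> 0} \<union> {n. b n \<noteq> 0}"])

lemma tail_mult: "tail m a \<Longrightarrow> tail m (\<lambda>n. c * a n :: 'k::mult_zero)"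
  by (auto simp: tail_def intro: finite_subset[of _ "{n. a n \<noteq> 0}"])

lemma tail_minus: "tail m a \<Longrightarrow> tail m (\<lambda>n. - a n :: 'k::group_add)"
  by (auto simp: tail_def)

text \<open>
  What the argument needs to know about the norm of \<open>\<ell>\<^sub>p\<close>, with \<open>\<theta>\<close> standing for \<open>1/p\<close>, or for
  \<open>0\<close> in the case of \<open>c\<^sub>0\<close>.
\<close>

locale sequence_norm =
  fixes \<nu> :: "(nat \<Rightarrow> 'k::{real_normed_field, euclidean_space}) \<Rightarrow> real" and \<theta> :: real
  assumes scale: "tail 0 a \<Longrightarrow> \<nu> (\<lambda>n. c * a n) = norm c * \<nu> a"
    and nonneg: "tail 0 a \<Longrightarrow> 0 \<le> \<nu> a"
    and definite: "\<lbrakk>tail 0 a; \<nu> a = 0\<rbrakk> \<Longrightarrow> a = (\<lambda>_. 0)"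
    and unit: "\<nu> (\<lambda>n. if n = k then 1 else 0) = 1"
    and disjoint_add: "\<lbrakk>tail 0 a; tail 0 b; \<And>n. a n = 0 \<or> b n = 0; \<nu> a = real j powr \<theta>; 1 \<le> j; \<nu> b = 1\<rbrakk>
      \<Longrightarrow> \<nu> (\<lambda>n. a n + b n) = real (Suc j) powr \<theta>"
begin

lemma tail_signs: "finite F \<Longrightarrow> (\<And>n. n \<in> F \<Longrightarrow> m \<le> n) \<Longrightarrow> tail m (\<lambda>n. if n \<in> F then if n \<in> A then - 1 else 1 :: 'k else 0)"
  by (auto simp: tail_def not_le[symmetric] intro: finite_subset[of _ F])

lemma norm_signs:
  assumes "finite F" "F \<noteq> {}"
  shows "\<nu> (\<lambda>n. if n \<in> F then if n \<in> A then - 1 else 1 else 0) = real (card F) powr \<theta>"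
proof -
  have single: "\<nu> (\<lambda>n. if n = k then if n \<in> A then - 1 else 1 else 0) = 1" for k
  proof -
    have "tail 0 (\<lambda>n. if n = k then 1 else 0 :: 'k)"
      by (auto simp: tail_def intro: finite_subset[of _ "{k}"])
    then have "\<nu> (\<lambda>n. (if k \<in> A then - 1 else 1) * (if n = k then 1 else 0)) = 1"
      by (subst scale) (auto simp: unit)
    moreover have "(\<lambda>n. (if k \<in> A then - 1 else 1) * (if n = k then 1 else 0 :: 'k))
        = (\<lambda>n. if n = k then if n \<in> A then - 1 else 1 else 0)" by auto
    ultimately show ?thesis by simp
  qed
  show ?thesis
    using assms
  proof (induction F rule: finite_ne_induct)
    case (singleton x)
    then show ?case using single[of x] by simp
  next
    case (insert x F)
    let ?a = "\<lambda>n. if n \<in> F then if n \<in> A then - 1 else 1 else 0 :: 'k"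
    let ?b = "\<lambda>n. if n = x then if n \<in> A then - 1 else 1 else 0 :: 'k"
    have "\<nu> (\<lambda>n. ?a n + ?b n) = real (Suc (card F)) powr \<theta>"
    proof (rule disjoint_add)
      show "tail 0 ?a" using insert by (intro tail_signs) auto
      show "tail 0 ?b" using tail_signs[of "{x}" 0 A] by simp
      show "1 \<le> card F" using insert by (simp add: Suc_le_eq card_gt_0_iff)
    qed (use insert single in auto)
    moreover have "(\<lambda>n. ?a n + ?b n) = (\<lambda>n. if n \<in> insert x F then if n \<in> A then - 1 else 1 else 0)"
      using insert by auto
    ultimately show ?case using insert by simp
  qed
qed

lemma normalise:
  assumes a: "tail 0 a" "\<nu> a \<noteq> 0"
  shows "\<nu> (\<lambda>n. of_real (1 / \<nu> a) * a n) = 1"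
  using a nonneg[OF a(1)] by (subst scale) (auto simp: norm_divide)

end

text \<open>
  The density \<open>G a\<close> stands for the \<open>q\<close>-th power of the norm of the image of \<open>a\<close>, taken pointwise.
  If images of unit vectors can be concentrated where any given image is small, then adding one
  vector after the other makes the \<open>q\<close>-th powers add up, up to bounded factors; comparing with the
  growth of \<open>\<nu>\<close> determines \<open>\<theta>\<close>. Since the error at each step can be made as small as desired, no
  infinite block sequence is needed.
\<close>

lemma (in sequence_norm) gliding_hump:
  fixes G :: "(nat \<Rightarrow> 'k) \<Rightarrow> 'a \<Rightarrow> real"
  assumes int: "\<And>a. tail m0 a \<Longrightarrow> integrable M (G a)"
    and G_nonneg: "\<And>a w. 0 \<le> G a w"
    and G_minus: "\<And>a. G (\<lambda>n. - a n) = G a"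
    and G_add: "\<And>\<eta>. 0 < \<eta> \<Longrightarrow> \<exists>K>0. \<forall>a b w. tail m0 a \<longrightarrow> tail m0 b \<longrightarrow>
      G (\<lambda>n. a n + b n) w \<le> (1 + \<eta>) * G a w + K * G b w"
    and c: "0 < c"
    and lower: "\<And>a. tail m0 a \<Longrightarrow> c * \<nu> a powr q \<le> (\<integral>w. G a w \<partial>M)"
    and upper: "\<And>a. tail m0 a \<Longrightarrow> (\<integral>w. G a w \<partial>M) \<le> C * \<nu> a powr q"
    and hump: "\<And>f \<epsilon> m. \<lbrakk>tail m0 f; 0 < \<epsilon>\<rbrakk> \<Longrightarrow> \<exists>a A. tail (max m m0) a \<and> \<nu> a = 1 \<and> A \<in> sets M
      \<and> (\<integral>w. G f w * indicator A w \<partial>M) < \<epsilon> \<and> (\<integral>w. G a w * indicator (- A) w \<partial>M) < \<epsilon>"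
  shows "\<theta> * q = 1"
proof -
  define I where "I a = (\<integral>w. G a w \<partial>M)" for a
  let ?e = "\<lambda>k n. if n = k then 1 else 0 :: 'k"
  have e_tail: "tail m0 (?e m0)" by (auto simp: tail_def intro: finite_subset[of _ "{m0}"])
  have cC: "c \<le> C"
    using lower[OF e_tail] upper[OF e_tail] by (simp add: unit)
  have I_nonneg: "0 \<le> I a" for a
    unfolding I_def using G_nonneg by simp
  have step: "\<exists>u. tail m0 u \<and> (\<forall>n. f n = 0 \<or> u n = 0) \<and> \<nu> u = 1
      \<and> I f + c / 2 \<le> I (\<lambda>n. f n + u n) \<and> I (\<lambda>n. f n + u n) \<le> I f + 2 * C"
    if f: "tail m0 f" for f
  proof -
    \<comment> \<open>all errors together are at most \<open>c / 2\<close>, whereas \<open>u\<close> contributes at least \<open>c\<close>\<close>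
    define \<eta> where "\<eta> = c / (4 * (C + I f))"
    have CI: "0 < C + I f" using c cC I_nonneg[of f] by simp
    then have \<eta>: "0 < \<eta>" using c by (simp add: \<eta>_def)
    have "c / (4 * t) * t = c / 4" if "0 < t" for t using that by simp
    from this[OF CI] have \<eta>CI: "\<eta> * (C + I f) = c / 4" by (simp only: \<eta>_def)
    obtain K where K: "0 < K" "\<And>a b w. \<lbrakk>tail m0 a; tail m0 b\<rbrakk>
        \<Longrightarrow> G (\<lambda>n. a n + b n) w \<le> (1 + \<eta>) * G a w + K * G b w"
      using G_add[OF \<eta>] by blast
    define \<delta> where "\<delta> = c / (8 * (1 + K))"
    have \<delta>: "0 < \<delta>" using c K by (simp add: \<delta>_def)
    have "c / (8 * t) * t = c / 8" if "0 < t" for t using that by simp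
    from this[of "1 + K"] K have \<delta>K: "\<delta> * (1 + K) = c / 8" by (simp only: \<delta>_def)
    have fin: "finite {n. f n \<noteq> 0}" using f by (simp add: tail_def)
    define m where "m = Suc (Max (insert 0 {n. f n \<noteq> 0}))"
    have f_zero: "f n = 0" if "m \<le> n" for n
    proof (rule ccontr)
      assume "f n \<noteq> 0"
      then have "n \<le> Max (insert 0 {n. f n \<noteq> 0})" using fin by (intro Max_ge) auto
      then show False using that by (simp add: m_def)
    qed
    obtain u A where u: "tail (max m m0) u" "\<nu> u = 1" and A: "A \<in> sets M"
      and fA: "(\<integral>w. G f w * indicator A w \<partial>M) < \<delta>" and uA: "(\<integral>w. G u w * indicator (- A) w \<partial>M) < \<delta>"
      using hump[OF f \<delta>] by blast
    have u0: "tail m0 u" using u(1) by (rule tail_mono) simp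
    have disj: "f n = 0 \<or> u n = 0" for n
      using f_zero[of n] u(1) by (cases "m \<le> n") (auto simp: tail_def)
    define g where "g = (\<lambda>n. f n + u n)"
    have g: "tail m0 g" unfolding g_def by (intro tail_add f u0)
    have Iu: "c \<le> I u" "I u \<le> C" using lower[OF u0] upper[OF u0] u by (auto simp: I_def)
    have iA: "integrable M (\<lambda>w. G a w * indicator A w)" if "tail m0 a" for a
      using integrable_mult_indicator[OF A int[OF that]] by (simp add: mult.commute)
    have iA': "integrable M (\<lambda>w. G a w * indicator (- A) w)" if a: "tail m0 a" for a
    proof -
      have "integrable M (\<lambda>w. G a w - G a w * indicator A w)" by (intro Bochner_Integration.integrable_diff int iA a)
      moreover have "(\<lambda>w. G a w - G a w * indicator A w) = (\<lambda>w. G a w * indicator (- A) w)"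
        by (auto simp: indicator_def)
      ultimately show ?thesis by simp
    qed
    have split: "I a = (\<integral>w. G a w * indicator A w \<partial>M) + (\<integral>w. G a w * indicator (- A) w \<partial>M)" if a: "tail m0 a" for a
    proof -
      have "I a = (\<integral>w. G a w * indicator A w + G a w * indicator (- A) w \<partial>M)"
        unfolding I_def by (intro Bochner_Integration.integral_cong) (auto simp: indicator_def)
      then show ?thesis
        by (simp only: Bochner_Integration.integral_add[OF iA[OF a] iA'[OF a]])
    qed
    have part: "(\<integral>w. G (\<lambda>n. a n + b n) w * indicator D w \<partial>M)
        \<le> (1 + \<eta>) * (\<integral>w. G a w * indicator D w \<partial>M) + K * (\<integral>w. G b w * indicator D w \<partial>M)"
      if a: "tail m0 a" and b: "tail m0 b" and D: "D = A \<or> D = - A" for a b D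
    proof -
      have i: "integrable M (\<lambda>w. G e w * indicator D w)" if "tail m0 e" for e
        using D iA[OF that] iA'[OF that] by auto
      have "(\<integral>w. G (\<lambda>n. a n + b n) w * indicator D w \<partial>M)
          \<le> (\<integral>w. (1 + \<eta>) * (G a w * indicator D w) + K * (G b w * indicator D w) \<partial>M)"
        using K(2)[OF a b] by (intro integral_mono i tail_add a b Bochner_Integration.integrable_add integrable_mult_right)
          (auto simp: indicator_def)
      also have "\<dots> = (1 + \<eta>) * (\<integral>w. G a w * indicator D w \<partial>M) + K * (\<integral>w. G b w * indicator D w \<partial>M)"
        using i[OF a] i[OF b] by simp
      finally show ?thesis .
    qed
    have gf: "(\<lambda>n. u n + f n) = g" "(\<lambda>n. g n + - f n) = u" "(\<lambda>n. g n + - u n) = f"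
      by (auto simp: g_def)
    let ?a = "\<lambda>h. \<integral>w. G h w * indicator A w \<partial>M" and ?b = "\<lambda>h. \<integral>w. G h w * indicator (- A) w \<partial>M"
    have nn: "0 \<le> ?a h" "0 \<le> ?b h" for h using G_nonneg by (auto intro!: integral_nonneg)
    \<comment> \<open>on \<open>A\<close> the sum is close to \<open>u\<close>, off \<open>A\<close> it is close to \<open>f\<close>\<close>
    have 1: "?a g \<le> (1 + \<eta>) * ?a u + K * ?a f" using part[OF u0 f, of A] by (simp add: gf)
    have 2: "?b g \<le> (1 + \<eta>) * ?b f + K * ?b u" using part[OF f u0, of "- A"] by (simp add: g_def)
    have 3: "?a u \<le> (1 + \<eta>) * ?a g + K * ?a f"
      using part[OF g tail_minus[OF f], of A] by (simp only: gf G_minus) simp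
    have 4: "?b f \<le> (1 + \<eta>) * ?b g + K * ?b u"
      using part[OF g tail_minus[OF u0], of "- A"] by (simp only: gf G_minus) simp
    have Ka: "K * ?a f \<le> K * \<delta>" and Kb: "K * ?b u \<le> K * \<delta>"
      using fA uA K by (auto intro!: mult_left_mono)
    have K\<delta>: "\<delta> + K * \<delta> = c / 8" using \<delta>K by (simp add: algebra_simps)
    have "I g \<le> (1 + \<eta>) * (?a u + ?b f) + 2 * (K * \<delta>)"
      using 1 2 Ka Kb unfolding split[OF g] by (simp add: distrib_left)
    also have "(1 + \<eta>) * (?a u + ?b f) \<le> (1 + \<eta>) * (C + I f)"
      using nn[of u] nn[of f] Iu(2) \<eta> unfolding split[OF u0] split[OF f]
      by (intro mult_left_mono) auto
    also have "\<dots> = C + I f + c / 4" using \<eta>CI by (simp add: distrib_right)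
    finally have hi: "I g \<le> I f + 2 * C" using K\<delta> \<delta> cC c by simp
    have "I u + I f \<le> (?a u + ?b f) + 2 * \<delta>"
      using fA uA unfolding split[OF u0] split[OF f] by simp
    also have "?a u + ?b f \<le> (1 + \<eta>) * I g + 2 * (K * \<delta>)"
      using 3 4 Ka Kb unfolding split[OF g] by (simp add: distrib_left)
    finally have "c + I f \<le> (1 + \<eta>) * I g + c / 4" using K\<delta> Iu by simp
    moreover have "(1 + \<eta>) * (I f + c / 2) \<le> I f + c / 2 + c / 4"
    proof -
      have "\<eta> * (I f + c / 2) \<le> \<eta> * (C + I f)" using \<eta> cC c by (intro mult_left_mono) auto
      then show ?thesis using \<eta>CI by (simp add: distrib_right)
    qed
    ultimately have "(1 + \<eta>) * (I f + c / 2) \<le> (1 + \<eta>) * I g" by simp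
    then have "I f + c / 2 \<le> I g" using \<eta> by simp
    with hi u0 disj u show ?thesis unfolding g_def by blast
  qed
  have grow: "\<exists>f. tail m0 f \<and> \<nu> f = real n powr \<theta> \<and> real n * (c / 2) \<le> I f \<and> I f \<le> real n * (2 * C)"
    if "1 \<le> n" for n
    using that
  proof (induction n rule: dec_induct)
    case base
    have "c \<le> I (?e m0)" "I (?e m0) \<le> C"
      using lower[OF e_tail] upper[OF e_tail] by (auto simp: unit I_def)
    then show ?case using e_tail unit[of m0] c cC by (intro exI[of _ "?e m0"]) auto
  next
    case (step n)
    then obtain f where f: "tail m0 f" "\<nu> f = real n powr \<theta>" "real n * (c / 2) \<le> I f" "I f \<le> real n * (2 * C)"
      by blast
    obtain u where u: "tail m0 u" "\<And>n. f n = 0 \<or> u n = 0" "\<nu> u = 1"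
      "I f + c / 2 \<le> I (\<lambda>n. f n + u n)" "I (\<lambda>n. f n + u n) \<le> I f + 2 * C"
      using \<open>\<And>f. tail m0 f \<Longrightarrow> \<exists>u. _ f u\<close>[OF f(1)] by blast
    have "\<nu> (\<lambda>n. f n + u n) = real (Suc n) powr \<theta>"
      using f u step.hyps by (intro disjoint_add) (auto intro: tail_mono)
    moreover have "tail m0 (\<lambda>n. f n + u n)" by (intro tail_add f u)
    ultimately show ?case
      using f u by (intro exI[of _ "\<lambda>n. f n + u n"]) (auto simp: distrib_right)
  qed
  have C: "0 < C" using c cC by simp
  have "\<theta> * q \<le> 1"
  proof (rule powr_growth_le)
    fix n :: nat assume "1 \<le> n"
    then obtain f where "tail m0 f" "\<nu> f = real n powr \<theta>" "I f \<le> real n * (2 * C)" using grow by blast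
    then have "c * real n powr (\<theta> * q) \<le> real n * (2 * C)"
      using lower[of f] by (simp add: I_def powr_powr)
    then show "real n powr (\<theta> * q) \<le> (2 * C / c) * real n powr 1"
      using c by (simp add: field_simps)
  qed
  moreover have "1 \<le> \<theta> * q"
  proof (rule powr_growth_le)
    fix n :: nat assume "1 \<le> n"
    then obtain f where "tail m0 f" "\<nu> f = real n powr \<theta>" "real n * (c / 2) \<le> I f" using grow by blast
    then have "real n * (c / 2) \<le> C * real n powr (\<theta> * q)"
      using upper[of f] by (simp add: I_def powr_powr)
    then show "real n powr 1 \<le> (2 * C / c) * real n powr (\<theta> * q)"
      using c by (simp add: field_simps)
  qed
  ultimately show ?thesis by simp
qed

section \<open>Type, cotype and the Kadec-Pelczynski dichotomy\<close>

abbreviation Lpow :: "'a measure \<Rightarrow> real \<Rightarrow> ('a \<Rightarrow> 'k::real_normed_vector) \<Rightarrow> real" where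
  "Lpow M r f \<equiv> \<integral>w. norm (f w) powr r \<partial>M"

definition lincomb :: "(nat \<Rightarrow> 'a \<Rightarrow> 'k) \<Rightarrow> (nat \<Rightarrow> 'k) \<Rightarrow> 'a \<Rightarrow> 'k::real_normed_field" where
  "lincomb x a w = (\<Sum>n | a n \<noteq> 0. a n * x n w)"

lemma lincomb_superset:
  assumes "finite F" "{n. a n \<noteq> 0} \<subseteq> F"
  shows "lincomb x a w = (\<Sum>n\<in>F. a n * x n w)"
  unfolding lincomb_def using assms by (intro sum.mono_neutral_left) auto

lemma lincomb_add:
  assumes "tail m a" "tail m b"
  shows "lincomb x (\<lambda>n. a n + b n) w = lincomb x a w + lincomb x b w"
proof -
  let ?F = "{n. a n \<noteq> 0} \<union> {n. b n \<noteq> 0}"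
  have F: "finite ?F" using assms by (simp add: tail_def)
  have "{n. a n + b n \<noteq> 0} \<subseteq> ?F" by auto
  then show ?thesis
    using lincomb_superset[OF F, of "\<lambda>n. a n + b n" x w] lincomb_superset[OF F, of a x w]
      lincomb_superset[OF F, of b x w]
    by (simp add: sum.distrib distrib_right)
qed

lemma lincomb_minus: "lincomb x (\<lambda>n. - a n) w = - lincomb x a w"
  by (simp add: lincomb_def sum_negf)

lemma lincomb_mult: "tail m a \<Longrightarrow> lincomb x (\<lambda>n. c * a n) w = c * lincomb x a w"
  using lincomb_superset[of "{n. a n \<noteq> 0}" "\<lambda>n. c * a n" x w]
  by (auto simp: tail_def lincomb_def sum_distrib_left mult.assoc)

lemma lincomb_unit: "lincomb x (\<lambda>n. if n = k then 1 else 0) w = x k w"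
  using lincomb_superset[of "{k}" "\<lambda>n. if n = k then 1 else 0" x w] by auto

lemma lincomb_signs:
  "finite F \<Longrightarrow> lincomb x (\<lambda>n. if n \<in> F then if n \<in> A then - 1 else 1 else 0) w = signed_sum (\<lambda>k. x k w) F A"
  by (subst lincomb_superset[of F]) (auto simp: signed_sum_def intro!: sum.cong)

lemma Lfun_lincomb:
  fixes x :: "nat \<Rightarrow> 'a \<Rightarrow> 'k::{real_normed_field, second_countable_topology}"
  assumes "0 < r" "\<And>n. x n \<in> Lfun M r"
  shows "lincomb x a \<in> Lfun M r"
  unfolding lincomb_def[abs_def] by (intro Lfun_sum assms)

lemma powr_sum_squares_le_sum_powr:
  fixes y :: "'i \<Rightarrow> real"
  assumes F: "finite F" and y: "\<And>k. k \<in> F \<Longrightarrow> 0 \<le> y k" and r: "0 < r" "r \<le> 2"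
  shows "(\<Sum>k\<in>F. (y k)\<^sup>2) powr (r / 2) \<le> (\<Sum>k\<in>F. y k powr r)"
proof -
  define S where "S = (\<Sum>k\<in>F. (y k)\<^sup>2)"
  have "0 \<le> S" by (simp add: S_def sum_nonneg)
  show ?thesis
  proof (cases "S = 0")
    case True
    then show ?thesis using r by (simp add: S_def sum_nonneg)
  next
    case False
    then have S: "0 < S" using \<open>0 \<le> S\<close> by simp
    have "S powr (r / 2) = S * S powr (r / 2 - 1)"
      using S by (simp add: powr_diff)
    also have "\<dots> = (\<Sum>k\<in>F. (y k)\<^sup>2 * S powr (r / 2 - 1))"
      by (simp add: S_def sum_distrib_right)
    also have "\<dots> \<le> (\<Sum>k\<in>F. y k powr r)"
    proof (rule sum_mono)
      fix k assume k: "k \<in> F"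
      show "(y k)\<^sup>2 * S powr (r / 2 - 1) \<le> y k powr r"
      proof (cases "y k = 0")
        case nz: False
        then have yk: "0 < y k" using y[OF k] by simp
        have "(y k)\<^sup>2 \<le> S" unfolding S_def using k F by (intro member_le_sum) auto
        then have "(y k)\<^sup>2 * S powr (r / 2 - 1) \<le> (y k)\<^sup>2 * ((y k)\<^sup>2) powr (r / 2 - 1)"
          using r yk by (intro mult_left_mono powr_mono2') auto
        also have "\<dots> = y k powr r"
        proof -
          have "(y k)\<^sup>2 = y k powr 2" using yk by (simp add: powr_numeral)
          then show ?thesis using yk by (simp only: powr_powr flip: powr_add) simp
        qed
        finally show ?thesis .
      qed simp
    qed
    finally show ?thesis by (simp add: S_def)
  qed
qed

text \<open>
  With \<open>\<mu>\<close> the mean of the squares, each \<open>y\<^sup>r = (y\<^sup>2)\<^bsup>r/2\<^esup>\<close> is at most \<open>\<mu>\<^bsup>r/2\<^esup>\<close> or at most \<open>y\<^sup>2 \<mu>\<^bsup>r/2-1\<^esup>\<close>; this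
  costs a factor \<open>2\<close> compared with the concavity of the power.
\<close>

lemma sum_powr_le_powr_sum_squares:
  fixes y :: "'i \<Rightarrow> real"
  assumes F: "finite F" "F \<noteq> {}" and y: "\<And>k. k \<in> F \<Longrightarrow> 0 \<le> y k" and r: "0 < r" "r \<le> 2"
  shows "(\<Sum>k\<in>F. y k powr r) \<le> 2 * real (card F) powr (1 - r / 2) * (\<Sum>k\<in>F. (y k)\<^sup>2) powr (r / 2)"
proof -
  define S where "S = (\<Sum>k\<in>F. (y k)\<^sup>2)"
  define n where "n = real (card F)"
  define \<mu> where "\<mu> = S / n"
  have n: "0 < n" using F by (simp add: n_def card_gt_0_iff)
  have "0 \<le> S" by (simp add: S_def sum_nonneg)
  show ?thesis
  proof (cases "S = 0")
    case True
    then have "\<forall>k\<in>F. (y k)\<^sup>2 = 0"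
      unfolding S_def using F by (subst (asm) sum_nonneg_eq_0_iff) auto
    then have "(\<Sum>k\<in>F. y k powr r) = 0" by (intro sum.neutral) auto
    then show ?thesis by simp
  next
    case False
    then have S: "0 < S" using \<open>0 \<le> S\<close> by simp
    then have \<mu>: "0 < \<mu>" using n by (simp add: \<mu>_def)
    have "(\<Sum>k\<in>F. y k powr r) \<le> (\<Sum>k\<in>F. \<mu> powr (r / 2) + (y k)\<^sup>2 * \<mu> powr (r / 2 - 1))"
    proof (rule sum_mono)
      fix k assume k: "k \<in> F"
      have yr: "y k powr r = ((y k)\<^sup>2) powr (r / 2)"
      proof -
        have "(y k)\<^sup>2 = y k powr 2" using y[OF k] by (cases "y k = 0") (simp_all add: powr_numeral)
        then show ?thesis by (simp add: powr_powr)
      qed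
      show "y k powr r \<le> \<mu> powr (r / 2) + (y k)\<^sup>2 * \<mu> powr (r / 2 - 1)"
      proof (cases "(y k)\<^sup>2 \<le> \<mu>")
        case True
        then have "y k powr r \<le> \<mu> powr (r / 2)" unfolding yr using r by (intro powr_mono2) auto
        then show ?thesis by (simp add: add_increasing2)
      next
        case False
        then have pos: "0 < (y k)\<^sup>2" using \<mu> by linarith
        then have "y k powr r = (y k)\<^sup>2 * ((y k)\<^sup>2) powr (r / 2 - 1)"
          unfolding yr using \<mu> by (simp add: powr_diff)
        also have "\<dots> \<le> (y k)\<^sup>2 * \<mu> powr (r / 2 - 1)"
          using False r \<mu> by (intro mult_left_mono powr_mono2') auto
        finally show ?thesis by (simp add: add_increasing)
      qed
    qed
    also have "\<dots> = n * \<mu> powr (r / 2) + S * \<mu> powr (r / 2 - 1)"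
      by (simp add: sum.distrib n_def S_def sum_distrib_right)
    also have "S * \<mu> powr (r / 2 - 1) = n * \<mu> powr (r / 2)"
      using \<mu> n by (simp add: powr_diff) (simp add: \<mu>_def field_simps)
    also have "n * \<mu> powr (r / 2) + n * \<mu> powr (r / 2) = 2 * n powr (1 - r / 2) * S powr (r / 2)"
      using n S by (simp add: \<mu>_def powr_divide powr_diff)
    finally show ?thesis by (simp add: n_def S_def)
  qed
qed

text \<open>
  The average over signs of the sum of \<open>n\<close> terms is, up to constants, the integral of the square
  function to the power \<open>r\<close>. For \<open>r \<le> 2\<close> this power lies between half of \<open>n\<^bsup>r/2-1\<^esup>\<close> times the sum of the
  \<open>r\<close>-th powers and that sum, and the integral of the sum is of order \<open>n\<close>. In other words, \<open>L\<^sub>r\<close> has cotype \<open>2\<close>, and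
  type \<open>r\<close> in the sense of averages.
\<close>

lemma (in sequence_norm) type_cotype:
  fixes x :: "nat \<Rightarrow> 'a \<Rightarrow> 'k"
  assumes r: "0 < r" "r \<le> 2" and x: "\<And>n. x n \<in> Lfun M r" and c: "0 < c"
    and lower: "\<And>a. tail m a \<Longrightarrow> c * \<nu> a powr r \<le> Lpow M r (lincomb x a)"
    and upper: "\<And>a. tail m a \<Longrightarrow> Lpow M r (lincomb x a) \<le> C * \<nu> a powr r"
  shows "1 / 2 \<le> \<theta>" "\<theta> * r \<le> 1"
proof -
  obtain k where k: "0 < k" "\<And>F (v :: nat \<Rightarrow> 'k). finite F \<Longrightarrow>
      k * (\<Sum>k\<in>F. (norm (v k))\<^sup>2) powr (r / 2) \<le> sign_moment r v F"
    using khintchine_lower[OF r(1)] by blast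
  obtain K where K: "0 < K" "\<And>F (v :: nat \<Rightarrow> 'k). finite F \<Longrightarrow>
      sign_moment r v F \<le> K * (\<Sum>k\<in>F. (norm (v k))\<^sup>2) powr (r / 2)"
    using khintchine_upper[OF r(1)] by blast
  have term_bounds: "c \<le> (\<integral>w. norm (x j w) powr r \<partial>M)" "(\<integral>w. norm (x j w) powr r \<partial>M) \<le> C" if "m \<le> j" for j
  proof -
    have "tail m (\<lambda>n. if n = j then 1 else 0 :: 'k)"
      using that by (auto simp: tail_def intro: finite_subset[of _ "{j}"])
    from lower[OF this] upper[OF this] show "c \<le> (\<integral>w. norm (x j w) powr r \<partial>M)" "(\<integral>w. norm (x j w) powr r \<partial>M) \<le> C"
      by (simp_all add: unit lincomb_unit)
  qed
  have C: "0 < C" using c term_bounds[of m] by simp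
  define V where "V n = sign_avg {m..<m + n} (\<lambda>A. \<integral>w. norm (signed_sum (\<lambda>k. x k w) {m..<m + n} A) powr r \<partial>M)" for n
  have V_norm: "c * real n powr (\<theta> * r) \<le> V n" "V n \<le> C * real n powr (\<theta> * r)" if n: "1 \<le> n" for n
  proof -
    let ?F = "{m..<m + n}"
    have "c * real n powr (\<theta> * r) \<le> (\<integral>w. norm (signed_sum (\<lambda>k. x k w) ?F A) powr r \<partial>M)
        \<and> (\<integral>w. norm (signed_sum (\<lambda>k. x k w) ?F A) powr r \<partial>M) \<le> C * real n powr (\<theta> * r)" for A
    proof -
      have t: "tail m (\<lambda>n. if n \<in> ?F then if n \<in> A then - 1 else 1 else 0 :: 'k)"
        by (intro tail_signs) auto
      have "\<nu> (\<lambda>n. if n \<in> ?F then if n \<in> A then - 1 else 1 else 0) = real (card ?F) powr \<theta>"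
        using n by (intro norm_signs) auto
      then show ?thesis
        using lower[OF t] upper[OF t]
        by (simp only: lincomb_signs[OF finite_atLeastLessThan] powr_powr card_atLeastLessThan add_diff_cancel_left')
    qed
    then have "sign_avg ?F (\<lambda>_. c * real n powr (\<theta> * r)) \<le> V n \<and> V n \<le> sign_avg ?F (\<lambda>_. C * real n powr (\<theta> * r))"
      unfolding V_def by (intro conjI sign_avg_mono) auto
    then show "c * real n powr (\<theta> * r) \<le> V n" "V n \<le> C * real n powr (\<theta> * r)"
      by (simp_all add: sign_avg_const)
  qed
  have int_x: "integrable M (\<lambda>w. norm (x j w) powr r)" for j
    using x by (rule Lfun_integrable)
  have int_signed: "integrable M (\<lambda>w. norm (signed_sum (\<lambda>k. x k w) {m..<m + n} A) powr r)" for n A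
    using Lfun_integrable[OF Lfun_lincomb[OF r(1) x, where a = "\<lambda>k. if k \<in> {m..<m + n} then if k \<in> A then - 1 else 1 else 0"]]
    by (simp only: lincomb_signs[OF finite_atLeastLessThan])
  have V_int: "V n = (\<integral>w. sign_avg {m..<m + n} (\<lambda>A. norm (signed_sum (\<lambda>k. x k w) {m..<m + n} A) powr r) \<partial>M)"
    and int_avg: "integrable M (\<lambda>w. sign_avg {m..<m + n} (\<lambda>A. norm (signed_sum (\<lambda>k. x k w) {m..<m + n} A) powr r))" for n
    unfolding V_def sign_avg_def using int_signed by simp_all
  have V_upper: "V n \<le> (K * C) * real n" for n
  proof -
    let ?F = "{m..<m + n}"
    have "V n \<le> (\<integral>w. K * (\<Sum>j\<in>?F. norm (x j w) powr r) \<partial>M)"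
      unfolding V_int
    proof (intro integral_mono int_avg integrable_mult_right Bochner_Integration.integrable_sum int_x)
      fix w
      have "sign_moment r (\<lambda>k. x k w) ?F \<le> K * (\<Sum>j\<in>?F. (norm (x j w))\<^sup>2) powr (r / 2)"
        by (rule K) simp
      also have "\<dots> \<le> K * (\<Sum>j\<in>?F. norm (x j w) powr r)"
        using K r by (intro mult_left_mono powr_sum_squares_le_sum_powr) auto
      finally show "sign_moment r (\<lambda>k. x k w) ?F \<le> K * (\<Sum>j\<in>?F. norm (x j w) powr r)" .
    qed
    also have "\<dots> = K * (\<Sum>j\<in>?F. \<integral>w. norm (x j w) powr r \<partial>M)"
      using int_x by simp
    also have "\<dots> \<le> K * (\<Sum>j\<in>?F. C)"
      using K term_bounds by (intro mult_left_mono sum_mono) auto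
    finally show ?thesis by (simp add: mult_ac)
  qed
  have V_lower: "k * c / 2 * real n powr (r / 2) \<le> V n" if n: "1 \<le> n" for n
  proof -
    let ?F = "{m..<m + n}"
    define d where "d = k / (2 * real n powr (1 - r / 2))"
    have pos: "0 < real n powr (1 - r / 2)" using n by simp
    have d: "0 < d" using k pos by (simp add: d_def)
    have "d * (real n * c) = d * (\<Sum>j\<in>?F. c)" by simp
    also have "\<dots> \<le> d * (\<Sum>j\<in>?F. \<integral>w. norm (x j w) powr r \<partial>M)"
      using d term_bounds by (intro mult_left_mono sum_mono) auto
    also have "\<dots> = (\<integral>w. d * (\<Sum>j\<in>?F. norm (x j w) powr r) \<partial>M)"
      using int_x by simp
    also have "\<dots> \<le> V n"
      unfolding V_int
    proof (intro integral_mono int_avg integrable_mult_right Bochner_Integration.integrable_sum int_x)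
      fix w
      have "d * (\<Sum>j\<in>?F. norm (x j w) powr r)
          \<le> d * (2 * real (card ?F) powr (1 - r / 2) * (\<Sum>j\<in>?F. (norm (x j w))\<^sup>2) powr (r / 2))"
        using d r n by (intro mult_left_mono sum_powr_le_powr_sum_squares) auto
      also have "\<dots> = k * (\<Sum>j\<in>?F. (norm (x j w))\<^sup>2) powr (r / 2)"
        using pos by (simp add: d_def)
      also have "\<dots> \<le> sign_moment r (\<lambda>k. x k w) ?F"
        by (rule k) simp
      finally show "d * (\<Sum>j\<in>?F. norm (x j w) powr r) \<le> sign_moment r (\<lambda>k. x k w) ?F" .
    qed
    also have "d * (real n * c) = k * c / 2 * real n powr (r / 2)"
      using n by (simp add: d_def powr_diff)
    finally show ?thesis .
  qed
  show "\<theta> * r \<le> 1"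
  proof (rule powr_growth_le)
    fix n :: nat assume "1 \<le> n"
    then show "real n powr (\<theta> * r) \<le> K * C / c * real n powr 1"
      using order_trans[OF V_norm(1) V_upper, of n] c by (simp add: field_simps)
  qed
  have "r / 2 \<le> \<theta> * r"
  proof (rule powr_growth_le)
    fix n :: nat assume "1 \<le> n"
    then have "k * c / 2 * real n powr (r / 2) \<le> C * real n powr (\<theta> * r)"
      using order_trans[OF V_lower V_norm(2)] by blast
    then show "real n powr (r / 2) \<le> 2 * C / (k * c) * real n powr (\<theta> * r)"
      using c k(1) by (simp add: field_simps)
  qed
  then show "1 / 2 \<le> \<theta>" using r by (simp add: field_simps)
qed

text \<open>
  Absolute continuity of the integral: the part of \<open>g\<close> above a high level has a small integral.
\<close>

lemma integral_small_on_small_sets: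
  fixes g :: "'a \<Rightarrow> real"
  assumes M: "finite_measure M" and g: "integrable M g" "\<And>w. 0 \<le> g w" and \<epsilon>: "0 < \<epsilon>"
  obtains \<delta> where "0 < \<delta>"
    "\<And>A. \<lbrakk>A \<in> sets M; measure M A < \<delta>\<rbrakk> \<Longrightarrow> (\<integral>w. g w * indicator A w \<partial>M) < \<epsilon>"
proof -
  interpret finite_measure M by fact
  have [measurable]: "g \<in> borel_measurable M" using g by simp
  define t where "t n w = (if real n < g w then g w else 0)" for n w
  have t_int: "integrable M (t n)" for n
    by (rule Bochner_Integration.integrable_bound[OF g(1)]) (auto simp: t_def[abs_def] g(2))
  have "(\<lambda>n. \<integral>w. t n w \<partial>M) \<longlonglongrightarrow> (\<integral>w. 0 \<partial>M)"
  proof (rule integral_dominated_convergence[where w = g])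
    show "AE w in M. (\<lambda>n. t n w) \<longlonglongrightarrow> 0"
    proof (intro always_eventually allI)
      fix w
      obtain k where "g w \<le> real k" using real_arch_simple by blast
      then have "\<forall>\<^sub>F n in sequentially. t n w = 0"
        by (intro eventually_sequentiallyI[of k]) (auto simp: t_def)
      then show "(\<lambda>n. t n w) \<longlonglongrightarrow> 0" by (rule tendsto_eventually)
    qed
  qed (use g in \<open>auto simp: t_def[abs_def]\<close>)
  then have "\<forall>\<^sub>F n in sequentially. (\<integral>w. t n w \<partial>M) < \<epsilon> / 2"
    using \<epsilon> by (intro order_tendstoD) auto
  then obtain n where n: "(\<integral>w. t n w \<partial>M) < \<epsilon> / 2"
    by (auto simp: eventually_sequentially)
  define \<delta> where "\<delta> = \<epsilon> / (2 * (real n + 1))"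
  show ?thesis
  proof (rule that)
    show "0 < \<delta>" using \<epsilon> by (simp add: \<delta>_def)
    fix A assume A: "A \<in> sets M" "measure M A < \<delta>"
    have i: "integrable M (\<lambda>w. real n * indicator A w)" using A by (intro integrable_mult_right) (auto simp: emeasure_finite less_top[symmetric])
    have "(\<integral>w. g w * indicator A w \<partial>M) \<le> (\<integral>w. t n w + real n * indicator A w \<partial>M)"
    proof (rule integral_mono)
      show "integrable M (\<lambda>w. g w * indicator A w)"
        using integrable_mult_indicator[OF A(1) g(1)] by (simp add: mult.commute)
      show "integrable M (\<lambda>w. t n w + real n * indicator A w)" by (intro Bochner_Integration.integrable_add t_int i)
      show "g w * indicator A w \<le> t n w + real n * indicator A w" for w
        using g(2)[of w] by (auto simp: t_def indicator_def)
    qed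
    also have "\<dots> = (\<integral>w. t n w \<partial>M) + real n * measure M A"
      using A(1) t_int i by (simp add: Int_absorb1 sets.sets_into_space)
    also have "real n * measure M A \<le> \<epsilon> / 2"
    proof -
      have "real n * measure M A \<le> (real n + 1) * \<delta>"
        using A(2) by (intro mult_mono) auto
      also have "\<dots> = \<epsilon> / 2" by (simp add: \<delta>_def field_simps)
      finally show ?thesis .
    qed
    finally show "(\<integral>w. g w * indicator A w \<partial>M) < \<epsilon>" using n by simp
  qed
qed

lemma lincomb_powr_add:
  fixes \<eta> r :: real
  assumes "0 < \<eta>" "0 < r"
  obtains K where "0 < K"
    "\<And>(x :: nat \<Rightarrow> 'a \<Rightarrow> 'k::real_normed_field) m (a :: nat \<Rightarrow> 'k) (b :: nat \<Rightarrow> 'k) w. \<lbrakk>tail m a; tail m b\<rbrakk> \<Longrightarrow> norm (lincomb x (\<lambda>n. a n + b n) w) powr r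
      \<le> (1 + \<eta>) * norm (lincomb x a w) powr r + K * norm (lincomb x b w) powr r"
proof -
  obtain K where K: "0 < K" "\<And>x y. \<lbrakk>0 \<le> x; 0 \<le> y\<rbrakk> \<Longrightarrow> (x + y) powr r \<le> (1 + \<eta>) * x powr r + K * y powr r"
    using powr_add_le_eta[OF assms] by blast
  show ?thesis
  proof (rule that[OF K(1)])
    fix x :: "nat \<Rightarrow> 'a \<Rightarrow> 'k" and m and a b :: "nat \<Rightarrow> 'k" and w
    assume "tail m a" "tail m b"
    then have "norm (lincomb x (\<lambda>n. a n + b n) w) powr r \<le> (norm (lincomb x a w) + norm (lincomb x b w)) powr r"
      using assms by (intro powr_mono2) (auto simp: lincomb_add norm_triangle_ineq)
    also have "\<dots> \<le> (1 + \<eta>) * norm (lincomb x a w) powr r + K * norm (lincomb x b w) powr r"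
      by (intro K) auto
    finally show "norm (lincomb x (\<lambda>n. a n + b n) w) powr r
      \<le> (1 + \<eta>) * norm (lincomb x a w) powr r + K * norm (lincomb x b w) powr r" .
  qed
qed

text \<open>
  If no hump can be found, then a unit vector cannot have most of its norm on the small set where its
  image exceeds a certain level \<open>\<Lambda>\<close>. Below this level the \<open>r\<close>-th power is at most \<open>\<Lambda>\<^bsup>r-2\<^esup>\<close> times the square,
  so the norm of \<open>L\<^sub>2\<close> is bounded from below as well.
\<close>

lemma (in sequence_norm) kadec_pelczynski:
  fixes x :: "nat \<Rightarrow> 'a \<Rightarrow> 'k"
  assumes M: "finite_measure M" and r: "2 \<le> r" and x: "\<And>n. x n \<in> Lfun M r" and c: "0 < c"
    and lower: "\<And>a. tail m0 a \<Longrightarrow> c * \<nu> a powr r \<le> Lpow M r (lincomb x a)"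
    and upper: "\<And>a. tail m0 a \<Longrightarrow> Lpow M r (lincomb x a) \<le> C * \<nu> a powr r"
  shows "\<theta> * r = 1 \<or> \<theta> = 1 / 2"
proof -
  interpret finite_measure M by fact
  have r0: "0 < r" using r by simp
  define G where "G a w = norm (lincomb x a w) powr r" for a w
  have G_int: "integrable M (G a)" for a
    unfolding G_def[abs_def] by (intro Lfun_integrable Lfun_lincomb r0 x)
  have [measurable]: "lincomb x a \<in> borel_measurable M" for a
    by (intro Lfun_measurable[of _ _ r] Lfun_lincomb r0 x)
  let ?hump = "\<forall>f \<epsilon> m. tail m0 f \<longrightarrow> 0 < \<epsilon> \<longrightarrow> (\<exists>a A. tail (max m m0) a \<and> \<nu> a = 1 \<and> A \<in> sets M
      \<and> (\<integral>w. G f w * indicator A w \<partial>M) < \<epsilon> \<and> (\<integral>w. G a w * indicator (- A) w \<partial>M) < \<epsilon>)"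
  show ?thesis
  proof (cases ?hump)
    case True
    have "\<theta> * r = 1"
    proof (rule gliding_hump[where G = G and M = M and c = c and C = C and ?m0.0 = m0])
      show "\<exists>K>0. \<forall>a b w. tail m0 a \<longrightarrow> tail m0 b \<longrightarrow> G (\<lambda>n. a n + b n) w \<le> (1 + \<eta>) * G a w + K * G b w"
        if "0 < \<eta>" for \<eta>
        using lincomb_powr_add[OF that r0, where ?'a = 'a and ?'k = 'k] unfolding G_def by metis
    qed (use True c lower upper G_int in \<open>auto simp: G_def lincomb_minus\<close>)
    then show ?thesis ..
  next
    case False
    then obtain f \<epsilon> m where f: "tail m0 f" and \<epsilon>: "0 < \<epsilon>"
      and no_hump: "\<not> (\<exists>a A. tail (max m m0) a \<and> \<nu> a = 1 \<and> A \<in> sets M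
        \<and> (\<integral>w. G f w * indicator A w \<partial>M) < \<epsilon> \<and> (\<integral>w. G a w * indicator (- A) w \<partial>M) < \<epsilon>)"
      by blast
    have no: "\<epsilon> \<le> (\<integral>w. G a w * indicator (- A) w \<partial>M)"
      if "tail (max m m0) a" "\<nu> a = 1" "A \<in> sets M" "(\<integral>w. G f w * indicator A w \<partial>M) < \<epsilon>" for a A
      using no_hump that not_less by blast
    obtain \<delta> where \<delta>: "0 < \<delta>"
      "\<And>A. \<lbrakk>A \<in> sets M; measure M A < \<delta>\<rbrakk> \<Longrightarrow> (\<integral>w. G f w * indicator A w \<partial>M) < \<epsilon>"
      using integral_small_on_small_sets[OF M G_int _ \<epsilon>, of f] by (auto simp: G_def)
    have e_tail: "tail m0 (\<lambda>n. if n = m0 then 1 else 0 :: 'k)"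
      by (auto simp: tail_def intro: finite_subset[of _ "{m0}"])
    have C: "0 < C" using c order_trans[OF lower[OF e_tail] upper[OF e_tail]] by (simp add: unit)
    \<comment> \<open>by Markov's inequality the image of a unit vector exceeds \<open>\<Lambda>\<close> on a set of measure less than \<open>\<delta>\<close>\<close>
    define \<Lambda> where "\<Lambda> = (C / \<delta> + 1) powr (1 / r)"
    have C\<delta>: "0 < C / \<delta> + 1" using C \<delta> by (simp add: add_pos_pos)
    have \<Lambda>: "0 < \<Lambda>" using C\<delta> by (simp add: \<Lambda>_def)
    have \<Lambda>r: "\<Lambda> powr r = C / \<delta> + 1" using r0 C\<delta> by (simp add: \<Lambda>_def powr_powr)
    have sq_le: "norm y powr 2 \<le> 1 + norm y powr r" for y :: 'k
    proof (cases "norm y \<le> 1")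
      case True
      then have "norm y powr 2 \<le> 1" by (simp add: power_le_one)
      then show ?thesis by (simp add: add_increasing2)
    next
      case False
      then have "norm y powr 2 \<le> norm y powr r" using r by (intro powr_mono) auto
      then show ?thesis by simp
    qed
    have x2: "x n \<in> Lfun M 2" for n
    proof -
      have [measurable]: "x n \<in> borel_measurable M" using x by (rule Lfun_measurable)
      have "integrable M (\<lambda>w. 1 + norm (x n w) powr r)" using Lfun_integrable[OF x] by simp
      then have "integrable M (\<lambda>w. norm (x n w) powr 2)"
        by (rule Bochner_Integration.integrable_bound) (use sq_le in \<open>auto simp: abs_of_nonneg add_nonneg_nonneg\<close>)
      then show ?thesis by (simp add: Lfun_def)
    qed
    have int2: "integrable M (\<lambda>w. norm (lincomb x a w) powr 2)" for a
      by (intro Lfun_integrable Lfun_lincomb x2) simp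
    let ?m = "max m m0"
    have low1: "\<epsilon> * \<Lambda> powr (2 - r) \<le> Lpow M 2 (lincomb x a)" if a: "tail ?m a" "\<nu> a = 1" for a
    proof -
      define A where "A = {w \<in> space M. \<Lambda> < norm (lincomb x a w)}"
      have A: "A \<in> sets M" unfolding A_def by measurable
      have a0: "tail m0 a" using a(1) by (rule tail_mono) simp
      have "\<Lambda> powr r * measure M A = (\<integral>w. \<Lambda> powr r * indicator A w \<partial>M)"
        using A by (simp add: Int_absorb1 sets.sets_into_space)
      also have "\<dots> \<le> (\<integral>w. G a w \<partial>M)"
      proof (rule integral_mono)
        show "integrable M (\<lambda>w. \<Lambda> powr r * indicator A w)"
          using A by (intro integrable_mult_right) (auto simp: emeasure_finite less_top[symmetric])
        show "\<Lambda> powr r * indicator A w \<le> G a w" for w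
          using \<Lambda> r0 by (auto simp: A_def G_def indicator_def intro!: powr_mono2)
      qed (rule G_int)
      also have "\<dots> \<le> C" using upper[OF a0] a(2) by (simp add: G_def)
      finally have "(C / \<delta> + 1) * measure M A \<le> C" by (simp only: \<Lambda>r)
      then have "measure M A * (C + \<delta>) \<le> C * \<delta>" using \<delta>(1) by (simp add: field_simps)
      also have "\<dots> < \<delta> * (C + \<delta>)" using \<delta>(1) by (simp add: algebra_simps)
      finally have "measure M A < \<delta>" using C \<delta>(1) by simp
      then have "\<epsilon> \<le> (\<integral>w. G a w * indicator (- A) w \<partial>M)" by (intro no a A \<delta>)
      also have "\<dots> \<le> (\<integral>w. \<Lambda> powr (r - 2) * norm (lincomb x a w) powr 2 \<partial>M)"
      proof (rule integral_mono_AE')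
        show "AE w in M. G a w * indicator (- A) w \<le> \<Lambda> powr (r - 2) * norm (lincomb x a w) powr 2"
        proof (rule AE_I2)
          fix w assume w: "w \<in> space M"
          show "G a w * indicator (- A) w \<le> \<Lambda> powr (r - 2) * norm (lincomb x a w) powr 2"
          proof (cases "w \<in> A")
            case False
            then have le: "norm (lincomb x a w) \<le> \<Lambda>" using w by (simp add: A_def)
            have "G a w = norm (lincomb x a w) powr (r - 2) * norm (lincomb x a w) powr 2"
              by (simp only: G_def flip: powr_add) simp
            also have "\<dots> \<le> \<Lambda> powr (r - 2) * norm (lincomb x a w) powr 2"
              using r le by (intro mult_right_mono powr_mono2) auto
            finally show ?thesis using False by simp
          qed simp
        qed
        show "AE w in M. 0 \<le> \<Lambda> powr (r - 2) * norm (lincomb x a w) powr 2" by simp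
      qed (use int2 in auto)
      also have "\<dots> = \<Lambda> powr (r - 2) * Lpow M 2 (lincomb x a)" using int2 by simp
      finally have "\<epsilon> * \<Lambda> powr (2 - r) \<le> \<Lambda> powr (r - 2) * Lpow M 2 (lincomb x a) * \<Lambda> powr (2 - r)"
        by (intro mult_right_mono) auto
      also have "\<dots> = (\<Lambda> powr (r - 2) * \<Lambda> powr (2 - r)) * Lpow M 2 (lincomb x a)"
        by (simp add: mult_ac)
      also have "\<Lambda> powr (r - 2) * \<Lambda> powr (2 - r) = 1" using \<Lambda> by (simp flip: powr_add)
      finally show ?thesis by simp
    qed
    have up1: "Lpow M 2 (lincomb x a) \<le> measure M (space M) + C" if a: "tail ?m a" "\<nu> a = 1" for a
    proof -
      have a0: "tail m0 a" using a(1) by (rule tail_mono) simp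
      have "Lpow M 2 (lincomb x a) \<le> (\<integral>w. 1 + G a w \<partial>M)"
      proof (rule integral_mono[OF int2])
        show "integrable M (\<lambda>w. 1 + G a w)" using G_int[of a] by simp
        show "norm (lincomb x a w) powr 2 \<le> 1 + G a w" for w unfolding G_def by (rule sq_le)
      qed
      also have "\<dots> = measure M (space M) + (\<integral>w. G a w \<partial>M)" using G_int[of a] by simp
      also have "\<dots> \<le> measure M (space M) + C"
        using upper[OF a0] a(2) by (simp add: G_def)
      finally show ?thesis .
    qed
    have both: "(\<epsilon> * \<Lambda> powr (2 - r)) * \<nu> a powr 2 \<le> Lpow M 2 (lincomb x a)
        \<and> Lpow M 2 (lincomb x a) \<le> (measure M (space M) + C) * \<nu> a powr 2" if a: "tail ?m a" for a
    proof -
      have a0: "tail 0 a" using a by (rule tail_mono) simp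
      show ?thesis
      proof (cases "\<nu> a = 0")
        case True
        then have "a = (\<lambda>_. 0)" using definite[OF a0] by simp
        then have "lincomb x a w = 0" for w by (simp add: lincomb_def)
        then show ?thesis using True by simp
      next
        case False
        let ?t = "of_real (1 / \<nu> a) :: 'k"
        have pos: "0 < \<nu> a" using nonneg[OF a0] False by simp
        have eq: "Lpow M 2 (lincomb x (\<lambda>n. ?t * a n)) = Lpow M 2 (lincomb x a) / \<nu> a powr 2"
          using pos unfolding lincomb_mult[OF a] norm_mult by (simp add: powr_mult powr_divide norm_divide)
        have "0 < \<nu> a powr 2" using pos by simp
        then show ?thesis
          using low1[OF tail_mult[OF a] normalise[OF a0 False]] up1[OF tail_mult[OF a] normalise[OF a0 False]]
          unfolding eq by (simp only: pos_le_divide_eq pos_divide_le_eq simp_thms)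
      qed
    qed
    have "\<theta> * 2 \<le> 1" "1 / 2 \<le> \<theta>"
      using type_cotype[where x = x and M = M and r = 2 and m = ?m and c = "\<epsilon> * \<Lambda> powr (2 - r)"
          and C = "measure M (space M) + C"] x2 both \<epsilon> \<Lambda> by auto
    then show ?thesis by simp
  qed
qed

section \<open>The exponents\<close>

definition reciprocal :: "ereal \<Rightarrow> real" where
  "reciprocal p = (if p = \<infinity> then 0 else 1 / real_of_ereal p)"

lemma tail_summable:
  fixes a :: "nat \<Rightarrow> 'k::real_normed_field"
  assumes "tail m a"
  shows "summable (\<lambda>n. norm (a n) powr p)"
  using assms by (intro summable_finite[of "{n. a n \<noteq> 0}"]) (auto simp: tail_def)

lemma ell_tail:
  fixes a b :: "nat \<Rightarrow> 'k::real_normed_field"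
  assumes p: "0 < p"
  shows "tail m a \<Longrightarrow> a \<in> qcarrier (ell p)"
    "vadd (ell p) a b = (\<lambda>n. a n + b n)" "vscale (ell p) c a = (\<lambda>n. c * a n)"
proof -
  show "a \<in> qcarrier (ell p)" if a: "tail m a"
  proof (cases "p = \<infinity>")
    case True
    obtain N where "\<forall>n. a n \<noteq> 0 \<longrightarrow> n < N"
      using a finite_nat_set_iff_bounded[of "{n. a n \<noteq> 0}"] by (auto simp: tail_def)
    then have "\<And>n. N \<le> n \<Longrightarrow> a n = 0" using not_le by blast
    then have "\<forall>\<^sub>F n in sequentially. a n = 0" by (intro eventually_sequentiallyI[of N])
    then have "a \<longlonglongrightarrow> 0" by (rule tendsto_eventually)
    then show ?thesis using True by (simp add: ell_def c_zero_def)
  next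
    case False
    then show ?thesis using tail_summable[OF a] by (simp add: ell_def ell_sum_def scalars_def)
  qed
  show "vadd (ell p) a b = (\<lambda>n. a n + b n)" "vscale (ell p) c a = (\<lambda>n. c * a n)"
    by (auto simp: ell_def ell_sum_def scalars_def c_zero_def)
qed

lemma quasi_normed_ell_ereal:
  assumes "0 < p"
  obtains K where "quasi_normed (ell p :: ('k::real_normed_field, _) qspace) (\<lambda>_. 0) K"
proof (cases "p = \<infinity>")
  case True
  then show ?thesis using that quasi_normed_c_zero by (simp add: ell_def)
next
  case False
  then obtain q where "p = ereal q" "0 < q" using assms by (cases p) auto
  then show ?thesis using that quasi_normed_ell by blast
qed

lemma sequence_norm_ell:
  assumes p: "0 < p"
  shows "sequence_norm (qnorm (ell p :: ('k::{real_normed_field, euclidean_space}, _) qspace)) (reciprocal p)"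
proof -
  let ?E = "ell p :: ('k, _) qspace"
  obtain K where "quasi_normed ?E (\<lambda>_. 0) K"
    using quasi_normed_ell_ereal[OF p] by blast
  then interpret E: quasi_normed ?E "\<lambda>_. 0" K .
  note E = ell_tail[OF p, where ?'k = 'k]
  show ?thesis
  proof
    fix a :: "nat \<Rightarrow> 'k" assume a: "tail 0 a"
    show "qnorm ?E (\<lambda>n. c * a n) = norm c * qnorm ?E a" for c
      using E.norm_scale[OF E(1)[OF a], of c] by (simp add: E)
    show "0 \<le> qnorm ?E a" by (intro E.norm_nonneg E(1)[OF a])
    show "a = (\<lambda>_. 0)" if "qnorm ?E a = 0" by (intro E.norm_zeroD E(1)[OF a] that)
  next
    fix k :: nat
    show "qnorm ?E (\<lambda>n. if n = k then 1 else 0) = 1"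
    proof (cases "p = \<infinity>")
      case True
      have "(SUP n. norm (if n = k then 1 else 0 :: 'k)) = 1"
      proof (rule antisym)
        show "(SUP n. norm (if n = k then 1 else 0 :: 'k)) \<le> 1"
          by (intro cSUP_least) auto
        have "norm (if k = k then 1 else 0 :: 'k) \<le> (SUP n. norm (if n = k then 1 else 0 :: 'k))"
          by (intro cSUP_upper bdd_aboveI2[of _ _ 1]) auto
        then show "1 \<le> (SUP n. norm (if n = k then 1 else 0 :: 'k))" by simp
      qed
      then show ?thesis using True by (simp add: ell_def c_zero_def)
    next
      case False
      have "(\<Sum>n. norm (if n = k then 1 else 0 :: 'k) powr real_of_ereal p)
          = (\<Sum>n\<in>{k}. norm (if n = k then 1 else 0 :: 'k) powr real_of_ereal p)"
        by (intro suminf_finite) auto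
      then show ?thesis using False by (simp add: ell_def ell_sum_def scalars_def)
    qed
  next
    fix a b :: "nat \<Rightarrow> 'k" and j :: nat
    assume a: "tail 0 a" and b: "tail 0 b" and disj: "\<And>n. a n = 0 \<or> b n = 0"
      and na: "qnorm ?E a = real j powr reciprocal p" and j: "1 \<le> j" and nb: "qnorm ?E b = 1"
    show "qnorm ?E (\<lambda>n. a n + b n) = real (Suc j) powr reciprocal p"
    proof (cases "p = \<infinity>")
      case True
      have bdd: "bdd_above (range (\<lambda>n. norm (h n)))" if "tail 0 h" for h :: "nat \<Rightarrow> 'k"
      proof -
        have "h \<longlonglongrightarrow> 0" using E(1)[OF that] True by (simp add: ell_def c_zero_def)
        from convergent_imp_Bseq[OF convergentI[OF this]] show ?thesis
          by (auto simp: Bseq_def bdd_above_def)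
      qed
      have sup: "(SUP n. norm (a n)) = 1" "(SUP n. norm (b n)) = 1"
        using na nb j True by (simp_all add: ell_def c_zero_def reciprocal_def)
      have "(SUP n. norm (a n + b n)) = 1"
      proof (rule antisym)
        show "(SUP n. norm (a n + b n)) \<le> 1"
        proof (rule cSUP_least)
          fix n
          show "norm (a n + b n) \<le> 1"
            using disj[of n] cSUP_upper[OF UNIV_I bdd[OF a], of n] cSUP_upper[OF UNIV_I bdd[OF b], of n]
            by (auto simp: sup)
        qed simp
        have "(SUP n. norm (a n)) \<le> (SUP n. norm (a n + b n))"
        proof (rule cSUP_mono)
          show "bdd_above (range (\<lambda>n. norm (a n + b n)))" by (intro bdd tail_add a b)
          show "\<exists>m\<in>UNIV. norm (a n) \<le> norm (a m + b m)" for n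
            using disj[of n] by (intro bexI[of _ n]) auto
        qed simp
        then show "1 \<le> (SUP n. norm (a n + b n))" by (simp add: sup)
      qed
      then show ?thesis using True by (simp add: ell_def c_zero_def reciprocal_def)
    next
      case False
      then obtain q where q: "p = ereal q" "0 < q" using p by (cases p) auto
      have nrm: "qnorm ?E h = (\<Sum>n. norm (h n) powr q) powr (1 / q)" for h
        by (simp add: q ell_carrier)
      have nonneg: "0 \<le> (\<Sum>n. norm (h n) powr q)" if "tail 0 h" for h :: "nat \<Rightarrow> 'k"
        by (intro suminf_nonneg tail_summable[OF that]) auto
      have "(\<Sum>n. norm (a n) powr q) = qnorm ?E a powr q" "(\<Sum>n. norm (b n) powr q) = qnorm ?E b powr q"
        using nonneg[OF a] nonneg[OF b] q(2) by (simp_all add: nrm powr_powr)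
      then have sa: "(\<Sum>n. norm (a n) powr q) = j" and sb: "(\<Sum>n. norm (b n) powr q) = 1"
        using q na nb by (simp_all add: reciprocal_def powr_powr)
      have "norm (a n + b n) powr q = norm (a n) powr q + norm (b n) powr q" for n
        using disj[of n] q(2) by auto
      then have "(\<Sum>n. norm (a n + b n) powr q) = real j + 1"
        using suminf_add[OF tail_summable[OF a] tail_summable[OF b], of q q] sa sb by simp
      then show ?thesis unfolding nrm using q by (simp add: reciprocal_def add.commute)
    qed
  qed
qed

text \<open>
  On finitely supported sequences the map is given by representatives of the images of the unit vectors.
\<close>

lemma linear_image_lincomb:
  fixes x :: "nat \<Rightarrow> nat \<Rightarrow> 'a \<Rightarrow> 'k::{real_normed_field, second_countable_topology}"
    and T :: "(nat \<Rightarrow> 'k) \<Rightarrow> nat \<Rightarrow> ('a \<Rightarrow> 'k) set"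
  assumes r: "0 < r" and s: "0 < s" and p: "0 < p"
    and T: "qlinear (ell p) (ell_sum s (Lspace M r)) T"
    and x: "\<And>n i. x n i \<in> Lfun M r"
    and Tx: "\<And>n i. T (\<lambda>j. if j = n then 1 else 0) i = ae_rel M r `` {x n i}"
    and a: "tail 0 a"
  shows "T a i = ae_rel M r `` {lincomb (\<lambda>n. x n i) a}"
proof -
  let ?E = "ell p :: ('k, _) qspace"
  let ?L = "Lspace M r :: ('k, _) qspace"
  let ?Y = "ell_sum s ?L"
  obtain K where "quasi_normed ?E (\<lambda>_. 0) K"
    using quasi_normed_ell_ereal[OF p] by blast
  then interpret P: quasi_normed_pair ?E "\<lambda>_. 0" K ?Y "\<lambda>_. ae_rel M r `` {\<lambda>_. 0}"
    "2 * (2 * 2 powr (1 / r)) * 2 powr (1 / s)"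
    by (intro quasi_normed_pair.intro quasi_normed_ell_sum quasi_normed_Lspace r s)
  note E = ell_tail[OF p, where ?'k = 'k]
  have restricted: "T (\<lambda>j. if j \<in> F then a j else 0) i = ae_rel M r `` {\<lambda>w. \<Sum>n\<in>F. a n * x n i w}"
    if "finite F" for F
    using that
  proof induction
    case empty
    then show ?case using P.qlinear_zero[OF T] by simp
  next
    case (insert k F)
    let ?e = "\<lambda>j. if j = k then 1 else 0 :: 'k" and ?f = "\<lambda>j. if j \<in> F then a j else 0"
    have e: "tail 0 ?e" by (auto simp: tail_def intro: finite_subset[of _ "{k}"])
    have f: "tail 0 ?f" using insert(1) by (auto simp: tail_def intro: finite_subset[of _ F])
    have eE: "?e \<in> qcarrier ?E" "?f \<in> qcarrier ?E" using E(1)[OF e] E(1)[OF f] by auto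
    have "(\<lambda>j. if j \<in> insert k F then a j else 0) = vadd ?E (vscale ?E (a k) ?e) ?f"
      using insert(2) by (auto simp: E)
    then have "T (\<lambda>j. if j \<in> insert k F then a j else 0) = vadd ?Y (vscale ?Y (a k) (T ?e)) (T ?f)"
      using T eE P.X.scale_in[OF eE(1), of "a k"] unfolding qlinear_def by simp
    then have "T (\<lambda>j. if j \<in> insert k F then a j else 0) i
        = vadd ?L (vscale ?L (a k) (T ?e i)) (T ?f i)"
      by (simp add: ell_sum_def)
    also have "\<dots> = ae_rel M r `` {\<lambda>w. a k * x k i w + (\<Sum>n\<in>F. a n * x n i w)}"
      unfolding Tx insert.IH vscale_Lspace[OF x]
      by (intro vadd_Lspace r Lfun_scale x Lfun_sum)
    finally show ?case using insert(1,2) by simp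
  qed
  have "(\<lambda>j. if j \<in> {n. a n \<noteq> 0} then a j else 0) = a" by auto
  then show ?thesis
    using restricted[of "{n. a n \<noteq> 0}"] a by (simp add: tail_def lincomb_def[abs_def])
qed

text \<open>
  The gliding hump is applied to the coordinates of \<open>\<ell>\<^sub>s(L\<^sub>r)\<close>, that is, to the counting measure. If it
  fails, the first \<open>N\<close> coordinates together form \<open>L\<^sub>r\<close> of the product of a finite set with the unit
  interval, where the norm with exponent \<open>s\<close> across the coordinates is equivalent to that with
  exponent \<open>r\<close>.
\<close>

lemma exponents_of_embedded_ell:
  fixes r s :: real and p :: ereal
  assumes r: "0 < r" and s: "0 < s" and p: "0 < p"
    and emb: "qembeds (ell p) (ell_sum s (L_unit r :: ('k::{real_normed_field, euclidean_space}, _) qspace))"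
  defines "\<theta> \<equiv> reciprocal p"
  shows "\<theta> * s = 1 \<or> (r \<le> 2 \<and> 1 / 2 \<le> \<theta> \<and> \<theta> * r \<le> 1) \<or> (2 \<le> r \<and> (\<theta> * r = 1 \<or> \<theta> = 1 / 2))"
proof -
  let ?U = "lebesgue_on {0..1::real}"
  let ?E = "ell p :: ('k, _) qspace"
  let ?L = "L_unit r :: ('k, _) qspace"
  let ?Y = "ell_sum s ?L"
  obtain K where "quasi_normed ?E (\<lambda>_. 0) K"
    using quasi_normed_ell_ereal[OF p] by blast
  then interpret P: quasi_normed_pair ?E "\<lambda>_. 0" K ?Y "\<lambda>_. ae_rel ?U r `` {\<lambda>_. 0}"
    "2 * (2 * 2 powr (1 / r)) * 2 powr (1 / s)"
    by (intro quasi_normed_pair.intro quasi_normed_ell_sum quasi_normed_Lspace r s)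
  interpret N: sequence_norm "qnorm ?E" \<theta>
    unfolding \<theta>_def by (rule sequence_norm_ell[OF p])
  note E = ell_tail[OF p, where ?'k = 'k]
  obtain T c C where T: "qlinear ?E ?Y T" and c: "0 < c" "0 < C"
    and T_lower: "\<And>a. a \<in> qcarrier ?E \<Longrightarrow> c * qnorm ?E a \<le> qnorm ?Y (T a)"
    and T_upper: "\<And>a. a \<in> qcarrier ?E \<Longrightarrow> qnorm ?Y (T a) \<le> C * qnorm ?E a"
    using P.qembeds_bounds[OF emb] by blast
  have TY: "T a \<in> qcarrier ?Y" if "a \<in> qcarrier ?E" for a
    using T that unfolding qlinear_def by blast
  have e_tail: "tail 0 (\<lambda>j. if j = n then 1 else 0 :: 'k)" for n
    by (auto simp: tail_def intro: finite_subset[of _ "{n}"])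
  have "\<exists>f. f \<in> Lfun ?U r \<and> T (\<lambda>j. if j = n then 1 else 0) i = ae_rel ?U r `` {f}" for n i
  proof -
    have "T (\<lambda>j. if j = n then 1 else 0) i \<in> qcarrier ?L"
      using TY[OF E(1)[OF e_tail[of n]]] by (simp add: ell_sum_def)
    then show ?thesis by (elim Lspace_carrierE) blast
  qed
  then obtain x where x: "\<And>n i. x n i \<in> Lfun ?U r"
    and Tx: "\<And>n i. T (\<lambda>j. if j = n then 1 else 0) i = ae_rel ?U r `` {x n i}"
    by metis
  define I where "I a i = Lpow ?U r (lincomb (\<lambda>n. x n i) a)" for a i
  have I_nonneg: "0 \<le> I a i" for a i by (simp add: I_def)
  define G where "G a i = I a i powr (s / r)" for a i
  have T_coord: "qnorm ?L (T a i) powr s = G a i" if "tail 0 a" for a i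
    unfolding linear_image_lincomb[OF r s p T x Tx that] using r
    by (simp add: qnorm_Lspace[OF Lfun_lincomb[OF r x]] powr_powr I_def G_def)
  have G_summable: "summable (G a)" if "tail 0 a" for a
  proof -
    have "summable (\<lambda>i. qnorm ?L (T a i) powr s)"
      using TY[OF E(1)[OF that]] by (simp add: ell_sum_def)
    then show ?thesis by (simp only: T_coord[OF that])
  qed
  have G_nonneg: "0 \<le> G a i" for a i by (simp add: G_def)
  have T_norm: "qnorm ?Y (T a) powr s = suminf (G a)" if a: "tail 0 a" for a
  proof -
    have "qnorm ?Y (T a) = suminf (G a) powr (1 / s)"
      by (simp add: ell_sum_def T_coord[OF a])
    then show ?thesis
      using s suminf_nonneg[OF G_summable[OF a] G_nonneg] by (simp add: powr_powr)
  qed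
  have G_lower: "c powr s * qnorm ?E a powr s \<le> suminf (G a)" if a: "tail 0 a" for a
  proof -
    have "(c * qnorm ?E a) powr s \<le> qnorm ?Y (T a) powr s"
      using s c N.nonneg[OF a] by (intro powr_mono2 T_lower E(1)[OF a]) auto
    then show ?thesis using c N.nonneg[OF a] by (simp add: T_norm[OF a] powr_mult)
  qed
  have G_upper: "suminf (G a) \<le> C powr s * qnorm ?E a powr s" if a: "tail 0 a" for a
  proof -
    have "qnorm ?Y (T a) powr s \<le> (C * qnorm ?E a) powr s"
      using s by (intro powr_mono2 T_upper E(1)[OF a] P.Y.norm_nonneg TY) auto
    then show ?thesis using c N.nonneg[OF a] by (simp add: T_norm[OF a] powr_mult)
  qed
  have cs: "0 < c powr s" using c by simp
  have count_int: "integrable (count_space UNIV) (G a)" "(\<integral>i. G a i \<partial>count_space UNIV) = suminf (G a)" if "tail 0 a" for a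
    using G_summable[OF that] G_nonneg
    by (auto simp: integrable_count_space_nat_iff integral_count_space_nat)
  let ?hump = "\<forall>f \<epsilon> m. tail 0 f \<longrightarrow> 0 < \<epsilon> \<longrightarrow> (\<exists>a A. tail (max m 0) a \<and> qnorm ?E a = 1 \<and> A \<in> sets (count_space UNIV)
      \<and> (\<integral>i. G f i * indicator A i \<partial>count_space UNIV) < \<epsilon>
      \<and> (\<integral>i. G a i * indicator (- A) i \<partial>count_space UNIV) < \<epsilon>)"
  show ?thesis
  proof (cases ?hump)
    case True
    have "\<theta> * s = 1"
    proof (rule N.gliding_hump[where G = G and M = "count_space UNIV" and c = "c powr s" and C = "C powr s" and ?m0.0 = 0])
      fix \<eta> :: real assume \<eta>: "0 < \<eta>"
      \<comment> \<open>\<open>1 + \<eta>\<close> is distributed evenly over the power \<open>r\<close> inside and the power \<open>s / r\<close> outside\<close>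
      define \<eta>2 where "\<eta>2 = sqrt (1 + \<eta>) - 1"
      define \<eta>1 where "\<eta>1 = sqrt (1 + \<eta>) powr (r / s) - 1"
      have sq: "1 < sqrt (1 + \<eta>)" using \<eta> by simp
      have pos: "0 < \<eta>2" "0 < \<eta>1" using sq r s by (auto simp: \<eta>1_def \<eta>2_def)
      obtain K1 where K1: "0 < K1" "\<And>(x :: nat \<Rightarrow> real \<Rightarrow> 'k) m (a :: nat \<Rightarrow> 'k) (b :: nat \<Rightarrow> 'k) w. \<lbrakk>tail m a; tail m b\<rbrakk> \<Longrightarrow>
          norm (lincomb x (\<lambda>n. a n + b n) w) powr r
          \<le> (1 + \<eta>1) * norm (lincomb x a w) powr r + K1 * norm (lincomb x b w) powr r"
        using lincomb_powr_add[OF pos(2) r, where ?'a = real and ?'k = 'k] by blast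
      obtain K2 where K2: "0 < K2" "\<And>x y. \<lbrakk>0 \<le> x; 0 \<le> y\<rbrakk> \<Longrightarrow>
          (x + y) powr (s / r) \<le> (1 + \<eta>2) * x powr (s / r) + K2 * y powr (s / r)"
        using powr_add_le_eta[OF pos(1), of "s / r"] r s by auto
      have "G (\<lambda>n. a n + b n) i \<le> (1 + \<eta>) * G a i + (K2 * K1 powr (s / r)) * G b i" if ab: "tail 0 a" "tail 0 b" for a b i
      proof -
        have int: "integrable ?U (\<lambda>w. norm (lincomb (\<lambda>n. x n i) h w) powr r)" for h
          by (intro Lfun_integrable Lfun_lincomb r x)
        have "I (\<lambda>n. a n + b n) i \<le> (\<integral>w. (1 + \<eta>1) * norm (lincomb (\<lambda>n. x n i) a w) powr r
            + K1 * norm (lincomb (\<lambda>n. x n i) b w) powr r \<partial>?U)"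
          unfolding I_def using int K1(2)[OF ab] by (intro integral_mono) auto
        also have "\<dots> = (1 + \<eta>1) * I a i + K1 * I b i"
          using int by (simp add: I_def)
        finally have "G (\<lambda>n. a n + b n) i \<le> ((1 + \<eta>1) * I a i + K1 * I b i) powr (s / r)"
          unfolding G_def using r s by (intro powr_mono2 I_nonneg) auto
        also have "\<dots> \<le> (1 + \<eta>2) * ((1 + \<eta>1) * I a i) powr (s / r) + K2 * (K1 * I b i) powr (s / r)"
          using pos K1(1) by (intro K2 mult_nonneg_nonneg I_nonneg) auto
        also have "((1 + \<eta>1) * I a i) powr (s / r) = (1 + \<eta>1) powr (s / r) * G a i"
          using pos I_nonneg by (simp add: powr_mult G_def)
        also have "(1 + \<eta>1) powr (s / r) = sqrt (1 + \<eta>)"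
          using r s sq by (simp add: \<eta>1_def powr_powr)
        also have "(1 + \<eta>2) * (sqrt (1 + \<eta>) * G a i) = (sqrt (1 + \<eta>) * sqrt (1 + \<eta>)) * G a i"
          by (simp add: \<eta>2_def)
        also have "sqrt (1 + \<eta>) * sqrt (1 + \<eta>) = 1 + \<eta>" using \<eta> by simp
        also have "K2 * (K1 * I b i) powr (s / r) = (K2 * K1 powr (s / r)) * G b i"
          using K1(1) I_nonneg by (simp add: powr_mult G_def)
        finally show ?thesis .
      qed
      then show "\<exists>K>0. \<forall>a b i. tail 0 a \<longrightarrow> tail 0 b \<longrightarrow> G (\<lambda>n. a n + b n) i \<le> (1 + \<eta>) * G a i + K * G b i"
        using K1(1) K2(1) by (intro exI[of _ "K2 * K1 powr (s / r)"]) auto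
    next
      show "G (\<lambda>n. - a n) = G a" for a
        by (auto simp: G_def I_def lincomb_minus)
    qed (use True count_int G_lower G_upper G_nonneg cs in auto)
    then show ?thesis ..
  next
    case False
    then obtain f \<epsilon> m where f: "tail 0 f" and \<epsilon>: "0 < \<epsilon>"
      and no_hump: "\<not> (\<exists>a A. tail (max m 0) a \<and> qnorm ?E a = 1 \<and> A \<in> sets (count_space UNIV)
        \<and> (\<integral>i. G f i * indicator A i \<partial>count_space UNIV) < \<epsilon>
        \<and> (\<integral>i. G a i * indicator (- A) i \<partial>count_space UNIV) < \<epsilon>)"
      by blast
    obtain N where N: "norm (\<Sum>i. G f (i + N)) < \<epsilon>"
      using suminf_exist_split[OF \<epsilon> G_summable[OF f]] by blast
    have tail_int: "(\<integral>i. G f i * indicator {N..} i \<partial>count_space UNIV) < \<epsilon>"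
    proof -
      have s1: "summable (\<lambda>i. G f i * indicator {N..} i)"
        by (rule summable_comparison_test'[OF G_summable[OF f], of 0]) (auto simp: indicator_def G_nonneg)
      have "(\<integral>i. G f i * indicator {N..} i \<partial>count_space UNIV) = (\<Sum>i. G f i * indicator {N..} i)"
        using s1 G_nonneg by (intro integral_count_space_nat) (simp add: integrable_count_space_nat_iff)
      also have "\<dots> = (\<Sum>i. G f (i + N) * indicator {N..} (i + N)) + (\<Sum>i<N. G f i * indicator {N..} i)"
        by (rule suminf_split_initial_segment[OF s1])
      also have "\<dots> = (\<Sum>i. G f (i + N))" by simp
      finally show ?thesis using N by simp
    qed
    have head1: "\<epsilon> \<le> (\<Sum>i<N. G a i)" if a: "tail m a" "qnorm ?E a = 1" for a
    proof -
      have a0: "tail 0 a" using a(1) by (rule tail_mono) simp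
      have "\<epsilon> \<le> (\<integral>i. G a i * indicator (- {N..}) i \<partial>count_space UNIV)"
      proof (rule ccontr)
        assume "\<not> ?thesis"
        then have "tail (max m 0) a \<and> qnorm ?E a = 1 \<and> {N..} \<in> sets (count_space UNIV)
            \<and> (\<integral>i. G f i * indicator {N..} i \<partial>count_space UNIV) < \<epsilon>
            \<and> (\<integral>i. G a i * indicator (- {N..}) i \<partial>count_space UNIV) < \<epsilon>"
          using a tail_int by (simp add: not_le)
        with no_hump show False by blast
      qed
      also have "\<dots> = (\<integral>i. G a i * indicator {..<N} i \<partial>count_space UNIV)"
        by (intro Bochner_Integration.integral_cong) (auto simp: indicator_def)
      also have "\<dots> = (\<Sum>i<N. G a i)"
      proof -
        have "(\<lambda>i. G a i * indicator {..<N} i) sums (\<Sum>i<N. G a i * indicator {..<N} i)"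
          by (intro sums_finite) auto
        then have "summable (\<lambda>i. G a i * indicator {..<N} i)" "(\<Sum>i. G a i * indicator {..<N} i) = (\<Sum>i<N. G a i)"
          by (auto simp: sums_iff)
        then show ?thesis using G_nonneg
          by (subst integral_count_space_nat) (simp_all add: integrable_count_space_nat_iff)
      qed
      finally show ?thesis .
    qed
    have "0 < N"
    proof (rule ccontr)
      assume "\<not> 0 < N"
      moreover have "tail m (\<lambda>j. if j = m then 1 else 0 :: 'k)"
        by (auto simp: tail_def intro: finite_subset[of _ "{m}"])
      ultimately show False using head1[of "\<lambda>j. if j = m then 1 else 0"] \<epsilon> by (simp add: N.unit)
    qed
    define M where "M = count_space {..<N} \<Otimes>\<^sub>M ?U"
    interpret U: finite_measure ?U
      by (intro finite_measureI) (simp add: emeasure_restrict_space)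
    have M: "finite_measure M"
      unfolding M_def by (intro finite_measure_pair_measure finite_measure_count_space U.finite_measure_axioms) simp
    define y where "y n = (\<lambda>(i, w). x n i w)" for n
    have [measurable]: "x n i \<in> borel_measurable ?U" for n i using x by (rule Lfun_measurable)
    have y_meas: "y n \<in> borel_measurable M" for n
      unfolding y_def M_def by (rule measurable_pair_measure_countable1) auto
    have y_lincomb: "lincomb y a (i, w) = lincomb (\<lambda>n. x n i) a w" for a i w
      by (simp add: lincomb_def y_def)
    have lin_meas: "lincomb y a \<in> borel_measurable M" for a
      unfolding lincomb_def[abs_def] using y_meas by measurable
    have nn: "(\<integral>\<^sup>+z. ennreal (norm (lincomb y a z) powr r) \<partial>M) = ennreal (\<Sum>i<N. I a i)" for a
    proof -
      have "(\<integral>\<^sup>+z. ennreal (norm (lincomb y a z) powr r) \<partial>M)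
          = (\<integral>\<^sup>+i. \<integral>\<^sup>+w. ennreal (norm (lincomb y a (i, w)) powr r) \<partial>?U \<partial>count_space {..<N})"
        unfolding M_def using lin_meas[of a, unfolded M_def]
        by (intro U.nn_integral_fst[symmetric]) measurable
      also have "\<dots> = (\<integral>\<^sup>+i. ennreal (I a i) \<partial>count_space {..<N})"
        unfolding y_lincomb I_def
        by (intro nn_integral_cong nn_integral_eq_integral Lfun_integrable Lfun_lincomb r x) auto
      also have "\<dots> = ennreal (\<Sum>i<N. I a i)"
        using I_nonneg by (simp add: nn_integral_count_space_finite sum_ennreal)
      finally show ?thesis .
    qed
    have lin_int: "integrable M (\<lambda>z. norm (lincomb y a z) powr r)"
      and lin_val: "Lpow M r (lincomb y a) = (\<Sum>i<N. I a i)" for a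
    proof -
      have [measurable]: "lincomb y a \<in> borel_measurable M" by (rule lin_meas)
      show "integrable M (\<lambda>z. norm (lincomb y a z) powr r)"
        using nn[of a] by (intro integrableI_nonneg) auto
      show "Lpow M r (lincomb y a) = (\<Sum>i<N. I a i)"
        using nn[of a] I_nonneg by (intro integral_eq_nn_integral[THEN trans]) (auto simp: sum_nonneg)
    qed
    have yL: "y n \<in> Lfun M r" for n
    proof -
      have "lincomb y (\<lambda>j. if j = n then 1 else 0) = y n" by (rule ext) (rule lincomb_unit)
      then show ?thesis using lin_int[of "\<lambda>j. if j = n then 1 else 0"] y_meas[of n] by (simp add: Lfun_def)
    qed
    have val_upper: "Lpow M r (lincomb y a) \<le> (real N * (C powr s) powr (r / s)) * qnorm ?E a powr r"
      if a: "tail m a" for a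
    proof -
      have a0: "tail 0 a" using a by (rule tail_mono) simp
      have "I a i \<le> (C powr s) powr (r / s) * qnorm ?E a powr r" for i
      proof -
        have "G a i \<le> suminf (G a)"
          using sum_le_suminf[OF G_summable[OF a0], of "{i}"] G_nonneg by simp
        also have "\<dots> \<le> C powr s * qnorm ?E a powr s" by (rule G_upper[OF a0])
        finally have "G a i powr (r / s) \<le> (C powr s * qnorm ?E a powr s) powr (r / s)"
          using r s G_nonneg by (intro powr_mono2) auto
        then show ?thesis
          using r s I_nonneg by (simp add: G_def powr_powr powr_mult)
      qed
      then have "(\<Sum>i<N. I a i) \<le> (\<Sum>i<N. (C powr s) powr (r / s) * qnorm ?E a powr r)"
        by (intro sum_mono) auto
      then show ?thesis by (simp add: lin_val mult.assoc)
    qed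
    have val_lower: "((\<epsilon> / N) powr (r / s)) * qnorm ?E a powr r \<le> Lpow M r (lincomb y a)"
      if a: "tail m a" for a
    proof (cases "qnorm ?E a = 0")
      case True
      then show ?thesis by simp
    next
      case False
      have a0: "tail 0 a" using a by (rule tail_mono) simp
      have pos: "0 < qnorm ?E a" using N.nonneg[OF a0] False by simp
      let ?t = "of_real (1 / qnorm ?E a) :: 'k"
      have scale: "I (\<lambda>n. ?t * a n) i = I a i / qnorm ?E a powr r" for i
        unfolding I_def lincomb_mult[OF a] norm_mult using pos by (simp add: powr_mult powr_divide norm_divide)
      have "\<epsilon> \<le> (\<Sum>i<N. G (\<lambda>n. ?t * a n) i)"
        by (intro head1 tail_mult a N.normalise a0 False)
      also have "\<dots> \<le> (\<Sum>i<N. (\<Sum>i<N. I (\<lambda>n. ?t * a n) i) powr (s / r))"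
        unfolding G_def using r s I_nonneg by (intro sum_mono powr_mono2 member_le_sum) auto
      also have "\<dots> = N * (\<Sum>i<N. I (\<lambda>n. ?t * a n) i) powr (s / r)" by simp
      finally have "\<epsilon> / N \<le> (\<Sum>i<N. I (\<lambda>n. ?t * a n) i) powr (s / r)"
        using \<open>0 < N\<close> by (simp add: field_simps)
      then have "(\<epsilon> / N) powr (r / s) \<le> ((\<Sum>i<N. I (\<lambda>n. ?t * a n) i) powr (s / r)) powr (r / s)"
        using r s \<epsilon> by (intro powr_mono2) auto
      also have "\<dots> = (\<Sum>i<N. I a i) / qnorm ?E a powr r"
        unfolding scale using r s I_nonneg by (simp add: powr_powr sum_nonneg flip: sum_divide_distrib)
      finally show ?thesis using pos by (simp add: lin_val field_simps)
    qed
    have c': "0 < (\<epsilon> / N) powr (r / s)" using \<epsilon> \<open>0 < N\<close> by simp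
    show ?thesis
    proof (cases "r \<le> 2")
      case True
      then show ?thesis
        using N.type_cotype[OF r True yL c' val_lower val_upper] by simp
    next
      case False
      then show ?thesis
        using N.kadec_pelczynski[OF M _ yL c' val_lower val_upper] by simp
    qed
  qed
qed

lemma Lambda_ell_sum_L_unit:
  fixes r s :: real
  assumes r: "0 < r" and s: "0 < s"
  shows "r \<le> 2 \<Longrightarrow> Lambda (ell_sum s (L_unit r :: ('k::{real_normed_field, euclidean_space}, _) qspace))
      = {ereal r..2} \<union> {ereal s}"
    and "2 \<le> r \<Longrightarrow> Lambda (ell_sum s (L_unit r :: ('k::{real_normed_field, euclidean_space}, _) qspace))
      = {2, ereal r, ereal s}"
proof -
  let ?Y = "ell_sum s (L_unit r :: ('k, _) qspace)"
  have exps: "p = ereal s \<or> (r \<le> 2 \<and> ereal r \<le> p \<and> p \<le> 2) \<or> (2 \<le> r \<and> (p = ereal r \<or> p = 2))"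
    if "p \<in> Lambda ?Y" for p
  proof -
    have p: "0 < p" and emb: "qembeds (ell p) ?Y" using that by (auto simp: Lambda_def)
    note alt = exponents_of_embedded_ell[OF r s p emb]
    show ?thesis
    proof (cases "p = \<infinity>")
      case True
      then show ?thesis using alt by (simp add: reciprocal_def)
    next
      case False
      then obtain q where q: "p = ereal q" "0 < q" using p by (cases p) auto
      have "q = s \<or> (r \<le> 2 \<and> r \<le> q \<and> q \<le> 2) \<or> (2 \<le> r \<and> (q = r \<or> q = 2))"
        using alt q(2) unfolding q(1) reciprocal_def by (auto simp: field_simps)
      then show ?thesis unfolding q(1) by auto
    qed
  qed
  have "finite_measure (lebesgue_on {0..1::real})"
    by (intro finite_measureI) (simp add: emeasure_restrict_space)
  then have in_s: "ereal s \<in> Lambda ?Y"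
    using ell_embeds_outer[OF r s, of "lebesgue_on {0..1::real}", where ?'k = 'k] s
    by (simp add: Lambda_def measure_restrict_space)
  have in_r: "ereal r \<in> Lambda ?Y"
    using ell_embeds_inner[OF r s, where ?'k = 'k] r by (auto simp: Lambda_def)
  have in_2: "2 \<in> Lambda ?Y"
    using ell_2_embeds[OF r s, where ?'k = 'k] by (auto simp: Lambda_def)
  show "Lambda ?Y = {ereal r..2} \<union> {ereal s}" if "r \<le> 2"
  proof (rule antisym)
    show "Lambda ?Y \<subseteq> {ereal r..2} \<union> {ereal s}" using exps that by force
    have "p \<in> Lambda ?Y" if p: "ereal r \<le> p" "p \<le> 2" for p
    proof -
      obtain q where q: "p = ereal q" "r \<le> q" "q \<le> 2" using p by (cases p) auto
      then consider "q = r" | "q = 2" | "r < q" "q < 2" by linarith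
      then show ?thesis
      proof cases
        case 3
        then show ?thesis
          using ell_embeds_stable[OF r s 3, where ?'k = 'k] r q(1) by (auto simp: Lambda_def)
      qed (use in_r in_2 q(1) in auto)
    qed
    then show "{ereal r..2} \<union> {ereal s} \<subseteq> Lambda ?Y" using in_s by auto
  qed
  show "Lambda ?Y = {2, ereal r, ereal s}" if "2 \<le> r"
  proof (rule antisym)
    show "Lambda ?Y \<subseteq> {2, ereal r, ereal s}" using exps that by force
    show "{2, ereal r, ereal s} \<subseteq> Lambda ?Y" using in_s in_r in_2 by auto
  qed
qed

theorem theorem3p3:
  fixes r s :: real
  assumes "0 < r" and "0 < s"
  shows
    "(r \<le> s \<and> s \<le> 2 \<longrightarrow>
        Lambda (ell_sum s (L_unit r :: (real, _) qspace)) = {ereal r..2} \<and>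
        Lambda (ell_sum s (L_unit r :: (complex, _) qspace)) = {ereal r..2}) \<and>
     (r \<le> 2 \<and> 2 \<le> s \<longrightarrow>
        Lambda (ell_sum s (L_unit r :: (real, _) qspace)) = {ereal r..2} \<union> {ereal s} \<and>
        Lambda (ell_sum s (L_unit r :: (complex, _) qspace)) = {ereal r..2} \<union> {ereal s}) \<and>
     (2 \<le> r \<and> r \<le> s \<longrightarrow>
        Lambda (ell_sum s (L_unit r :: (real, _) qspace)) = {2, ereal r, ereal s} \<and>
        Lambda (ell_sum s (L_unit r :: (complex, _) qspace)) = {2, ereal r, ereal s}) \<and>
     (s \<le> r \<and> r \<le> 2 \<longrightarrow>
        Lambda (ell_sum s (L_unit r :: (real, _) qspace)) = {ereal r..2} \<union> {ereal s} \<and>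
        Lambda (ell_sum s (L_unit r :: (complex, _) qspace)) = {ereal r..2} \<union> {ereal s}) \<and>
     (max 2 s \<le> r \<longrightarrow>
        Lambda (ell_sum s (L_unit r :: (real, _) qspace)) = {2, ereal r, ereal s} \<and>
        Lambda (ell_sum s (L_unit r :: (complex, _) qspace)) = {2, ereal r, ereal s})"
proof -
  have "{ereal r..2} \<union> {ereal s} = {ereal r..2}" if "r \<le> s" "s \<le> 2"
    using that by auto
  then show ?thesis
    by (simp add: Lambda_ell_sum_L_unit[OF assms])
qed

end
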